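(* Fix $\chi>0$. For $k=1,2,3$ and $n\ge 0$ the following estimates hold: $$\|p_{n,k}\|_2^2<\|s_{n,k}\|_2^2<\|s_{n,k}\|_S^2<\|P_{n,k}\|_S^2=\|P_{n,k}\|_2^2+\chi\|P_{n-1,k}\|_2^2 ,$$ where $P_{-1,k}:=0$. In addition, for any $0<r<\infty$ there exist positive constants $c_1,c_r$ such that (for $n\ge1$) $$\|s_{n,k}\|_S<(1+\chi)\left(c_1\,((n-1)!)^{-\log 5/\log 2}+c_r\,r^{-n}\right).$$ Consequently, $\lim_{n\to\infty}\|s_{n,k}\|_S=\lim_{n\to\infty}\|s_{n,k}\|_2=0$.
   Context: Sierpinski gasket: let $q_0=(\tfrac12,\tfrac{\sqrt3}{2})$, $q_1=(0,0)$, $q_2=(1,0)$, $V_0=\{q_0,q_1,q_2\}$, $F_i(x)=\tfrac12(x-q_i)+q_i$, and let $SG\subset\mathbb R^2$ be the unique nonempty compact set with $SG=\bigcup_{i=0}^2F_i(SG)$. For a word $w=(w_1,\dots,w_m)\in\{0,1,2\}^m$, $|w|=m$, put $F_w=F_{w_1}\circ\cdots\circ F_{w_m}$; $F_w(SG)$ is called an $m$-cell; $V_m=\bigcup_{|w|=m}F_w(V_0)$; distinct $x,y\in V_m$ satisfy $x\sim_m y$ if they lie in a common $m$-cell. $\mu$ is the self-similar Borel probability measure with $\mu(F_w(SG))=3^{-|w|}$. All functions are real-valued. Energy and Laplacian: $\mathscr E(u,v)=\lim_{m\to\infty}(3/5)^{-m}\sum_{x\sim_m y}(u(x)-u(y))(v(x)-v(y))$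 (sum over unordered pairs), and $u\in\operatorname{dom}\mathscr E$ if $\mathscr E(u,u)$ exists and is finite. For $u\in\operatorname{dom}\mathscr E$ and $f$ continuous, $\Delta u=f$ means $\mathscr E(u,v)=-\int_{SG}fv\,d\mu$ for all $v\in\operatorname{dom}\mathscr E$ vanishing on $V_0$. Indices of $q_i$ are mod 3. Normal derivative: $\partial_nu(q_i)=\lim_m(5/3)^m(2u(q_i)-u(F_i^mq_{i+1})-u(F_i^mq_{i-1}))$. Tangential derivative: $\partial_Tu(q_i)=\lim_m5^m(u(F_i^mq_{i+1})-u(F_i^mq_{i-1}))$. Monomials: for $j\ge0$, $k\in\{1,2,3\}$, $P_{j,k}$ is the unique function with $\Delta^{j+1}P_{j,k}=0$ such that for all $0\le n\le j$: $\Delta^nP_{j,k}(q_0)=\delta_{nj}\delta_{k1}$, $\partial_n\Delta^nP_{j,k}(q_0)=\delta_{nj}\delta_{k2}$, $\partial_T\Delta^nP_{j,k}(q_0)=\delta_{nj}\delta_{k3}$. In particular $\Delta P_{j,k}=P_{j-1,k}$ with $P_{-1,k}=0$. Inner products: $\langle f,g\rangle_2=\int_{SG}fg\,d\mu$ with norm $\|\cdot\|_2$; $\langle f,g\rangle_S=\int_{SG}fg\,d\mu+\chi\int_{SG}\Delta f\,\Delta g\,d\mu$ with norm $\|\cdot\|_S$. For fixed $k$, $\{p_{n,k}\}_{n\ge0}$ (Legendre) and $\{s_{n,k}\}_{n\ge0}$ (Sobolev-Legendre) are the monic orthogonal polynomials obtained from $P_{0,k},P_{1,k},\dots$ by Gram-Schmidt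 without normalization with respect to $\langle\cdot,\cdot\rangle_2$ and $\langle\cdot,\cdot\rangle_S$ respectively; i.e. each of $p_{n,k}$, $s_{n,k}$ equals $P_{n,k}$ plus a linear combination of $P_{0,k},\dots,P_{n-1,k}$ and is orthogonal to $P_{0,k},\dots,P_{n-1,k}$.
   Formalization: The strict chain is false for n=0 (p_0=s_0=P_0 and ΔP_0=0, so all terms are equal) and its first inequality is false for n=1 (p_1=s_1); the formal statement has equalities exactly there and the full strict chain for n≥2. *)

theory Defs
  imports "HOL-Probability.Probability"
begin

text \<open>The indices of the vertices and of the contractions are read mod 3, so index
  \<open>i - 1\<close> is written \<open>i + 2\<close> below.\<close>

definition q :: "nat \<Rightarrow> real \<times> real" where
  "q i = (if i mod 3 = 0 then (1/2, sqrt 3 / 2) else if i mod 3 = 1 then (0, 0) else (1, 0))"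

definition F :: "nat \<Rightarrow> real \<times> real \<Rightarrow> real \<times> real" where
  "F i x = (1/2) *\<^sub>R (x - q i) + q i"

definition SG :: "(real \<times> real) set" where
  "SG = (THE K. compact K \<and> K \<noteq> {} \<and> K = (\<Union>i\<in>{0,1,2}. F i ` K))"

definition words :: "nat \<Rightarrow> nat list set" where
  "words m = {w. length w = m \<and> set w \<subseteq> {0,1,2}}"

definition Fw :: "nat list \<Rightarrow> real \<times> real \<Rightarrow> real \<times> real" where
  "Fw w = foldr (\<lambda>i g. F i \<circ> g) w id"

definition V0 :: "(real \<times> real) set" where
  "V0 = {q 0, q 1, q 2}"

definition V :: "nat \<Rightarrow> (real \<times> real) set" where
  "V m = (\<Union>w\<in>words m. Fw w ` V0)"

definition adj :: "nat \<Rightarrow> real \<times> real \<Rightarrow> real \<times> real \<Rightarrow> bool" where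
  "adj m x y \<longleftrightarrow> x \<in> V m \<and> y \<in> V m \<and> x \<noteq> y \<and>
     (\<exists>w\<in>words m. x \<in> Fw w ` SG \<and> y \<in> Fw w ` SG)"

text \<open>The standard measure, as a Borel measure on the plane carried by \<open>SG\<close>
  (the empty word gives it mass 1 there).\<close>

definition mu :: "(real \<times> real) measure" where
  "mu = (THE M. sets M = sets borel \<and> prob_space M \<and>
     (\<forall>A\<in>sets borel. measure M A = (\<Sum>i<3. measure M (F i -` A)) / 3) \<and>
     (\<forall>m. \<forall>w\<in>words m. measure M (Fw w ` SG) = (1/3) ^ m))"

text \<open>Functions on \<open>SG\<close> are functions on the plane of which only the values on \<open>SG\<close> matter.\<close>

text \<open>The factor 1/2 is there because the sum is over ordered pairs.\<close>

definition energy_level ::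
    "nat \<Rightarrow> (real \<times> real \<Rightarrow> real) \<Rightarrow> (real \<times> real \<Rightarrow> real) \<Rightarrow> real" where
  "energy_level m u v = (3/5) powi (- int m) *
     ((1/2) * (\<Sum>(x, y) | adj m x y. (u x - u y) * (v x - v y)))"

definition energy :: "(real \<times> real \<Rightarrow> real) \<Rightarrow> (real \<times> real \<Rightarrow> real) \<Rightarrow> real" where
  "energy u v = lim (\<lambda>m. energy_level m u v)"

text \<open>The energy only sees the values on the countable null set of all vertices; as usual,
  a function of finite energy is identified with the continuous extension of these values,
  so the domain consists of continuous functions.\<close>

definition dom_energy :: "(real \<times> real \<Rightarrow> real) set" where
  "dom_energy = {u. continuous_on SG u \<and> convergent (\<lambda>m. energy_level m u u)}"

definition has_laplacian :: "(real \<times> real \<Rightarrow> real) \<Rightarrow> (real \<times> real \<Rightarrow> real) \<Rightarrow> bool" where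
  "has_laplacian u f \<longleftrightarrow> u \<in> dom_energy \<and> continuous_on SG f \<and>
     (\<forall>v\<in>dom_energy. (\<forall>x\<in>V0. v x = 0) \<longrightarrow> energy u v = - (LINT x:SG|mu. f x * v x))"

text \<open>The Laplacian is determined on \<open>SG\<close> only; it is extended by 0.\<close>

definition laplacian :: "(real \<times> real \<Rightarrow> real) \<Rightarrow> real \<times> real \<Rightarrow> real" where
  "laplacian u = (THE f. has_laplacian u f \<and> (\<forall>x. x \<notin> SG \<longrightarrow> f x = 0))"

definition has_normal_derivative :: "(real \<times> real \<Rightarrow> real) \<Rightarrow> nat \<Rightarrow> real \<Rightarrow> bool" where
  "has_normal_derivative u i d \<longleftrightarrow>
     (\<lambda>m. (5/3) ^ m * (2 * u (q i) - u ((F i ^^ m) (q (i + 1))) - u ((F i ^^ m) (q (i + 2)))))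
       \<longlonglongrightarrow> d"

definition has_tangential_derivative :: "(real \<times> real \<Rightarrow> real) \<Rightarrow> nat \<Rightarrow> real \<Rightarrow> bool" where
  "has_tangential_derivative u i d \<longleftrightarrow>
     (\<lambda>m. 5 ^ m * (u ((F i ^^ m) (q (i + 1))) - u ((F i ^^ m) (q (i + 2))))) \<longlonglongrightarrow> d"

definition is_monomial :: "nat \<Rightarrow> nat \<Rightarrow> (real \<times> real \<Rightarrow> real) \<Rightarrow> bool" where
  "is_monomial j k u \<longleftrightarrow>
     (\<forall>n\<le>j. \<exists>f. has_laplacian ((laplacian ^^ n) u) f) \<and>
     (\<forall>x\<in>SG. (laplacian ^^ (j + 1)) u x = 0) \<and>
     (\<forall>n\<le>j. (laplacian ^^ n) u (q 0) = of_bool (n = j \<and> k = 1) \<and>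
        has_normal_derivative ((laplacian ^^ n) u) 0 (of_bool (n = j \<and> k = 2)) \<and>
        has_tangential_derivative ((laplacian ^^ n) u) 0 (of_bool (n = j \<and> k = 3)))"

text \<open>Uniqueness holds on \<open>SG\<close>, whence the extension by 0.\<close>

definition Pmon :: "nat \<Rightarrow> nat \<Rightarrow> real \<times> real \<Rightarrow> real" where
  "Pmon j k = (THE u. is_monomial j k u \<and> (\<forall>x. x \<notin> SG \<longrightarrow> u x = 0))"

definition ip2 :: "(real \<times> real \<Rightarrow> real) \<Rightarrow> (real \<times> real \<Rightarrow> real) \<Rightarrow> real" where
  "ip2 f g = (LINT x:SG|mu. f x * g x)"

definition ipS :: "real \<Rightarrow> (real \<times> real \<Rightarrow> real) \<Rightarrow> (real \<times> real \<Rightarrow> real) \<Rightarrow> real" where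
  "ipS chi f g = (LINT x:SG|mu. f x * g x) + chi * (LINT x:SG|mu. laplacian f x * laplacian g x)"

definition norm2 :: "(real \<times> real \<Rightarrow> real) \<Rightarrow> real" where
  "norm2 f = sqrt (ip2 f f)"

definition normS :: "real \<Rightarrow> (real \<times> real \<Rightarrow> real) \<Rightarrow> real" where
  "normS chi f = sqrt (ipS chi f f)"

text \<open>Gram-Schmidt without normalization with respect to the inner product \<open>B\<close>.\<close>

fun monic_orth ::
    "(('a \<Rightarrow> real) \<Rightarrow> ('a \<Rightarrow> real) \<Rightarrow> real) \<Rightarrow> (nat \<Rightarrow> 'a \<Rightarrow> real) \<Rightarrow> nat \<Rightarrow> 'a \<Rightarrow> real" where
  "monic_orth B v n = (\<lambda>x. v n x -
     (\<Sum>i<n. B (v n) (monic_orth B v i) / B (monic_orth B v i) (monic_orth B v i)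
               * monic_orth B v i x))"

declare monic_orth.simps [simp del]

definition legendre :: "nat \<Rightarrow> nat \<Rightarrow> real \<times> real \<Rightarrow> real" where
  "legendre n k = monic_orth ip2 (\<lambda>j. Pmon j k) n"

definition sobolev_legendre :: "real \<Rightarrow> nat \<Rightarrow> nat \<Rightarrow> real \<times> real \<Rightarrow> real" where
  "sobolev_legendre chi n k = monic_orth (ipS chi) (\<lambda>j. Pmon j k) n"

end

theory Submission
  imports Defs "HOL-Computational_Algebra.Formal_Power_Series"
begin

text \<open>The Poisson equation \<open>\<Delta> u = f\<close> is solved by a self-similar construction, and the solution
  satisfies the Green formula against every continuous function. This gives uniqueness,
  makes the monomials explicit, and lets one test with functions that need not have finite energy.

  The inequalities between the norms come from the minimality of monic orthogonal polynomials,
  except that strictness needs an argument. For \<open>s\<^sub>n \<noteq> P\<^sub>n\<close> one shows \<open>\<integral> P\<^sub>n P\<^sub>0 d\<mu> \<noteq> 0\<close>: this integral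
  is a boundary term, and the formal power series of the boundary values of \<open>P\<^sub>0, P\<^sub>1, \<dots>\<close> satisfy
  functional equations that come from the Dirichlet-to-Neumann map of \<open>\<Delta> u = z u\<close> and the dilation
  \<open>z \<mapsto> 5 z\<close>. For \<open>k = 1, 3\<close> the resulting recurrences have positive terms, for \<open>k = 2\<close> the
  3-adic valuations of two summands differ. For \<open>p\<^sub>n \<noteq> s\<^sub>n\<close>, equality would make \<open>\<Delta> p\<^sub>n\<close> orthogonal
  to \<open>p\<^sub>n\<close> and to \<open>P\<^sub>0\<close>, and then \<open>p\<^sub>n\<close> minus its harmonic part has no energy.

  For the decay, let \<open>T\<close> be a solution operator of the Poisson equation with \<open>T P\<^sub>n = P\<^sub>n\<^sub>+\<^sub>1\<close> up to
  a multiple of \<open>P\<^sub>0\<close>. Since \<open>T\<close> maps \<open>L\<^sup>2\<close> to bounded functions, Bessel's inequality at each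
  point shows that \<open>\<parallel>T p\<^sub>n\<parallel>\<^sup>2 / \<parallel>p\<^sub>n\<parallel>\<^sup>2\<close> is summable, while
  \<open>\<parallel>p\<^sub>n\<^sub>+\<^sub>1\<parallel> \<le> \<parallel>T p\<^sub>n\<parallel>\<close> by minimality, so the norms decay
  faster than every geometric sequence.\<close>

section \<open>The gasket\<close>

text \<open>Testing with all continuous functions pays off in the uniqueness of
  \<open>\<Delta> u\<close>: the natural test function is the source itself times a weight vanishing
  at the corners, and nothing is known about the energy of such a product. The strict inequalities
  have genuine exceptions in low degree. As \<open>P\<^sub>0\<close> is harmonic, the two inner
  products agree as soon as one argument is \<open>P\<^sub>0\<close>; hence both orthogonalizations
  coincide in degrees 0 and 1, and in degree 0 all the norms agree. The prime 3 enters because 5 is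
  -1 mod 3. The recurrences divide by numbers \<open>5 ^ n - 1\<close>, which are 3-adic units for
  odd \<open>n\<close> and equal 3 times \<open>n / 2\<close> times a unit for even
  \<open>n\<close>. So the 3-adic part of every denominator is governed by powers of 3 and
  factorials, and an exact valuation can be carried through an induction although the signs cannot.
  For the decay of the Sobolev norms, \<open>T p\<^sub>n\<close> is a monic competitor of degree
  \<open>n + 1\<close> whose Laplacian is \<open>p\<^sub>n\<close> itself, so that the
  \<open>L^2\<close> norm of \<open>p\<^sub>n\<close> controls both parts of its Sobolev
  norm.\<close>

lemma less3_cases:
  assumes "(i::nat) < 3" obtains "i = 0" | "i = 1" | "i = 2"
  using assms by linarith

lemma all_less3: "(\<forall>i<3. P i) \<longleftrightarrow> P 0 \<and> P 1 \<and> P (2::nat)"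
  by (auto elim: less3_cases)

lemma sum_less3: "(\<Sum>i<3. f i) = f 0 + f 1 + f (2::nat)"
  for f :: "nat \<Rightarrow> 'a::comm_monoid_add"
  by (simp add: eval_nat_numeral lessThan_Suc ac_simps)

lemma UN_less3: "(\<Union>i<3. X i) = (\<Union>i\<in>{0,1,2::nat}. X i)"
proof -
  have "{..<3} = {0, 1, 2::nat}" by auto
  thus ?thesis by simp
qed

lemma q_simps [simp]: "q 0 = (1/2, sqrt 3 / 2)" "q (Suc 0) = (0, 0)" "q 2 = (1, 0)"
  by (auto simp: q_def)

lemma F_eq: "F i x = (1/2) *\<^sub>R x + (1/2) *\<^sub>R q i"
  by (simp add: F_def algebra_simps) (metis scaleR_half_double scaleR_right_distrib)

definition Finv :: "nat \<Rightarrow> real \<times> real \<Rightarrow> real \<times> real" where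
  "Finv i x = 2 *\<^sub>R x - q i"

lemma Finv_F [simp]: "Finv i (F i x) = x"
  by (simp add: Finv_def F_eq scaleR_right_distrib)

lemma F_Finv [simp]: "F i (Finv i x) = x"
  by (simp add: Finv_def F_eq algebra_simps)

lemma F_eq_iff [simp]: "F i x = F i y \<longleftrightarrow> x = y"
  by (metis Finv_F)

lemma vimage_F: "F i -` A = Finv i ` A"
  by (auto intro: image_eqI[of _ _ "F i _"])

lemma F_image_eq: "F i ` A = Finv i -` A"
  by (auto intro: image_eqI[of _ _ "Finv i _"])

lemma F_q_self [simp]: "F i (q i) = q i"
  by (simp add: F_def)

lemma F_q_swap: "F i (q j) = F j (q i)"
  by (simp add: F_eq add.commute)

lemma dist_F [simp]: "dist (F i x) (F i y) = dist x y / 2"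
proof -
  have "F i x - F i y = (1/2) *\<^sub>R (x - y)" by (simp add: F_eq algebra_simps)
  thus ?thesis by (simp add: dist_norm)
qed

lemma continuous_F [continuous_intros]: "continuous_on S (F i)"
  unfolding F_def by (intro continuous_intros)

lemma continuous_Finv [continuous_intros]: "continuous_on S (Finv i)"
  unfolding Finv_def by (intro continuous_intros)

lemma F_measurable [measurable]: "F i \<in> borel_measurable borel"
  by (intro borel_measurable_continuous_onI continuous_F)

text \<open>Barycentric coordinates with respect to the triangle \<open>q 0, q 1, q 2\<close>.\<close>

definition lam :: "nat \<Rightarrow> real \<times> real \<Rightarrow> real" where
  "lam j x = (if j = 0 then 2 * snd x / sqrt 3
     else if j = 1 then 1 - fst x - snd x / sqrt 3 else fst x - snd x / sqrt 3)"

lemma continuous_lam [continuous_intros]: "continuous_on S (lam j)"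
proof (cases "j = 0 \<or> j = 1")
  case True
  thus ?thesis unfolding lam_def[abs_def] by (auto intro!: continuous_intros)
next
  case False
  hence "lam j = (\<lambda>x. fst x - snd x / sqrt 3)" by (auto simp: lam_def)
  thus ?thesis by (auto intro!: continuous_intros)
qed

lemma lam_F:
  assumes "i < 3" "j < 3"
  shows "lam j (F i x) = lam j x / 2 + (if i = j then 1/2 else 0)"
proof -
  consider "i = 0" | "i = 1" | "i = 2" using assms(1) by (rule less3_cases)
  thus ?thesis
  proof cases
    case 1
    have "sqrt 3 / 2 / sqrt 3 = (1/2 :: real)" by simp
    thus ?thesis unfolding 1 lam_def F_eq by (auto simp: add_divide_distrib)
  next
    case 2
    thus ?thesis using assms(2) unfolding lam_def F_eq by (auto simp: diff_divide_distrib)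
  next
    case 3
    thus ?thesis using assms(2) unfolding lam_def F_eq by (auto simp: diff_divide_distrib)
  qed
qed

lemma lam_q:
  assumes "i < 3" "j < 3"
  shows "lam j (q i) = of_bool (i = j)"
proof -
  consider "i = 0" | "i = 1" | "i = 2" using assms(1) by (rule less3_cases)
  thus ?thesis using assms(2) by cases (auto simp: lam_def)
qed

lemma lam_sum: "lam 0 x + lam 1 x + lam 2 x = 1"
  by (simp add: lam_def)

lemma point_eq_lam: "x = lam 0 x *\<^sub>R q 0 + lam 1 x *\<^sub>R q 1 + lam 2 x *\<^sub>R q 2"
  by (cases x) (simp add: lam_def algebra_simps add_divide_distrib[symmetric])

lemma eq_if_lam_eq: "(\<And>j. j < 3 \<Longrightarrow> lam j x = lam j y) \<Longrightarrow> x = y"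
  by (subst point_eq_lam, subst (2) point_eq_lam) simp

definition triangle :: "(real \<times> real) set" where
  "triangle = {x. \<forall>j<3. 0 \<le> lam j x}"

lemma q_in_triangle: "i < 3 \<Longrightarrow> q i \<in> triangle"
  by (auto simp: triangle_def lam_q)

lemma F_triangle: "i < 3 \<Longrightarrow> F i ` triangle \<subseteq> triangle"
  by (auto simp: triangle_def lam_F)

lemma norm_q: "norm (q i) \<le> 1"
  by (auto simp: q_def norm_Pair power_divide)

lemma triangle_norm: "x \<in> triangle \<Longrightarrow> norm x \<le> 1"
proof -
  assume x: "x \<in> triangle"
  hence l: "lam 0 x \<ge> 0" "lam 1 x \<ge> 0" "lam 2 x \<ge> 0"
    by (auto simp: triangle_def)
  have "norm (lam 0 x *\<^sub>R q 0 + lam 1 x *\<^sub>R q 1 + lam 2 x *\<^sub>R q 2)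
      \<le> norm (lam 0 x *\<^sub>R q 0) + norm (lam 1 x *\<^sub>R q 1) + norm (lam 2 x *\<^sub>R q 2)"
    by (intro norm_triangle_le add_right_mono norm_triangle_ineq)
  also have "\<dots> \<le> lam 0 x * 1 + lam 1 x * 1 + lam 2 x * 1"
    unfolding norm_scaleR using l by (intro add_mono mult_mono norm_q) auto
  also have "\<dots> = 1" using lam_sum[of x] by simp
  finally show ?thesis using point_eq_lam[of x] by simp
qed

lemma compact_triangle: "compact triangle"
proof -
  have "bounded triangle"
    using triangle_norm by (meson bounded_iff)
  moreover have "triangle = (\<Inter>j\<in>{..<3}. {x. 0 \<le> lam j x})"
    by (auto simp: triangle_def)
  moreover have "closed (\<Inter>j\<in>{..<3}. {x. 0 \<le> lam j x})"
    by (intro closed_INT ballI closed_Collect_le continuous_intros)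
  ultimately show ?thesis by (simp add: compact_eq_bounded_closed)
qed

section \<open>Existence and uniqueness of the attractor\<close>

fun approx_SG :: "nat \<Rightarrow> (real \<times> real) set" where
  "approx_SG 0 = triangle"
| "approx_SG (Suc n) = (\<Union>i<3. F i ` approx_SG n)"

lemma approx_SG_props: "compact (approx_SG n) \<and> approx_SG n \<noteq> {} \<and> approx_SG (Suc n) \<subseteq> approx_SG n"
proof (induction n)
  case 0
  then show ?case using compact_triangle q_in_triangle[of 0] F_triangle by auto
next
  case (Suc n)
  have "compact (approx_SG (Suc n))"
    using Suc by (auto intro!: compact_UN compact_continuous_image continuous_intros)
  moreover have "approx_SG (Suc n) \<noteq> {}"
    using Suc unfolding approx_SG.simps by (metis SUP_bot_conv(2) image_is_empty lessThan_iff zero_less_numeral)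
  moreover have "approx_SG (Suc (Suc n)) \<subseteq> approx_SG (Suc n)"
    using Suc by (subst (1 2) approx_SG.simps) blast
  ultimately show ?case by blast
qed

lemma approx_SG_antimono: "m \<le> n \<Longrightarrow> approx_SG n \<subseteq> approx_SG m"
  using approx_SG_props lift_Suc_antimono_le[of approx_SG m n] by blast

lemma attractor_exists:
  "\<exists>K. compact K \<and> K \<noteq> {} \<and> K \<subseteq> triangle \<and> K = (\<Union>i<3. F i ` K)"
proof (intro exI conjI)
  let ?K = "\<Inter>n. approx_SG n"
  show "compact ?K"
    using approx_SG_props by (intro compact_Inter) auto
  show "?K \<noteq> {}"
    using approx_SG_props approx_SG_antimono by (intro compact_nest) blast+
  show "?K \<subseteq> triangle" using approx_SG.simps(1) by blast
  show "?K = (\<Union>i<3. F i ` ?K)"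
  proof (intro equalityI subsetI)
    fix x assume x: "x \<in> ?K"
    \<comment> \<open>At every level some branch works; as the sets decrease, one of the three
      branches must work at all levels.\<close>
    have "\<exists>i<3. \<forall>n. Finv i x \<in> approx_SG n"
    proof (rule ccontr)
      assume "\<not> ?thesis"
      then obtain N where N: "\<And>i. i < 3 \<Longrightarrow> Finv i x \<notin> approx_SG (N i)" by metis
      define M where "M = Max (N ` {..<3})"
      have "N i \<le> M" if "i < 3" for i using that by (auto simp: M_def)
      hence "\<And>i. i < 3 \<Longrightarrow> Finv i x \<notin> approx_SG M" using N approx_SG_antimono by blast
      moreover have "x \<in> approx_SG (Suc M)" using x by blast
      ultimately show False by (auto simp: F_image_eq)
    qed
    then obtain i where "i < 3" "Finv i x \<in> ?K" by blast
    thus "x \<in> (\<Union>i<3. F i ` ?K)" by (metis F_Finv UN_I imageI lessThan_iff)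
  next
    fix x assume "x \<in> (\<Union>i<3. F i ` ?K)"
    then obtain i y where i: "i < 3" "y \<in> ?K" "x = F i y" by blast
    have "x \<in> approx_SG n" for n
    proof -
      have "x \<in> approx_SG (Suc n)" using i by auto
      thus ?thesis using approx_SG_props by blast
    qed
    thus "x \<in> ?K" by blast
  qed
qed

text \<open>The point of \<open>K\<close> farthest from \<open>L\<close> is an image under some
  \<open>F i\<close> of another point of \<open>K\<close>, and \<open>F i\<close> halves the
  distance to \<open>L\<close>. So the maximal distance is at most half of itself.\<close>

lemma attractor_subset:
  assumes K: "compact K" "K = (\<Union>i<3. F i ` K)"
    and L: "compact L" "L \<noteq> {}" "L = (\<Union>i<3. F i ` L)"
  shows "K \<subseteq> L"
proof (cases "K = {}")
  case False
  have cont: "continuous_on K (\<lambda>x. infdist x L)" by (intro continuous_intros)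
  obtain x where x: "x \<in> K" "\<And>y. y \<in> K \<Longrightarrow> infdist y L \<le> infdist x L"
    using continuous_attains_sup[OF K(1) False cont] by blast
  then obtain i y where y: "i < 3" "y \<in> K" "x = F i y" using K(2) by blast
  obtain z where z: "z \<in> L" "infdist y L = dist y z"
    using infdist_attains_inf[OF compact_imp_closed[OF L(1)] L(2)] by metis
  have "F i z \<in> L" using z y L(3) by blast
  hence "infdist x L \<le> dist y z / 2" using infdist_le[of "F i z" L x] y by simp
  moreover have "dist y z \<le> infdist x L" using z(2) x(2)[OF y(2)] by simp
  ultimately have "infdist x L \<le> 0" by linarith
  hence "infdist w L = 0" if "w \<in> K" for w
    using x(2)[OF that] infdist_nonneg[of w L] by linarith
  thus ?thesis using in_closed_iff_infdist_zero[OF compact_imp_closed[OF L(1)] L(2)] by auto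
qed auto

lemma SG_unique:
  assumes "compact K" "K \<noteq> {}" "K = (\<Union>i<3. F i ` K)"
  shows "SG = K"
  unfolding SG_def UN_less3[symmetric]
proof (rule the_equality)
  show "compact K \<and> K \<noteq> {} \<and> K = (\<Union>i<3. F i ` K)" using assms by blast
  fix L assume "compact L \<and> L \<noteq> {} \<and> L = (\<Union>i<3. F i ` L)"
  thus "L = K" using attractor_subset[of K L] attractor_subset[of L K] assms by blast
qed

lemma
  shows compact_SG: "compact SG" and SG_nonempty: "SG \<noteq> {}"
    and SG_subset_triangle: "SG \<subseteq> triangle" and SG_eq: "SG = (\<Union>i<3. F i ` SG)"
proof -
  obtain K where K: "compact K" "K \<noteq> {}" "K \<subseteq> triangle" "K = (\<Union>i<3. F i ` K)"
    using attractor_exists by blast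
  hence "SG = K" using SG_unique by blast
  thus "compact SG" "SG \<noteq> {}" "SG \<subseteq> triangle" "SG = (\<Union>i<3. F i ` SG)"
    using K by simp_all
qed

lemma closed_SG: "closed SG" using compact_SG compact_imp_closed by blast

lemma SG_borel [measurable]: "SG \<in> sets borel" using closed_SG by simp

lemma F_SG: "i < 3 \<Longrightarrow> x \<in> SG \<Longrightarrow> F i x \<in> SG"
  using SG_eq by blast

lemma SG_cases:
  assumes "x \<in> SG" obtains i y where "i < 3" "y \<in> SG" "x = F i y"
  using assms SG_eq by blast

lemma SG_norm: "x \<in> SG \<Longrightarrow> norm x \<le> 1"
  using SG_subset_triangle triangle_norm by blast

lemma SG_dist: "x \<in> SG \<Longrightarrow> y \<in> SG \<Longrightarrow> dist x y \<le> 2"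
  using SG_norm[of x] SG_norm[of y] norm_triangle_ineq4[of x y] by (simp add: dist_norm)

text \<open>\<open>F i\<close> fixes \<open>q i\<close>, preserves \<open>SG\<close> and halves
  distances, so the distance from \<open>q i\<close> to \<open>SG\<close> is at most half of
  itself.\<close>

lemma q_in_SG [simp]: "i < 3 \<Longrightarrow> q i \<in> SG"
proof -
  assume i: "i < 3"
  obtain z where z: "z \<in> SG" "infdist (q i) SG = dist (q i) z"
    using infdist_attains_inf[OF closed_SG SG_nonempty] by metis
  have "infdist (q i) SG \<le> dist (q i) (F i z)" using F_SG[OF i z(1)] by (rule infdist_le)
  also have "\<dots> = dist (q i) z / 2" using dist_F[of i "q i" z] by simp
  finally have "infdist (q i) SG = 0" using z(2) infdist_nonneg[of "q i" SG] by linarith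
  thus ?thesis using in_closed_iff_infdist_zero[OF closed_SG SG_nonempty] by simp
qed

text \<open>On the image of \<open>F i\<close> the \<open>i\<close>-th barycentric coordinate is at
  least 1/2. As the coordinates sum to 1, a common point of two cells has the coordinates
  \<open>i\<close> and \<open>j\<close> equal to 1/2 and the third equal to 0: it is the midpoint of
  an edge.\<close>

lemma triangle_cells_meet:
  assumes "i < 3" "j < 3" "i \<noteq> j" "x \<in> triangle" "y \<in> triangle" "F i x = F j y"
  shows "x = q j" "y = q i"
proof -
  have e: "lam l (F i x) = lam l (F j y)" for l using assms(6) by simp
  have p: "lam 0 x \<ge> 0" "lam 1 x \<ge> 0" "lam 2 x \<ge> 0" "lam 0 y \<ge> 0" "lam 1 y \<ge> 0" "lam 2 y \<ge> 0"
    using assms by (auto simp: triangle_def)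
  have e: "lam l x + of_bool (i = l) = lam l y + of_bool (j = l)" if "l < 3" for l
    using e[of l] assms(1,2) that by (auto simp: lam_F split: if_splits)
  have ij: "i = 0 \<or> i = 1 \<or> i = 2" "j = 0 \<or> j = 1 \<or> j = 2" using assms by linarith+
  define x0 x1 x2 y0 y1 y2 where "x0 = lam 0 x" "x1 = lam 1 x" "x2 = lam 2 x"
    "y0 = lam 0 y" "y1 = lam 1 y" "y2 = lam 2 y"
  note d = this
  have "x0 + of_bool (i = 0) = y0 + of_bool (j = 0)" "x1 + of_bool (i = 1) = y1 + of_bool (j = 1)"
    "x2 + of_bool (i = 2) = y2 + of_bool (j = 2)" "x0 + x1 + x2 = 1" "y0 + y1 + y2 = 1"
    "x0 \<ge> 0" "x1 \<ge> 0" "x2 \<ge> 0" "y0 \<ge> 0" "y1 \<ge> 0" "y2 \<ge> 0"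
    using e[of 0] e[of 1] e[of 2] lam_sum[of x] lam_sum[of y] p unfolding d by simp_all
  hence "x0 = of_bool (0 = j) \<and> x1 = of_bool (1 = j) \<and> x2 = of_bool (2 = j) \<and>
      y0 = of_bool (0 = i) \<and> y1 = of_bool (1 = i) \<and> y2 = of_bool (2 = i)"
    using ij assms(3) by (elim disjE; simp; linarith)
  hence *: "lam l x = of_bool (l = j) \<and> lam l y = of_bool (l = i)"
    if "l = 0 \<or> l = 1 \<or> l = 2" for l
    using that unfolding d by (elim disjE) (simp_all only: simp_thms)
  have "lam l x = lam l (q j) \<and> lam l y = lam l (q i)" if "l < 3" for l
  proof -
    have "l = 0 \<or> l = 1 \<or> l = 2" using that by linarith
    from *[OF this] show ?thesis
      using lam_q[OF assms(2) that] lam_q[OF assms(1) that]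
      by (cases "l = j"; cases "l = i"; simp)
  qed
  thus "x = q j" "y = q i" using eq_if_lam_eq by blast+
qed

lemma cells_meet:
  assumes "i < 3" "j < 3" "i \<noteq> j" "x \<in> SG" "y \<in> SG" "F i x = F j y"
  shows "x = q j" "y = q i"
  using triangle_cells_meet[OF assms(1-3)] assms(4-6) SG_subset_triangle by blast+

lemma inj_q: "i < 3 \<Longrightarrow> j < 3 \<Longrightarrow> q i = q j \<longleftrightarrow> i = j"
  by (auto elim!: less3_cases)

section \<open>Words and cells\<close>

lemma words_0 [simp]: "words 0 = {[]}" by (auto simp: words_def)

lemma words_Suc: "words (Suc m) = (\<Union>i<3. (#) i ` words m)"
  by (auto simp: words_def length_Suc_conv image_iff)

lemma finite_words: "finite (words m)"
  by (induction m) (auto simp: words_Suc)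

lemma Fw_Nil [simp]: "Fw [] = id" and Fw_Cons [simp]: "Fw (i # w) = F i \<circ> Fw w"
  by (simp_all add: Fw_def)

lemma Fw_SG: "w \<in> words m \<Longrightarrow> x \<in> SG \<Longrightarrow> Fw w x \<in> SG"
proof (induction m arbitrary: w)
  case (Suc m)
  then obtain i v where "i < 3" "v \<in> words m" "w = i # v" by (auto simp: words_Suc)
  thus ?case using Suc F_SG by simp
qed simp

lemma dist_Fw: "w \<in> words m \<Longrightarrow> dist (Fw w x) (Fw w y) = dist x y / 2 ^ m"
  by (induction m arbitrary: w) (auto simp: words_Suc)

lemma SG_word:
  assumes "x \<in> SG" obtains w y where "w \<in> words m" "y \<in> SG" "x = Fw w y"
  using assms
proof (induction m arbitrary: x thesis)
  case (Suc m)
  obtain i y where i: "i < 3" "y \<in> SG" "x = F i y" using SG_cases Suc.prems(2) by blast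
  obtain w z where "w \<in> words m" "z \<in> SG" "y = Fw w z" using Suc.IH[OF _ i(2)] by blast
  thus ?case using i Suc.prems(1)[of "i # w" z] by (auto simp: words_Suc)
qed auto

lemma words_Suc_sum: "(\<Sum>w\<in>words (Suc m). f w) = (\<Sum>i<3. \<Sum>w\<in>words m. f (i # w))"
  for f :: "_ \<Rightarrow> 'a::comm_monoid_add"
proof -
  have "(\<Sum>w\<in>words (Suc m). f w) = (\<Sum>i<3. \<Sum>w\<in>(#) i ` words m. f w)"
    unfolding words_Suc by (rule sum.UNION_disjoint) (auto simp: finite_words)
  thus ?thesis by (simp add: sum.reindex)
qed

lemma small_cells:
  assumes "e > (0::real)"
  obtains m where "2 / 2 ^ m < e"
proof -
  obtain m where "(1/2) ^ m < e / 2" using real_arch_pow_inv[of "e/2" "1/2"] assms by auto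
  thus ?thesis by (intro that[of m]) (simp add: field_simps)
qed

section \<open>The self-similar measure\<close>

definition digit_measure :: "nat measure" where
  "digit_measure = measure_pmf (pmf_of_set {..<3})"

definition digit_streams :: "nat stream measure" where
  "digit_streams = stream_space digit_measure"

text \<open>The address map: since \<open>F i x\<close> is the mean of \<open>x\<close> and
  \<open>q i\<close>, iterating the contractions along the digits yields this series. Independent
  uniform digits are pushed forward to the standard measure.\<close>

definition coding :: "nat stream \<Rightarrow> real \<times> real" where
  "coding s = (\<Sum>n. (1/2) ^ Suc n *\<^sub>R q (s !! n))"

interpretation digit: prob_space digit_measure
  unfolding digit_measure_def by (rule prob_space_measure_pmf)

interpretation digits: prob_space digit_streams
  unfolding digit_streams_def by (rule digit.prob_space_stream_space)

lemma nn_integral_digit: "(\<integral>\<^sup>+ i. f i \<partial>digit_measure) = (\<Sum>i<3. f i) / 3"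
  unfolding digit_measure_def by (subst nn_integral_pmf_of_set) (auto simp: lessThan_empty_iff)

lemma coding_terms:
  shows "norm ((1/2) ^ Suc n *\<^sub>R q i) \<le> (1/2) ^ Suc n"
  using norm_q[of i] by (simp add: field_simps)

lemma half_sums: "(\<lambda>n. (1/2::real) ^ Suc n) sums 1"
  using power_half_series by simp

lemma summable_coding: "summable (\<lambda>n. (1/2) ^ Suc n *\<^sub>R q (s !! n))"
  by (rule summable_comparison_test'[of "\<lambda>n. (1/2) ^ Suc n" 0])
     (use half_sums sums_summable coding_terms in blast)+

lemma norm_coding: "norm (coding s) \<le> 1"
proof -
  have "norm (coding s) \<le> (\<Sum>n. (1/2) ^ Suc n)"
    unfolding coding_def
    by (rule norm_suminf_le) (use half_sums sums_summable coding_terms in blast)+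
  thus ?thesis using half_sums by (simp add: sums_iff)
qed

lemma coding_Stream: "coding (i ## s) = F i (coding s)"
proof -
  have "coding (i ## s) = (\<Sum>n. (1/2) ^ Suc (Suc n) *\<^sub>R q (s !! n)) + (1/2) *\<^sub>R q i"
    unfolding coding_def using suminf_split_head[OF summable_coding[of "i ## s"]] by simp
  also have "(\<Sum>n. (1/2) ^ Suc (Suc n) *\<^sub>R q (s !! n)) = (1/2) *\<^sub>R coding s"
    unfolding coding_def using suminf_scaleR_right[OF summable_coding[of s], of "1/2"] by simp
  finally show ?thesis by (simp add: F_eq)
qed

lemma coding_measurable [measurable]: "coding \<in> borel_measurable digit_streams"
proof (rule borel_measurable_LIMSEQ_metric)
  fix s :: "nat stream"
  show "(\<lambda>n. \<Sum>i<n. (1/2) ^ Suc i *\<^sub>R q (s !! i)) \<longlonglongrightarrow> coding s"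
    unfolding coding_def using summable_coding by (rule summable_LIMSEQ)
next
  fix n
  have [measurable]: "q \<in> borel_measurable digit_measure"
    unfolding digit_measure_def by simp
  show "(\<lambda>s. \<Sum>i<n. (1/2) ^ Suc i *\<^sub>R q (s !! i)) \<in> borel_measurable digit_streams"
    unfolding digit_streams_def by measurable
qed

lemma F_mod: "F (i mod 3) = F i"
  by (rule ext) (simp add: F_def q_def)

lemma coding_in_SG: "coding s \<in> SG"
proof -
  have "infdist (coding s) SG \<le> 2 / 2 ^ n" for n s
  proof (induction n arbitrary: s)
    case 0
    have "infdist (coding s) SG \<le> dist (coding s) (q 0)" by (rule infdist_le) (rule q_in_SG, simp)
    also have "\<dots> \<le> 2" using norm_triangle_ineq4[of "coding s" "q 0"] norm_coding[of s] norm_q[of 0]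
      unfolding dist_norm by linarith
    finally show ?case by simp
  next
    case (Suc n)
    obtain z where z: "z \<in> SG" "infdist (coding (stl s)) SG = dist (coding (stl s)) z"
      using infdist_attains_inf[OF closed_SG SG_nonempty] by metis
    \<comment> \<open>A stream may contain any numbers as digits; \<open>F\<close> reads them mod 3,
      and the reduced digit makes \<open>F_SG\<close> applicable.\<close>
    have "F (shd s) z \<in> SG" using F_SG[of "shd s mod 3" z] z(1) by (simp add: F_mod)
    hence "infdist (coding s) SG \<le> dist (coding s) (F (shd s) z)" by (rule infdist_le)
    also have "\<dots> = infdist (coding (stl s)) SG / 2"
      using z(2) dist_F[of "shd s" "coding (stl s)" z] coding_Stream[of "shd s" "stl s"] by simp
    finally have "infdist (coding s) SG \<le> infdist (coding (stl s)) SG / 2" .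
    with Suc[of "stl s"] show ?case by simp
  qed
  hence "infdist (coding s) SG \<le> 0"
    by (intro LIMSEQ_le_const[of "\<lambda>n. 2 / 2 ^ n"] exI) (auto intro!: real_tendsto_divide_at_top filterlim_pow_at_top tendsto_eq_intros LIMSEQ_divide_realpow_zero)
  hence "infdist (coding s) SG = 0" using infdist_nonneg[of "coding s" SG] by linarith
  thus ?thesis using in_closed_iff_infdist_zero[OF closed_SG SG_nonempty] by simp
qed

definition sg_measure :: "(real \<times> real) measure" where
  "sg_measure = distr digit_streams borel coding"

lemma nn_integral_sg_measure:
  assumes [measurable]: "f \<in> borel_measurable borel"
  shows "(\<integral>\<^sup>+ x. f x \<partial>sg_measure) = (\<Sum>i<3. \<integral>\<^sup>+ x. f (F i x) \<partial>sg_measure) / 3"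
proof -
  have [measurable]: "(\<lambda>s. f (coding s)) \<in> borel_measurable (stream_space digit_measure)"
    using coding_measurable unfolding digit_streams_def by measurable
  have "(\<integral>\<^sup>+ x. f x \<partial>sg_measure) = (\<integral>\<^sup>+ s. f (coding s) \<partial>digit_streams)"
    unfolding sg_measure_def by (subst nn_integral_distr) auto
  also have "\<dots> = (\<integral>\<^sup>+ i. (\<integral>\<^sup>+ s. f (coding (i ## s)) \<partial>digit_streams) \<partial>digit_measure)"
    unfolding digit_streams_def by (subst digit.nn_integral_stream_space) auto
  also have "\<dots> = (\<Sum>i<3. \<integral>\<^sup>+ s. f (F i (coding s)) \<partial>digit_streams) / 3"
    by (simp add: nn_integral_digit coding_Stream)
  also have "\<dots> = (\<Sum>i<3. \<integral>\<^sup>+ x. f (F i x) \<partial>sg_measure) / 3"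
    unfolding sg_measure_def by (simp add: nn_integral_distr)
  finally show ?thesis .
qed

text \<open>The total mass on \<open>SG\<close> stands in for the masses of all cells, which
  \<open>self_similar_measure_cells\<close> recovers. This form is quick to check for image measures
  such as the one in \<open>mu_sig\<close>.\<close>

definition self_similar_measure :: "(real \<times> real) measure \<Rightarrow> bool" where
  "self_similar_measure M \<longleftrightarrow> sets M = sets borel \<and> prob_space M \<and>
     (\<forall>A\<in>sets borel. measure M A = (\<Sum>i<3. measure M (F i -` A)) / 3) \<and> measure M SG = 1"

text \<open>Adding \<open>C\<close> makes \<open>g\<close> nonnegative, which carries the identity
  over from nonnegative integrals. The shifts cancel because the average of \<open>C\<close> over
  the three cells is \<open>C\<close>.\<close>

lemma integral_sg_measure:
  assumes "sets M = sets borel" "prob_space M"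
    and nn: "\<And>f. f \<in> borel_measurable borel \<Longrightarrow>
      (\<integral>\<^sup>+ x. f x \<partial>M) = (\<Sum>i<3. \<integral>\<^sup>+ x. f (F i x) \<partial>M) / (3::ennreal)"
    and g[measurable]: "(g :: _ \<Rightarrow> real) \<in> borel_measurable borel" and b: "\<And>x. \<bar>g x\<bar> \<le> C"
  shows "(\<integral>x. g x \<partial>M) = (\<Sum>i<3. \<integral>x. g (F i x) \<partial>M) / 3"
proof -
  interpret prob_space M by fact
  note [measurable_cong] = assms(1)
  have int: "integrable M (\<lambda>x. g (h x) + C)" if [measurable]: "h \<in> borel_measurable borel" for h
  proof (rule integrable_const_bound[of _ "2 * C"])
    have "norm (g (h x) + C) \<le> 2 * C" for x using b[of "h x"] by simp
    thus "AE x in M. norm (g (h x) + C) \<le> 2 * C" by simp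
  qed measurable
  have int': "integrable M (\<lambda>x. g (h x))" if [measurable]: "h \<in> borel_measurable borel" for h
    by (rule integrable_const_bound[of _ C]) (use b in auto)
  have nonneg: "g x + C \<ge> 0" for x using b[of x] by linarith
  have eq: "(\<integral>x. g (h x) + C \<partial>M) = (\<integral>x. g (h x) \<partial>M) + C" if "h \<in> borel_measurable borel" for h
    using int'[OF that] by (simp add: prob_space)
  have nn2: "(\<integral>x. g (h x) + C \<partial>M) \<ge> 0" for h
    by (rule integral_nonneg_AE) (rule AE_I2, rule nonneg)
  have "ennreal (\<integral>x. g x + C \<partial>M) = (\<integral>\<^sup>+ x. ennreal (g x + C) \<partial>M)"
    using int[of "\<lambda>x. x"] nonneg by (subst nn_integral_eq_integral) auto
  also have "\<dots> = (\<Sum>i<3. \<integral>\<^sup>+ x. ennreal (g (F i x) + C) \<partial>M) / 3"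
    by (rule nn) measurable
  also have "\<dots> = (\<Sum>i<3. ennreal (\<integral>x. g (F i x) + C \<partial>M)) / 3"
    using int[of "F _"] nonneg by (subst nn_integral_eq_integral) auto
  also have "\<dots> = ennreal ((\<Sum>i<3. \<integral>x. g (F i x) + C \<partial>M) / 3)"
  proof -
    define S where "S = (\<Sum>i<3. \<integral>x. g (F i x) + C \<partial>M)"
    have "S \<ge> 0" unfolding S_def using nn2 by (intro sum_nonneg) simp
    hence "ennreal S / 3 = ennreal (S / 3)" using divide_ennreal[of S 3] by simp
    moreover have "(\<Sum>i<3. ennreal (\<integral>x. g (F i x) + C \<partial>M)) = ennreal S"
      unfolding S_def using nn2 by (subst sum_ennreal) simp_all
    ultimately show ?thesis unfolding S_def by simp
  qed
  finally have "(\<integral>x. g x + C \<partial>M) = (\<Sum>i<3. \<integral>x. g (F i x) + C \<partial>M) / 3"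
    using nn2[of "\<lambda>x. x"] nn2[of "F _"] by (subst (asm) ennreal_inj) (simp_all add: sum_nonneg)
  thus ?thesis using eq[of "\<lambda>x. x"] eq[of "F _"] by (simp add: sum.distrib)
qed

lemma self_similar_sg_measure: "self_similar_measure sg_measure"
  unfolding self_similar_measure_def
proof (intro conjI ballI)
  show [measurable_cong]: "sets sg_measure = sets borel" by (simp add: sg_measure_def)
  show P: "prob_space sg_measure"
    unfolding sg_measure_def by (rule digits.prob_space_distr) measurable
  interpret P: prob_space sg_measure by fact
  show "measure sg_measure SG = 1"
    unfolding sg_measure_def using coding_in_SG digits.prob_space
    by (subst measure_distr) (auto simp: vimage_def)
  fix A :: "(real \<times> real) set" assume A[measurable]: "A \<in> sets borel"
  have "(\<integral>x. indicator A x \<partial>sg_measure) = (\<Sum>i<3. \<integral>x. indicator A (F i x) \<partial>sg_measure) / (3::real)"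
    by (rule integral_sg_measure[of _ _ 1, OF _ P nn_integral_sg_measure]) (auto simp: sg_measure_def)
  moreover have "(\<integral>x. indicator A (F i x) \<partial>sg_measure) = measure sg_measure (F i -` A)" for i
  proof -
    have "(\<integral>x. indicator A (F i x) \<partial>sg_measure) = (\<integral>x. indicator (F i -` A) x \<partial>sg_measure)"
      by (rule Bochner_Integration.integral_cong) (auto simp: indicator_def)
    also have "\<dots> = measure sg_measure (F i -` A)"
      by (subst Bochner_Integration.integral_indicator) (simp add: sg_measure_def)
    finally show ?thesis .
  qed
  ultimately show "measure sg_measure A = (\<Sum>i<3. measure sg_measure (F i -` A)) / 3"
    by (simp add: sg_measure_def)
qed

lemma Fw_measurable [measurable]: "Fw w \<in> borel_measurable borel"
proof (induction w)
  case Nil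
  have "Fw [] = (\<lambda>x. x)" by auto
  thus ?case by simp
qed (auto intro: measurable_comp F_measurable)

section \<open>Uniqueness of the self-similar measure\<close>

lemma self_similar_measure_words:
  assumes "self_similar_measure M" "A \<in> sets borel"
  shows "measure M A = (\<Sum>w\<in>words m. measure M (Fw w -` A)) / 3 ^ m"
  using assms(2)
proof (induction m arbitrary: A)
  case (Suc m)
  have [measurable]: "F i -` A \<in> sets borel" for i using measurable_sets_borel[OF F_measurable Suc.prems] .
  have "measure M A = (\<Sum>i<3. measure M (F i -` A)) / 3"
    using assms(1) Suc.prems unfolding self_similar_measure_def by blast
  also have "\<dots> = (\<Sum>i<3. (\<Sum>w\<in>words m. measure M (Fw w -` (F i -` A))) / 3 ^ m) / 3"
    using Suc.IH[of "F _ -` A"] by simp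
  also have "\<dots> = (\<Sum>w\<in>words (Suc m). measure M (Fw w -` A)) / 3 ^ Suc m"
    by (simp add: words_Suc_sum vimage_comp sum_divide_distrib mult.commute)
  finally show ?case .
qed auto

text \<open>Compare word by word at a level where the cells have diameter below \<open>e\<close>. A
  cell that misses \<open>A\<close> contributes nothing to the \<open>M\<close>-mass of
  \<open>A\<close>; any other cell lies in the closed \<open>e\<close>-neighbourhood of
  \<open>A\<close> and contributes its full weight to the \<open>N\<close>-mass. Then let
  \<open>e\<close> tend to 0.\<close>

lemma self_similar_measure_closed_le:
  assumes M: "self_similar_measure M" and N: "self_similar_measure N" and A: "closed A"
  shows "measure M A \<le> measure N A"
proof (cases "A = {}")
  case False
  interpret M: prob_space M using M self_similar_measure_def by blast
  interpret N: prob_space N using N self_similar_measure_def by blast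
  have sM[measurable_cong, simp]: "sets M = sets borel" "sets N = sets borel" using M N self_similar_measure_def by blast+
  have "space M = space borel" "space N = space borel"
    using sets_eq_imp_space_eq[OF sM(1)] sets_eq_imp_space_eq[OF sM(2)] by auto
  hence sp[simp]: "space M = UNIV" "space N = UNIV" by auto
  define B where "B e = {x. infdist x A \<le> e}" for e
  have B: "closed (B e)" for e unfolding B_def by (intro closed_Collect_le continuous_intros)
  have *: "measure M A \<le> measure N (B e)" if e: "e > 0" for e
  proof -
    obtain m where m: "2 / 2 ^ m < e" using small_cells[OF e] .
    have "measure M (Fw w -` A) \<le> measure N (Fw w -` B e)" if w: "w \<in> words m" for w
    proof (cases "Fw w -` A \<inter> SG = {}")
      case True
      have "measure M (Fw w -` A) \<le> measure M (UNIV - SG)"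
        using True by (intro M.finite_measure_mono) auto
      also have "\<dots> = 0" using M.prob_compl[of SG] M by (auto simp: self_similar_measure_def)
      finally show ?thesis by (simp add: order.trans[OF _ measure_nonneg])
    next
      case False
      then obtain y where y: "y \<in> SG" "Fw w y \<in> A" by blast
      have "SG \<subseteq> Fw w -` B e"
      proof
        fix x assume "x \<in> SG"
        have "infdist (Fw w x) A \<le> dist (Fw w x) (Fw w y)" using y by (intro infdist_le)
        also have "\<dots> \<le> 2 / 2 ^ m" using dist_Fw[OF w, of x y] SG_dist[OF \<open>x \<in> SG\<close> y(1)] by (simp add: divide_right_mono)
        finally show "x \<in> Fw w -` B e" using m by (simp add: B_def)
      qed
      hence "measure N SG \<le> measure N (Fw w -` B e)"
        using B measurable_sets_borel[OF Fw_measurable, of "B e" w] by (intro N.finite_measure_mono) auto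
      moreover have "measure N SG = 1" using N self_similar_measure_def by blast
      ultimately show ?thesis using M.prob_le_1[of "Fw w -` A"] by linarith
    qed
    thus ?thesis
      using self_similar_measure_words[OF M, of A m] self_similar_measure_words[OF N, of "B e" m] A B
      by (simp add: divide_right_mono sum_mono)
  qed
  have "(\<lambda>n. measure N (B (1 / real (Suc n)))) \<longlonglongrightarrow> measure N (\<Inter>n. B (1 / real (Suc n)))"
  proof (rule N.finite_Lim_measure_decseq)
    have "B (1 / real (Suc n)) \<subseteq> B (1 / real (Suc m))" if "m \<le> n" for m n
    proof -
      have "1 / real (Suc n) \<le> 1 / real (Suc m)" using that by (intro frac_le) simp_all
      thus ?thesis unfolding B_def by force
    qed
    thus "decseq (\<lambda>n. B (1 / real (Suc n)))" by (simp only: decseq_def) blast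
  qed (use B in auto)
  moreover have "(\<Inter>n. B (1 / real (Suc n))) = A"
  proof (intro equalityI subsetI)
    fix x assume x: "x \<in> (\<Inter>n. B (1 / real (Suc n)))"
    have "infdist x A \<le> 0"
    proof (rule field_le_epsilon)
      fix e :: real assume "e > 0"
      then obtain n where "1 / real (Suc n) < e" using nat_approx_posE by blast
      moreover have "infdist x A \<le> 1 / real (Suc n)" using x by (auto simp: B_def)
      ultimately show "infdist x A \<le> 0 + e" by linarith
    qed
    hence "infdist x A = 0" using infdist_nonneg[of x A] by linarith
    thus "x \<in> A" using in_closed_iff_infdist_zero[OF A False] by simp
  qed (auto simp: B_def)
  ultimately show ?thesis using * by (intro LIMSEQ_le_const[of _ "measure N A"]) auto
qed auto

lemma self_similar_measure_unique:
  assumes M: "self_similar_measure M" and N: "self_similar_measure N"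
  shows "M = N"
proof -
  interpret M: prob_space M using M self_similar_measure_def by blast
  interpret N: prob_space N using N self_similar_measure_def by blast
  have [simp]: "sets M = sets borel" "sets N = sets borel" using M N self_similar_measure_def by blast+
  show ?thesis
  proof (rule measure_eqI_generator_eq[where E = "Collect closed" and A = "\<lambda>_. UNIV" and \<Omega> = UNIV])
    fix X :: "(real \<times> real) set" assume "X \<in> Collect closed"
    hence "measure M X = measure N X"
      using self_similar_measure_closed_le[OF M N, of X] self_similar_measure_closed_le[OF N M, of X] by simp
    thus "emeasure M X = emeasure N X" by (simp add: M.emeasure_eq_measure N.emeasure_eq_measure)
  qed (auto simp: Int_stable_def borel_eq_closed closed_Int)
qed

text \<open>The corner \<open>q j\<close> lies in the \<open>j\<close>-th cell only and is fixed by
  \<open>F j\<close>, so its mass is a third of itself. Consequently the overlaps of cells are null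
  sets.\<close>

lemma self_similar_measure_point:
  assumes M: "self_similar_measure M" and j: "j < 3"
  shows "measure M {q j} = 0"
proof -
  interpret M: prob_space M using M self_similar_measure_def by blast
  have sM[simp]: "sets M = sets borel" using M self_similar_measure_def by blast
  have sp: "space M = UNIV" using sets_eq_imp_space_eq[OF sM] by simp
  have *: "measure M (F i -` {q j}) = (if i = j then measure M {q j} else 0)" if i: "i < 3" for i
  proof (cases "i = j")
    case True
    hence "F i -` {q j} = {q j}" by (auto simp: vimage_F) (metis Finv_F F_q_self)+
    thus ?thesis using True by simp
  next
    case False
    have "F i -` {q j} \<subseteq> UNIV - SG"
    proof
      fix x assume "x \<in> F i -` {q j}"
      hence "F i x = F j (q j)" by simp
      hence "x \<in> SG \<Longrightarrow> q j = q i" using cells_meet(2)[OF i j False, of x "q j"] j by simp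
      thus "x \<in> UNIV - SG" using False inj_q[OF i j] by auto
    qed
    hence "measure M (F i -` {q j}) \<le> measure M (UNIV - SG)"
      by (intro M.finite_measure_mono) auto
    also have "\<dots> = 0" using M.prob_compl[of SG] M by (auto simp: self_similar_measure_def sp)
    finally show ?thesis using False by (simp add: measure_le_0_iff)
  qed
  have "measure M {q j} = (\<Sum>i<3. measure M (F i -` {q j})) / 3"
    using M unfolding self_similar_measure_def by auto
  also have "\<dots> = (\<Sum>i<3. if i = j then measure M {q j} else 0) / 3" using * by simp
  also have "\<dots> = measure M {q j} / 3" using j by (simp add: sum.delta)
  finally show ?thesis by simp
qed

lemma self_similar_measure_cells:
  assumes M: "self_similar_measure M" and w: "w \<in> words m"
  shows "measure M (Fw w ` SG) = (1/3) ^ m"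
  using w
proof (induction m arbitrary: w)
  case 0
  thus ?case using M by (auto simp: self_similar_measure_def)
next
  case (Suc m)
  interpret M: prob_space M using M self_similar_measure_def by blast
  have sM[simp]: "sets M = sets borel" using M self_similar_measure_def by blast
  have sp: "space M = UNIV" using sets_eq_imp_space_eq[OF sM] by simp
  obtain j v where v: "j < 3" "v \<in> words m" "w = j # v" using Suc.prems by (auto simp: words_Suc)
  have closed: "closed (Fw u ` SG)" if "u \<in> words n" for u n
  proof -
    have "continuous_on SG (Fw u)"
    proof (rule continuous_onI)
      fix x e assume "(0::real) < e"
      thus "\<exists>d>0. \<forall>x'\<in>SG. dist x' x < d \<longrightarrow> dist (Fw u x') (Fw u x) \<le> e"
        by (intro exI[of _ "e * 2 ^ n"]) (simp add: dist_Fw[OF that] divide_le_eq)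
    qed
    thus ?thesis using compact_SG compact_continuous_image compact_imp_closed by blast
  qed
  have A: "Fw w ` SG \<in> sets borel" using closed[OF Suc.prems] by simp
  have *: "measure M (F i -` (Fw w ` SG)) = (if i = j then measure M (Fw v ` SG) else 0)" if i: "i < 3" for i
  proof (cases "i = j")
    case True
    hence "F i -` (Fw w ` SG) = Fw v ` SG" using v by auto
    thus ?thesis using True by simp
  next
    case False
    have "F i -` (Fw w ` SG) \<subseteq> (UNIV - SG) \<union> {q j}"
    proof
      fix x assume "x \<in> F i -` (Fw w ` SG)"
      then obtain y where y: "y \<in> SG" "F i x = F j (Fw v y)" using v by auto
      thus "x \<in> (UNIV - SG) \<union> {q j}" using cells_meet(1)[OF i v(1) False _ Fw_SG[OF v(2) y(1)] y(2)] by auto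
    qed
    hence "measure M (F i -` (Fw w ` SG)) \<le> measure M ((UNIV - SG) \<union> {q j})"
      by (intro M.finite_measure_mono) auto
    also have "\<dots> \<le> measure M (UNIV - SG) + measure M {q j}"
      by (rule measure_Un_le) auto
    also have "\<dots> = 0"
      using M.prob_compl[of SG] M self_similar_measure_point[OF M v(1)] by (auto simp: self_similar_measure_def sp)
    finally show ?thesis using False by (simp add: measure_le_0_iff)
  qed
  have "measure M (Fw w ` SG) = (\<Sum>i<3. measure M (F i -` (Fw w ` SG))) / 3"
    using M A unfolding self_similar_measure_def by auto
  also have "\<dots> = (\<Sum>i<3. if i = j then measure M (Fw v ` SG) else 0) / 3" using * by simp
  also have "\<dots> = measure M (Fw v ` SG) / 3" using v by (simp add: sum.delta)
  finally show ?case using Suc.IH[OF v(2)] by simp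
qed

lemma mu_eq: "mu = sg_measure"
  unfolding mu_def
proof (rule the_equality)
  let ?P = "\<lambda>M. sets M = sets borel \<and> prob_space M \<and>
     (\<forall>A\<in>sets borel. measure M A = (\<Sum>i<3. measure M (F i -` A)) / 3) \<and>
     (\<forall>m. \<forall>w\<in>words m. measure M (Fw w ` SG) = (1/3) ^ m)"
  show "?P sg_measure"
    using self_similar_sg_measure self_similar_measure_cells[OF self_similar_sg_measure]
    unfolding self_similar_measure_def by blast
  fix M assume M: "?P M"
  hence "measure M (Fw [] ` SG) = (1/3) ^ 0" by (metis words_0 singletonI)
  hence "measure M SG = 1" by simp
  hence "self_similar_measure M" unfolding self_similar_measure_def using M by blast
  thus "M = sg_measure" using self_similar_measure_unique self_similar_sg_measure by blast
qed

section \<open>Integrals and graph energies\<close>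

lemma sets_mu [simp, measurable_cong]: "sets mu = sets borel"
  by (simp add: mu_eq sg_measure_def)

lemma space_mu [simp]: "space mu = UNIV"
  by (simp add: mu_eq sg_measure_def)

interpretation mu: prob_space mu
  using self_similar_sg_measure unfolding mu_eq self_similar_measure_def by blast

lemma mu_SG: "measure mu SG = 1"
  using self_similar_sg_measure unfolding mu_eq self_similar_measure_def by blast

lemma AE_mu_SG: "AE x in mu. x \<in> SG"
  using mu.prob_eq_1[of SG] mu_SG by simp

abbreviation contSG :: "(real \<times> real \<Rightarrow> real) \<Rightarrow> bool" where
  "contSG f \<equiv> continuous_on SG f"

definition intg :: "(real \<times> real \<Rightarrow> real) \<Rightarrow> real" where
  "intg f = (LINT x:SG|mu. f x)"

lemma contSG_F: "contSG f \<Longrightarrow> i < 3 \<Longrightarrow> contSG (\<lambda>x. f (F i x))"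
  by (rule continuous_on_compose2[of SG f]) (auto intro: continuous_F F_SG)

lemma contSG_bounded: "contSG f \<Longrightarrow> \<exists>C>0. \<forall>x\<in>SG. \<bar>f x\<bar> \<le> C"
  using compact_imp_bounded[OF compact_continuous_image[OF _ compact_SG], of f]
  by (auto simp: bounded_pos)

lemma set_integrable_contSG: "contSG f \<Longrightarrow> set_integrable mu SG f"
proof -
  assume f: "contSG f"
  obtain C where C: "C > 0" "\<And>x. x \<in> SG \<Longrightarrow> \<bar>f x\<bar> \<le> C" using contSG_bounded[OF f] by blast
  have [measurable]: "(\<lambda>x. indicat_real SG x *\<^sub>R f x) \<in> borel_measurable borel"
    using borel_measurable_continuous_on_indicator[OF _ f] by simp
  show ?thesis unfolding set_integrable_def
  proof (rule mu.integrable_const_bound[of _ C])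
    show "AE x in mu. norm (indicat_real SG x *\<^sub>R f x) \<le> C"
      using C by (auto simp: indicator_def)
  qed measurable
qed

lemma intg_cong: "(\<And>x. x \<in> SG \<Longrightarrow> f x = g x) \<Longrightarrow> intg f = intg g"
  unfolding intg_def by (rule set_lebesgue_integral_cong) auto

lemma intg_add: "contSG f \<Longrightarrow> contSG g \<Longrightarrow> intg (\<lambda>x. f x + g x) = intg f + intg g"
  unfolding intg_def by (intro set_integral_add set_integrable_contSG)

lemma intg_diff: "contSG f \<Longrightarrow> contSG g \<Longrightarrow> intg (\<lambda>x. f x - g x) = intg f - intg g"
  unfolding intg_def by (intro set_integral_diff set_integrable_contSG)

lemma intg_cmult: "intg (\<lambda>x. c * f x) = c * intg f"
  unfolding intg_def by simp

lemma intg_divide: "intg (\<lambda>x. f x / c) = intg f / c"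
  unfolding intg_def by simp

lemma intg_const: "intg (\<lambda>x. c) = c"
  unfolding intg_def set_lebesgue_integral_def by (simp add: mu_SG)

lemma intg_0 [simp]: "intg (\<lambda>x. 0) = 0"
  by (simp add: intg_const)

lemma intg_sum: "(\<And>i. i \<in> I \<Longrightarrow> contSG (f i)) \<Longrightarrow> intg (\<lambda>x. \<Sum>i\<in>I. f i x) = (\<Sum>i\<in>I. intg (f i))"
  by (induction I rule: infinite_finite_induct) (auto simp: intg_add continuous_on_sum)

lemma intg_mono:
  "contSG f \<Longrightarrow> contSG g \<Longrightarrow> (\<And>x. x \<in> SG \<Longrightarrow> f x \<le> g x) \<Longrightarrow> intg f \<le> intg g"
  unfolding intg_def by (intro set_integral_mono set_integrable_contSG) auto

lemma intg_nonneg: "contSG f \<Longrightarrow> (\<And>x. x \<in> SG \<Longrightarrow> 0 \<le> f x) \<Longrightarrow> 0 \<le> intg f"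
  using intg_mono[of "\<lambda>x. 0" f] by (simp add: intg_const)

lemma intg_abs: "contSG f \<Longrightarrow> \<bar>intg f\<bar> \<le> intg (\<lambda>x. \<bar>f x\<bar>)"
proof -
  assume f: "contSG f"
  hence c: "contSG (\<lambda>x. \<bar>f x\<bar>)" "contSG (\<lambda>x. (-1) * f x)" by (auto intro!: continuous_intros)
  have "intg f \<le> intg (\<lambda>x. \<bar>f x\<bar>)" by (rule intg_mono[OF f c(1)]) simp
  moreover have "intg (\<lambda>x. (-1) * f x) \<le> intg (\<lambda>x. \<bar>f x\<bar>)" by (rule intg_mono[OF c(2,1)]) simp
  ultimately show ?thesis unfolding intg_cmult by linarith
qed

lemma intg_split:
  assumes f: "contSG f"
  shows "intg f = (\<Sum>i<3. intg (\<lambda>x. f (F i x))) / 3"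
proof -
  define g where "g x = indicat_real SG x *\<^sub>R f x" for x
  obtain C where C: "C > 0" "\<And>x. x \<in> SG \<Longrightarrow> \<bar>f x\<bar> \<le> C" using contSG_bounded[OF f] by blast
  have g: "g \<in> borel_measurable borel"
    unfolding g_def using borel_measurable_continuous_on_indicator[OF _ f] by simp
  have "(\<integral>x. g x \<partial>mu) = (\<Sum>i<3. \<integral>x. g (F i x) \<partial>mu) / 3"
    unfolding mu_eq using self_similar_sg_measure C
    by (intro integral_sg_measure[of _ _ C, OF _ _ nn_integral_sg_measure g])
      (auto simp: self_similar_measure_def g_def indicator_def)
  moreover have "(\<integral>x. g (F i x) \<partial>mu) = intg (\<lambda>x. f (F i x))" if "i < 3" for i
    unfolding intg_def set_lebesgue_integral_def
  proof (rule integral_cong_AE)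
    show "(\<lambda>x. g (F i x)) \<in> borel_measurable mu" using g by measurable
    show "(\<lambda>x. indicat_real SG x *\<^sub>R f (F i x)) \<in> borel_measurable mu"
      using borel_measurable_continuous_on_indicator[OF _ contSG_F[OF f that]] by simp
    show "AE x in mu. g (F i x) = indicat_real SG x *\<^sub>R f (F i x)"
      using AE_mu_SG by eventually_elim (auto simp: g_def F_SG that)
  qed
  ultimately show ?thesis unfolding intg_def set_lebesgue_integral_def g_def by simp
qed

lemma intg_split3:
  "contSG f \<Longrightarrow> intg f = (intg (\<lambda>x. f (F 0 x)) + intg (\<lambda>x. f (F 1 x)) + intg (\<lambda>x. f (F 2 x))) / 3"
  using intg_split by (simp add: sum_less3)

lemma intg_cell_le:
  assumes "contSG f" "\<And>x. x \<in> SG \<Longrightarrow> 0 \<le> f x" "i < 3"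
  shows "intg (\<lambda>x. f (F i x)) \<le> 3 * intg f"
proof -
  have "0 \<le> intg (\<lambda>x. f (F j x))" if "j < 3" for j
    by (intro intg_nonneg contSG_F assms F_SG that)
  hence "intg (\<lambda>x. f (F i x)) \<le> (\<Sum>i<3. intg (\<lambda>x. f (F i x)))"
    using assms(3) by (intro member_le_sum) auto
  thus ?thesis using intg_split[OF assms(1)] by simp
qed

lemma intg_word_le:
  assumes "contSG f" "\<And>x. x \<in> SG \<Longrightarrow> 0 \<le> f x" "w \<in> words m"
  shows "intg (\<lambda>x. f (Fw w x)) \<le> 3 ^ m * intg f"
  using assms
proof (induction m arbitrary: w f)
  case (Suc m)
  obtain i v where v: "i < 3" "v \<in> words m" "w = i # v" using Suc.prems by (auto simp: words_Suc)
  have "intg (\<lambda>x. f (F i (Fw v x))) \<le> 3 ^ m * intg (\<lambda>x. f (F i x))"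
    by (rule Suc.IH[of "\<lambda>x. f (F i x)"]) (intro contSG_F Suc.prems F_SG v; assumption)+
  also have "\<dots> \<le> 3 ^ m * (3 * intg f)"
    using intg_cell_le[OF Suc.prems(1,2) v(1)] by simp
  finally show ?case using v by simp
qed auto

lemma contSG_small_oscillation:
  assumes f: "contSG f" and e: "e > 0"
  shows "\<exists>M. \<forall>m\<ge>M. \<forall>w\<in>words m. \<forall>x\<in>SG. \<forall>y\<in>SG. \<bar>f (Fw w x) - f (Fw w y)\<bar> \<le> e"
proof -
  have "uniformly_continuous_on SG f" by (rule compact_uniformly_continuous[OF f compact_SG])
  then obtain d where d: "d > 0" "\<And>x y. x \<in> SG \<Longrightarrow> y \<in> SG \<Longrightarrow> dist x y < d \<Longrightarrow> dist (f x) (f y) < e"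
    using e unfolding uniformly_continuous_on_def by metis
  obtain M where M: "2 / 2 ^ M < d" using small_cells[OF d(1)] .
  show ?thesis
  proof (intro exI[of _ M] allI impI ballI)
    fix m w x y assume *: "M \<le> m" "w \<in> words m" "x \<in> SG" "y \<in> SG"
    have "dist (Fw w x) (Fw w y) = dist x y / 2 ^ m" using dist_Fw * by blast
    also have "\<dots> \<le> 2 / 2 ^ M" using SG_dist[OF *(3,4)] *(1) by (intro frac_le) auto
    finally have "dist (Fw w x) (Fw w y) < d" using M by linarith
    from d(2)[OF Fw_SG[OF *(2,3)] Fw_SG[OF *(2,4)] this]
    show "\<bar>f (Fw w x) - f (Fw w y)\<bar> \<le> e" by (simp add: dist_real_def)
  qed
qed

text \<open>Half of a positive value persists on a small cell around the point, and that cell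
  carries the positive mass \<open>1 / 3 ^ M\<close>.\<close>

lemma intg_eq_0_imp:
  assumes f: "contSG f" and nn: "\<And>x. x \<in> SG \<Longrightarrow> 0 \<le> f x" and "intg f = 0" and x: "x \<in> SG"
  shows "f x = 0"
proof (rule ccontr)
  assume "f x \<noteq> 0"
  hence pos: "f x / 2 > 0" using nn[OF x] by simp
  obtain M where M: "\<And>w a b. w \<in> words M \<Longrightarrow> a \<in> SG \<Longrightarrow> b \<in> SG \<Longrightarrow> \<bar>f (Fw w a) - f (Fw w b)\<bar> \<le> f x / 2"
    using contSG_small_oscillation[OF f pos] by blast
  obtain w y where w: "w \<in> words M" "y \<in> SG" "x = Fw w y" using SG_word[OF x] .
  have "f (Fw w z) \<ge> f x / 2" if "z \<in> SG" for z
  proof -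
    have "\<bar>f x - f (Fw w z)\<bar> \<le> f x / 2" unfolding w(3) using M[OF w(1,2) that] w(3) by simp
    thus ?thesis by linarith
  qed
  moreover have cw: "contSG (\<lambda>z. f (Fw w z))"
  proof -
    have "contSG (\<lambda>z. f (Fw v z))" if "v \<in> words n" for v n
      using that f
    proof (induction n arbitrary: v f)
      case (Suc n)
      then obtain i u where "i < 3" "u \<in> words n" "v = i # u" by (auto simp: words_Suc)
      thus ?case using Suc.IH[of u "\<lambda>x. f (F i x)"] contSG_F[OF Suc.prems(2)] by simp
    qed auto
    thus ?thesis using w by blast
  qed
  ultimately have "f x / 2 \<le> intg (\<lambda>z. f (Fw w z))"
    using intg_mono[of "\<lambda>_. f x / 2" "\<lambda>z. f (Fw w z)"] by (simp add: intg_const)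
  also have "\<dots> \<le> 3 ^ M * intg f" using intg_word_le[OF f nn w(1)] by simp
  finally show False using pos assms(3) by simp
qed

text \<open>The variance of the absolute value of \<open>f\<close> under a probability measure is
  nonnegative.\<close>

lemma intg_abs_le_sqrt:
  assumes f: "contSG f"
  shows "intg (\<lambda>x. \<bar>f x\<bar>) \<le> sqrt (intg (\<lambda>x. f x * f x))"
proof -
  define c where "c = intg (\<lambda>x. \<bar>f x\<bar>)"
  have "0 \<le> intg (\<lambda>x. (\<bar>f x\<bar> - c) * (\<bar>f x\<bar> - c))"
    using f by (intro intg_nonneg continuous_intros) auto
  also have "(\<lambda>x. (\<bar>f x\<bar> - c) * (\<bar>f x\<bar> - c)) = (\<lambda>x. (f x * f x - (2 * c) * \<bar>f x\<bar>) + c * c)"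
    by (rule ext) (simp add: algebra_simps flip: abs_mult)
  also have "intg \<dots> = intg (\<lambda>x. f x * f x) - 2 * c * c + c * c"
    using f by (subst intg_add, (intro continuous_intros; simp)+, subst intg_diff)
      (auto intro!: continuous_intros simp: intg_cmult intg_const c_def)
  finally show ?thesis unfolding c_def[symmetric] by (intro real_le_rsqrt) (simp add: power2_eq_square)
qed

lemma contSG_eq_on_vertices:
  assumes "contSG u" "contSG v" and eq: "\<And>m w. w \<in> words m \<Longrightarrow> u (Fw w (q 0)) = v (Fw w (q 0))"
    and x: "x \<in> SG"
  shows "u x = v x"
proof -
  have c: "contSG (\<lambda>x. u x - v x)" using assms by (intro continuous_intros)
  have "\<bar>u x - v x\<bar> \<le> 0"
  proof (rule field_le_epsilon)
    fix e :: real assume "e > 0"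
    then obtain M where M: "\<And>w x y. w \<in> words M \<Longrightarrow> x \<in> SG \<Longrightarrow> y \<in> SG \<Longrightarrow>
        \<bar>(u (Fw w x) - v (Fw w x)) - (u (Fw w y) - v (Fw w y))\<bar> \<le> e"
      using contSG_small_oscillation[OF c \<open>e > 0\<close>] by blast
    obtain w y where w: "w \<in> words M" "y \<in> SG" "x = Fw w y" using SG_word[OF x] .
    show "\<bar>u x - v x\<bar> \<le> 0 + e" using M[OF w(1,2) q_in_SG[of 0]] eq[OF w(1)] w(3) by simp
  qed
  thus ?thesis by simp
qed

section \<open>Graph energies, recursively over the cells\<close>

definition triangle_form :: "(nat \<Rightarrow> real) \<Rightarrow> (nat \<Rightarrow> real) \<Rightarrow> real" where
  "triangle_form a b = (a 0 - a 1) * (b 0 - b 1) + (a 1 - a 2) * (b 1 - b 2) + (a 0 - a 2) * (b 0 - b 2)"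

fun graph_energy :: "nat \<Rightarrow> (real \<times> real \<Rightarrow> real) \<Rightarrow> (real \<times> real \<Rightarrow> real) \<Rightarrow> real" where
  "graph_energy 0 u v = triangle_form (\<lambda>j. u (q j)) (\<lambda>j. v (q j))"
| "graph_energy (Suc m) u v = 5/3 * (\<Sum>i<3. graph_energy m (\<lambda>x. u (F i x)) (\<lambda>x. v (F i x)))"

lemma V_0: "V 0 = {q 0, q 1, q 2}" by (simp add: V_def V0_def)

lemma V_Suc: "V (Suc m) = (\<Union>i<3. F i ` V m)"
  unfolding V_def words_Suc by (simp add: image_UN image_comp) blast

lemma V_SG: "x \<in> V m \<Longrightarrow> x \<in> SG"
  by (induction m arbitrary: x) (auto simp: V_0 V_Suc F_SG simp del: q_simps)

lemma q_in_V: "i < 3 \<Longrightarrow> q i \<in> V m"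
proof (induction m)
  case 0
  thus ?case by (auto simp: V_0 elim!: less3_cases simp del: q_simps)
next
  case (Suc m)
  thus ?case unfolding V_Suc using F_q_self[of i] by (metis UN_iff image_eqI lessThan_iff)
qed

lemma adj_Suc:
  "{(x, y). adj (Suc m) x y} = (\<Union>i<3. map_prod (F i) (F i) ` {(x, y). adj m x y})"
proof (intro equalityI subsetI)
  fix p assume "p \<in> {(x, y). adj (Suc m) x y}"
  then obtain x y where p: "p = (x, y)" "adj (Suc m) x y" by blast
  then obtain w where w: "w \<in> words (Suc m)" "x \<in> Fw w ` SG" "y \<in> Fw w ` SG"
    unfolding adj_def by blast
  then obtain i v where v: "i < 3" "v \<in> words m" "w = i # v" by (auto simp: words_Suc)
  have *: "\<exists>z. x = F i z \<and> z \<in> Fw v ` SG \<and> z \<in> V m" if x: "x \<in> Fw w ` SG" "x \<in> V (Suc m)" for x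
  proof -
    obtain z where z: "z \<in> SG" "x = F i (Fw v z)" using x(1) v by auto
    obtain j t where t: "j < 3" "t \<in> V m" "x = F j t" using x(2) by (auto simp: V_Suc)
    have "Fw v z \<in> V m"
    proof (cases "i = j")
      case True
      thus ?thesis using z t by simp
    next
      case False
      \<comment> \<open>The point is the junction of the cells \<open>i\<close> and
        \<open>j\<close>, and its preimage in cell \<open>i\<close> is the vertex
        \<open>q j\<close>.\<close>
      have "Fw v z = q j"
        using cells_meet(1)[OF v(1) t(1) False Fw_SG[OF v(2) z(1)] V_SG[OF t(2)]] z t by simp
      thus ?thesis using q_in_V[OF t(1)] by simp
    qed
    thus ?thesis using z by blast
  qed
  obtain x' y' where "x = F i x'" "x' \<in> Fw v ` SG" "x' \<in> V m" "y = F i y'" "y' \<in> Fw v ` SG" "y' \<in> V m"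
    using *[of x] *[of y] w p(2) unfolding adj_def by blast
  moreover have "x \<noteq> y" using p(2) unfolding adj_def by blast
  ultimately have "adj m x' y'" "p = map_prod (F i) (F i) (x', y')"
    using v p unfolding adj_def by auto
  thus "p \<in> (\<Union>i<3. map_prod (F i) (F i) ` {(x, y). adj m x y})" using v by blast
next
  fix p assume "p \<in> (\<Union>i<3. map_prod (F i) (F i) ` {(x, y). adj m x y})"
  then obtain i x y where i: "i < 3" "p = (F i x, F i y)" "adj m x y" by auto
  then obtain w where w: "w \<in> words m" "x \<in> Fw w ` SG" "y \<in> Fw w ` SG" unfolding adj_def by blast
  have "i # w \<in> words (Suc m)" "F i x \<in> Fw (i # w) ` SG" "F i y \<in> Fw (i # w) ` SG"
    using i w by (auto simp: words_Suc)
  moreover have "F i x \<in> V (Suc m)" "F i y \<in> V (Suc m)" "F i x \<noteq> F i y"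
    using i unfolding adj_def V_Suc by auto
  ultimately have "adj (Suc m) (F i x) (F i y)" unfolding adj_def by blast
  thus "p \<in> {(x, y). adj (Suc m) x y}" using i by simp
qed

lemma distinct_pairs_of_three:
  "a \<noteq> b \<Longrightarrow> a \<noteq> c \<Longrightarrow> b \<noteq> c \<Longrightarrow>
   {(x, y). x \<in> {a, b, c} \<and> y \<in> {a, b, c} \<and> x \<noteq> y} = {(a, b), (b, a), (a, c), (c, a), (b, c), (c, b)}"
  by auto

lemma adj_0_set: "{(x, y). adj 0 x y} =
    {(q 0, q 1), (q 1, q 0), (q 0, q 2), (q 2, q 0), (q 1, q 2), (q 2, q 1)}"
proof -
  have "adj 0 x y \<longleftrightarrow> x \<in> {q 0, q 1, q 2} \<and> y \<in> {q 0, q 1, q 2} \<and> x \<noteq> y" for x y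
  proof -
    have "adj 0 x y \<longleftrightarrow> x \<in> V 0 \<and> y \<in> V 0 \<and> x \<noteq> y"
      unfolding adj_def using V_SG[of x 0] V_SG[of y 0] by auto
    thus ?thesis unfolding V_0 .
  qed
  moreover have "q 0 \<noteq> q 1" "q 0 \<noteq> q 2" "q 1 \<noteq> q 2" by simp_all
  ultimately show ?thesis using distinct_pairs_of_three[of "q 0" "q 1" "q 2"] by (simp only: simp_thms)
qed

lemma finite_adj: "finite {(x, y). adj m x y}"
  by (induction m) (simp_all only: adj_Suc adj_0_set, auto)

lemma images_meet: "f ` A \<inter> g ` B \<noteq> {} \<Longrightarrow> \<exists>a\<in>A. \<exists>b\<in>B. f a = g b"
  by auto

text \<open>The cells of \<open>F i\<close> and \<open>F j\<close> share at most one point, so an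
  edge of level \<open>Suc m\<close> lies in exactly one of them, and the sum over edges splits like
  the recursion of \<open>graph_energy\<close>. The factor 2 counts every edge in both
  directions.\<close>

lemma energy_level_eq_EL: "energy_level m u v = graph_energy m u v"
proof -
  have "(\<Sum>(x, y) | adj m x y. (u x - u y) * (v x - v y)) = 2 * (3/5) ^ m * graph_energy m u v"
  proof (induction m arbitrary: u v)
    case 0
    have "q 0 \<noteq> q 1" "q 0 \<noteq> q 2" "q 1 \<noteq> q 2" by simp_all
    thus ?case unfolding adj_0_set
      by (simp del: q_simps add: triangle_form_def) (simp add: algebra_simps)
  next
    case (Suc m)
    have "(\<Sum>(x, y) | adj (Suc m) x y. (u x - u y) * (v x - v y))
      = (\<Sum>i<3. \<Sum>(x, y)\<in>map_prod (F i) (F i) ` {(x, y). adj m x y}. (u x - u y) * (v x - v y))"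
      unfolding adj_Suc
    proof (rule sum.UNION_disjoint)
      show "\<forall>i\<in>{..<3}. \<forall>j\<in>{..<3}. i \<noteq> j \<longrightarrow> map_prod (F i) (F i) ` {(x, y). adj m x y} \<inter>
          map_prod (F j) (F j) ` {(x, y). adj m x y} = {}"
      proof (intro ballI impI, rule ccontr)
        fix i j assume ij: "i \<in> {..<3::nat}" "j \<in> {..<3}" "i \<noteq> j"
          "map_prod (F i) (F i) ` {(x, y). adj m x y} \<inter> map_prod (F j) (F j) ` {(x, y). adj m x y} \<noteq> {}"
        then obtain x y x' y' where *: "adj m x y" "adj m x' y'" "F i x = F j x'" "F i y = F j y'"
        proof -
          obtain p p' where p: "p \<in> {(x, y). adj m x y}" "p' \<in> {(x, y). adj m x y}"
            "map_prod (F i) (F i) p = map_prod (F j) (F j) p'" using images_meet[OF ij(4)] by (elim bexE)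
          have a: "adj m (fst p) (snd p)" "adj m (fst p') (snd p')"
            using p(1,2) by (simp_all only: mem_Collect_eq case_prod_beta)
          have f: "F i (fst p) = F j (fst p')" "F i (snd p) = F j (snd p')"
            using p(3) by (metis fst_map_prod, metis snd_map_prod)
          show ?thesis using that[OF a f] .
        qed
        have "x \<in> SG" "y \<in> SG" "x' \<in> SG" "y' \<in> SG" "x \<noteq> y" using * V_SG unfolding adj_def by blast+
        thus False using cells_meet(1)[of i j x x'] cells_meet(1)[of i j y y'] ij * by simp
      qed
    qed (auto simp: finite_adj)
    also have "\<dots> = (\<Sum>i<3. \<Sum>(x, y) | adj m x y. (u (F i x) - u (F i y)) * (v (F i x) - v (F i y)))"
    proof (rule sum.cong[OF refl])
      fix i
      have "inj_on (map_prod (F i) (F i)) {(x, y). adj m x y}" by (auto simp: inj_on_def)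
      thus "(\<Sum>(x, y)\<in>map_prod (F i) (F i) ` {(x, y). adj m x y}. (u x - u y) * (v x - v y)) =
        (\<Sum>(x, y) | adj m x y. (u (F i x) - u (F i y)) * (v (F i x) - v (F i y)))"
        by (simp add: sum.reindex case_prod_beta comp_def)
    qed
    also have "\<dots> = (\<Sum>i<3. 2 * (3/5) ^ m * graph_energy m (\<lambda>x. u (F i x)) (\<lambda>x. v (F i x)))"
      using Suc.IH[of "\<lambda>x. u (F _ x)" "\<lambda>x. v (F _ x)"] by simp
    also have "\<dots> = 2 * (3/5) ^ Suc m * graph_energy (Suc m) u v"
      by (simp add: sum_distrib_left[symmetric])
    finally show ?case .
  qed
  moreover have "(3/5) powi (- int m) * (3/5 :: real) ^ m = 1"
    by (simp add: power_int_minus power_int_of_nat)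
  ultimately show ?thesis unfolding energy_level_def by (simp add: mult.assoc[symmetric])
qed

lemma graph_energy_cong:
  "(\<And>x. x \<in> SG \<Longrightarrow> u x = u' x) \<Longrightarrow> (\<And>x. x \<in> SG \<Longrightarrow> v x = v' x) \<Longrightarrow> graph_energy m u v = graph_energy m u' v'"
proof (induction m arbitrary: u u' v v')
  case 0
  thus ?case by (simp add: triangle_form_def del: q_simps)
next
  case (Suc m)
  have "graph_energy m (\<lambda>x. u (F i x)) (\<lambda>x. v (F i x)) = graph_energy m (\<lambda>x. u' (F i x)) (\<lambda>x. v' (F i x))" if "i < 3" for i
    using Suc.prems that by (intro Suc.IH) (auto simp: F_SG)
  thus ?case by simp
qed

lemma graph_energy_sym: "graph_energy m u v = graph_energy m v u"
  by (induction m arbitrary: u v) (simp_all add: triangle_form_def mult.commute)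

lemma graph_energy_add_left: "graph_energy m (\<lambda>x. u x + c * u' x) v = graph_energy m u v + c * graph_energy m u' v"
proof (induction m arbitrary: u u' v)
  case 0 thus ?case by (simp add: triangle_form_def algebra_simps del: q_simps)
next
  case (Suc m) thus ?case by (simp add: sum_less3 algebra_simps)
qed

lemma graph_energy_nonneg: "graph_energy m u u \<ge> 0"
  by (induction m arbitrary: u) (auto simp: triangle_form_def intro!: sum_nonneg simp del: q_simps)

text \<open>The harmonic extension minimizes the energy at the next level.\<close>

lemma graph_energy_mono_Suc: "graph_energy m u u \<le> graph_energy (Suc m) u u"
proof (induction m arbitrary: u)
  case 0
  define a b c x y z where "a = u (q 0)" "b = u (q 1)" "c = u (q 2)"
    "x = u (F 1 (q 2))" "y = u (F 0 (q 2))" "z = u (F 0 (q 1))"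
  note d = this
  have e: "F (Suc 0) (q 0) = F 0 (q 1)" "F 2 (q 0) = F 0 (q 2)" "F 2 (q 1) = F 1 (q 2)" "F 2 (q (Suc 0)) = F 1 (q 2)"
    "F 1 (q 0) = F 0 (q 1)"
    by (simp_all only: F_q_swap One_nat_def)
  have "graph_energy (Suc 0) u u - graph_energy 0 u u = 5/3 * (((a-z)^2 + (z-y)^2 + (a-y)^2) + ((z-b)^2 + (b-x)^2+(z-x)^2)
     + ((y-x)^2+(x-c)^2+(y-c)^2)) - ((a-b)^2+(b-c)^2+(a-c)^2)"
    unfolding d by (simp add: triangle_form_def sum_less3 e power2_eq_square del: q_simps)
  \<comment> \<open>A certificate as a sum of squares: \<open>5*x-(2*b+2*c+a)\<close> and its
    analogues are 5 times the deviations of the midpoint values from the harmonic rule 2/5, 2/5,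
    1/5.\<close>
  also have "\<dots> = (5*x-(2*b+2*c+a))^2/15 + (5*y-(2*a+2*c+b))^2/15 + (5*z-(2*a+2*b+c))^2/15
     + ((5*x-(2*b+2*c+a)) - (5*y-(2*a+2*c+b)))^2/15 + ((5*x-(2*b+2*c+a)) - (5*z-(2*a+2*b+c)))^2/15
     + ((5*y-(2*a+2*c+b)) - (5*z-(2*a+2*b+c)))^2/15 + (5*x-(2*b+2*c+a))^2/15 + (5*y-(2*a+2*c+b))^2/15 + (5*z-(2*a+2*b+c))^2/15 "
    by (simp add: power2_eq_square field_simps)
  also have "\<dots> \<ge> 0" by simp
  finally show ?case by simp
next
  case (Suc m)
  have "(\<Sum>i<3. graph_energy m (\<lambda>x. u (F i x)) (\<lambda>x. u (F i x))) \<le> (\<Sum>i<3. graph_energy (Suc m) (\<lambda>x. u (F i x)) (\<lambda>x. u (F i x)))"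
    by (rule sum_mono) (rule Suc.IH)
  thus ?case by (subst (1 2) graph_energy.simps(2)) simp
qed

lemma graph_energy_eq_0_imp:
  assumes u: "contSG u" and 0: "\<And>m. graph_energy m u u = 0" and "u (q 0) = 0" and x: "x \<in> SG"
  shows "u x = 0"
proof -
  have "\<forall>j<3. u (Fw w (q j)) = 0" if "w \<in> words m" for m w
    using that 0 assms(3)
  proof (induction m arbitrary: w u)
    case 0
    have "triangle_form (\<lambda>j. u (q j)) (\<lambda>j. u (q j)) = 0" using "0.prems"(2)[of 0] by simp
    hence "u (q 0) = u (q 1)" "u (q 0) = u (q 2)"
      unfolding triangle_form_def by (simp_all add: sum_nonneg_eq_0_iff add_nonneg_eq_0_iff)
    thus ?case using 0 by (auto elim!: less3_cases simp del: q_simps)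
  next
    case (Suc m)
    obtain i v where v: "i < 3" "v \<in> words m" "w = i # v" using Suc.prems by (auto simp: words_Suc)
    have D0: "triangle_form (\<lambda>j. u (q j)) (\<lambda>j. u (q j)) = 0" using Suc.prems(2)[of 0] by simp
    hence "u (q 0) = u (q 1)" "u (q 0) = u (q 2)"
      unfolding triangle_form_def by (simp_all add: add_nonneg_eq_0_iff)
    hence ui: "u (q i) = 0" using Suc.prems(3) v(1) by (auto elim!: less3_cases simp del: q_simps)
    have E: "graph_energy n (\<lambda>x. u (F i x)) (\<lambda>x. u (F i x)) = 0" for n
    proof -
      have "(\<Sum>i<3. graph_energy n (\<lambda>x. u (F i x)) (\<lambda>x. u (F i x))) = 0" using Suc.prems(2)[of "Suc n"] by simp
      thus ?thesis using v(1) by (subst (asm) sum_nonneg_eq_0_iff) (auto simp: graph_energy_nonneg)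
    qed
    have "triangle_form (\<lambda>j. u (F i (q j))) (\<lambda>j. u (F i (q j))) = 0" using E[of 0] by simp
    hence "u (F i (q 0)) = u (F i (q 1))" "u (F i (q 0)) = u (F i (q 2))"
      unfolding triangle_form_def by (simp_all add: add_nonneg_eq_0_iff)
    hence "u (F i (q 0)) = 0" using ui F_q_self[of i] v(1) by (auto elim!: less3_cases simp del: q_simps)
    thus ?case using Suc.IH[OF v(2), of "\<lambda>x. u (F i x)"] E v(3) by simp
  qed
  thus ?thesis using contSG_eq_on_vertices[OF u, of "\<lambda>_. 0", OF _ _ x] by force
qed

section \<open>Self-similar functions and harmonic functions\<close>

definition aff :: "(nat \<Rightarrow> real) \<Rightarrow> real \<times> real \<Rightarrow> real" where
  "aff a x = a 0 * lam 0 x + a 1 * lam 1 x + a 2 * lam 2 x"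

lemma aff_q: "j < 3 \<Longrightarrow> aff a (q j) = a j"
  by (auto simp: aff_def lam_q elim!: less3_cases simp del: q_simps)

lemma aff_F: "i < 3 \<Longrightarrow> aff a (F i x) = (a i + aff a x) / 2"
  by (auto simp: aff_def lam_F field_simps elim!: less3_cases simp del: q_simps)

lemma aff_diff_le:
  assumes "\<And>j. j < 3 \<Longrightarrow> \<bar>a j - b j\<bar> \<le> g" "x \<in> SG"
  shows "\<bar>aff a x - aff b x\<bar> \<le> g"
proof -
  have l: "lam 0 x \<ge> 0" "lam 1 x \<ge> 0" "lam 2 x \<ge> 0"
    using assms(2) SG_subset_triangle by (auto simp: triangle_def)
  have "aff a x - aff b x = (a 0 - b 0) * lam 0 x + (a 1 - b 1) * lam 1 x + (a 2 - b 2) * lam 2 x"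
    by (simp add: aff_def algebra_simps)
  also have "\<bar>\<dots>\<bar> \<le> \<bar>a 0 - b 0\<bar> * lam 0 x + \<bar>a 1 - b 1\<bar> * lam 1 x + \<bar>a 2 - b 2\<bar> * lam 2 x"
    using l by (intro order.trans[OF abs_triangle_ineq] add_mono) (auto simp: abs_mult)
  also have "\<dots> \<le> g * lam 0 x + g * lam 1 x + g * lam 2 x"
    using l assms(1) by (intro add_mono mult_right_mono) auto
  also have "\<dots> = g" using lam_sum[of x] by (simp add: distrib_left[symmetric])
  finally show ?thesis .
qed

text \<open>A function on the gasket may be prescribed by a parameter \<open>p\<close>, its vertex values
  \<open>val p\<close>, and the parameters \<open>T i p\<close> of its restrictions to the three cells.\<close>

definition cell_index :: "real \<times> real \<Rightarrow> nat" where
  "cell_index x = (LEAST i. x \<in> F i ` SG)"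

primrec interpolant :: "(nat \<Rightarrow> 'p \<Rightarrow> 'p) \<Rightarrow> ('p \<Rightarrow> nat \<Rightarrow> real) \<Rightarrow> nat \<Rightarrow> 'p \<Rightarrow> real \<times> real \<Rightarrow> real" where
  "interpolant T val 0 p x = aff (val p) x"
| "interpolant T val (Suc n) p x =
     interpolant T val n (T (cell_index x) p) (Finv (cell_index x) x)"

definition self_similar_function :: "(nat \<Rightarrow> 'p \<Rightarrow> 'p) \<Rightarrow> ('p \<Rightarrow> nat \<Rightarrow> real) \<Rightarrow> 'p \<Rightarrow> real \<times> real \<Rightarrow> real" where
  "self_similar_function T val p x = lim (\<lambda>n. interpolant T val n p x)"

text \<open>\<open>Q p g\<close> bounds by \<open>g\<close> how far the midpoint values are from
  affine interpolation, and \<open>r\<close> is the contraction of this bound per level.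
  \<open>val_fix\<close> preserves the values at the corners, and \<open>val_swap\<close> makes two
  cells agree at their common point.\<close>

locale self_similar_scheme =
  fixes T :: "nat \<Rightarrow> 'p \<Rightarrow> 'p" and val :: "'p \<Rightarrow> nat \<Rightarrow> real"
    and Q :: "'p \<Rightarrow> real \<Rightarrow> bool" and r :: real
  assumes r: "0 \<le> r" "r < 1"
    and Q_T: "Q p g \<Longrightarrow> i < 3 \<Longrightarrow> Q (T i p) (r * g)"
    and val_fix: "Q p g \<Longrightarrow> i < 3 \<Longrightarrow> val (T i p) i = val p i"
    and val_swap: "Q p g \<Longrightarrow> i < 3 \<Longrightarrow> j < 3 \<Longrightarrow> val (T i p) j = val (T j p) i"
    and val_near: "Q p g \<Longrightarrow> i < 3 \<Longrightarrow> j < 3 \<Longrightarrow> \<bar>val (T i p) j - (val p i + val p j) / 2\<bar> \<le> g"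
begin

abbreviation "I n p x \<equiv> interpolant T val n p x"
abbreviation "L p x \<equiv> self_similar_function T val p x"

lemma cell_index_F:
  assumes "i < 3" "x \<in> SG"
  obtains k y where "cell_index (F i x) = k" "k < 3" "y \<in> SG" "F i x = F k y"
proof -
  have "F i x \<in> F (cell_index (F i x)) ` SG" "cell_index (F i x) \<le> i"
    unfolding cell_index_def using assms by (auto intro: LeastI Least_le)
  thus ?thesis using that assms by (metis imageE order.strict_trans1)
qed

text \<open>At a junction \<open>cell_index\<close> selects one of two cells. That the other one
  gives the same value rests on the vertex values at level \<open>n\<close>, whence the joint
  induction.\<close>

lemma interpolant_q_F:
  "Q p g \<Longrightarrow> (\<forall>j<3. I n p (q j) = val p j) \<and> (\<forall>i<3. \<forall>x\<in>SG. I (Suc n) p (F i x) = I n (T i p) x)"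
proof (induction n arbitrary: p g)
  have step: "\<forall>i<3. \<forall>x\<in>SG. I (Suc n) p (F i x) = I n (T i p) x"
    if Q: "Q p g" and IH: "\<And>i j. i < 3 \<Longrightarrow> j < 3 \<Longrightarrow> I n (T i p) (q j) = val (T i p) j" for n p g
  proof (intro allI ballI impI)
    fix i x assume i: "i < (3::nat)" "x \<in> SG"
    obtain k y where k: "cell_index (F i x) = k" "k < 3" "y \<in> SG" "F i x = F k y"
      using cell_index_F[OF i] .
    show "I (Suc n) p (F i x) = I n (T i p) x"
    proof (cases "i = k")
      case True
      thus ?thesis using k by simp
    next
      case False
      have "x = q k" "y = q i" using cells_meet[OF i(1) k(2) False i(2) k(3,4)] by auto
      moreover have "I (Suc n) p (F i x) = I n (T k p) y" using k by simp
      ultimately show ?thesis using IH[OF i(1) k(2)] IH[OF k(2) i(1)] val_swap[OF Q i(1) k(2)] by simp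
    qed
  qed
  case 0
  thus ?case using step[of p g 0] by (auto simp: aff_q)
  case (Suc n)
  have IH: "I n (T i p) (q j) = val (T i p) j" if "i < 3" "j < 3" for i j
    using Suc.IH[OF Q_T[OF Suc.prems that(1)]] that by blast
  have "I (Suc n) p (q j) = val p j" if j: "j < 3" for j
  proof -
    have "I (Suc n) p (q j) = I (Suc n) p (F j (q j))" by simp
    also have "\<dots> = I n (T j p) (q j)" using step[OF Suc.prems IH] j by (metis q_in_SG)
    finally show ?thesis using IH[OF j j] val_fix[OF Suc.prems j] by simp
  qed
  moreover have "I (Suc n) (T i p) (q j) = val (T i p) j" if "i < 3" "j < 3" for i j
  proof -
    have Q: "Q (T i p) (r * g)" using Q_T[OF Suc.prems that(1)] .
    have 1: "I n (T k (T i p)) (q l) = val (T k (T i p)) l" if "k < 3" "l < 3" for k l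
      using Suc.IH[OF Q_T[OF Q that(1)]] that by blast
    have "I (Suc n) (T i p) (q j) = I (Suc n) (T i p) (F j (q j))" by simp
    also have "\<dots> = I n (T j (T i p)) (q j)" using step[OF Q 1] that(2) by (metis q_in_SG)
    finally show ?thesis using 1[OF that(2) that(2)] val_fix[OF Q that(2)] by simp
  qed
  ultimately show ?case using step[OF Suc.prems, of "Suc n"] by blast
qed

lemma interpolant_F: "Q p g \<Longrightarrow> i < 3 \<Longrightarrow> x \<in> SG \<Longrightarrow> I (Suc n) p (F i x) = I n (T i p) x"
  using interpolant_q_F by blast

lemma interpolant_q: "Q p g \<Longrightarrow> j < 3 \<Longrightarrow> I n p (q j) = val p j"
  using interpolant_q_F by blast

lemma interpolant_cont: "Q p g \<Longrightarrow> contSG (I n p)"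
proof (induction n arbitrary: p g)
  case 0
  thus ?case unfolding interpolant.simps aff_def by (intro continuous_intros)
next
  case (Suc n)
  have "continuous_on (\<Union>i\<in>{..<3}. F i ` SG) (I (Suc n) p)"
  proof (rule continuous_on_closed_Union)
    fix i assume i: "i \<in> {..<3::nat}"
    show "closed (F i ` SG)"
      using compact_SG by (intro compact_imp_closed compact_continuous_image continuous_F)
    have "contSG (I n (T i p))" using Suc.IH[OF Q_T[OF Suc.prems]] i by simp
    hence "continuous_on (F i ` SG) (\<lambda>x. I n (T i p) (Finv i x))"
      by (rule continuous_on_compose2) (auto intro: continuous_Finv)
    moreover have "\<forall>x\<in>F i ` SG. I (Suc n) p x = I n (T i p) (Finv i x)"
      using interpolant_F[OF Suc.prems] i by (metis Finv_F imageE lessThan_iff)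
    ultimately show "continuous_on (F i ` SG) (I (Suc n) p)"
      using continuous_on_cong[of "F i ` SG" "F i ` SG" "I (Suc n) p" "\<lambda>x. I n (T i p) (Finv i x)"]
      by blast
  qed auto
  thus ?case using SG_eq by simp
qed

text \<open>At level 0 this is \<open>val_near\<close>, spread over the cell by the convexity of
  barycentric interpolation; every further level gains a factor \<open>r\<close>.\<close>

lemma interpolant_step:
  assumes "Q p g" "x \<in> SG"
  shows "\<bar>I (Suc n) p x - I n p x\<bar> \<le> r ^ n * g"
  using assms
proof (induction n arbitrary: p g x)
  case 0
  obtain i y where i: "i < 3" "y \<in> SG" "x = F i y" using SG_cases[OF 0(2)] .
  have "I (Suc 0) p x = aff (val (T i p)) y" using interpolant_F[OF 0(1) i(1,2), of 0] i by simp
  moreover have "aff (val p) (F i y) = aff (\<lambda>j. (val p i + val p j) / 2) y"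
  proof -
    have "aff (\<lambda>j. (c + a j) / 2) y = (c * (lam 0 y + lam 1 y + lam 2 y) + aff a y) / 2" for c a
      by (simp add: aff_def field_simps)
    thus ?thesis unfolding aff_F[OF i(1)] lam_sum by simp
  qed
  ultimately show ?case using aff_diff_le[OF val_near[OF 0(1) i(1)] i(2)] i by simp
next
  case (Suc n)
  obtain i y where i: "i < 3" "y \<in> SG" "x = F i y" using SG_cases[OF Suc.prems(2)] .
  have "\<bar>I (Suc n) (T i p) y - I n (T i p) y\<bar> \<le> r ^ n * (r * g)"
    using Suc.IH[OF Q_T[OF Suc.prems(1) i(1)] i(2)] .
  thus ?case using interpolant_F[OF Suc.prems(1) i(1,2)] i by (simp add: mult_ac del: interpolant.simps)
qed

lemma interpolant_step_sum:
  assumes "Q p g" "x \<in> SG"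
  shows "\<bar>I (n + k) p x - I n p x\<bar> \<le> r ^ n * g * (\<Sum>i<k. r ^ i)"
proof (induction k)
  case (Suc k)
  have "\<bar>I (Suc (n + k)) p x - I (n + k) p x\<bar> \<le> r ^ (n + k) * g"
    by (rule interpolant_step[OF assms])
  with Suc show ?case by (simp add: algebra_simps power_add del: interpolant.simps)
qed simp

lemma Q_nonneg: "Q p g \<Longrightarrow> 0 \<le> g"
  using val_near[of p g 0 0] by linarith

lemma geometric_partial_le: "(\<Sum>i<k. r ^ i) \<le> 1 / (1 - r)"
proof -
  have "(\<Sum>i<k. r ^ i) \<le> (\<Sum>i. r ^ i)" using r by (intro sum_le_suminf summable_geometric) auto
  thus ?thesis using r by (simp add: suminf_geometric)
qed

lemma interpolant_near:
  assumes "Q p g" "x \<in> SG"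
  shows "\<bar>I (n + k) p x - I n p x\<bar> \<le> r ^ n * (g / (1 - r))"
proof -
  have "r ^ n * g * (\<Sum>i<k. r ^ i) \<le> r ^ n * g * (1 / (1 - r))"
    using Q_nonneg[OF assms(1)] r by (intro mult_left_mono geometric_partial_le) auto
  thus ?thesis using interpolant_step_sum[OF assms, of n k] by simp
qed

lemma L_limit:
  assumes "Q p g" "x \<in> SG"
  shows "(\<lambda>n. I n p x) \<longlonglongrightarrow> L p x"
proof -
  have "summable (\<lambda>n. I (Suc n) p x - I n p x)"
  proof (rule summable_comparison_test'[of "\<lambda>n. r ^ n * g" 0])
    show "summable (\<lambda>n. r ^ n * g)" using r by (intro summable_mult2 summable_geometric) auto
  qed (use interpolant_step[OF assms] in \<open>simp del: interpolant.simps\<close>)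
  from summable_LIMSEQ[OF this]
  have "(\<lambda>n. I n p x - I 0 p x) \<longlonglongrightarrow> (\<Sum>n. I (Suc n) p x - I n p x)"
    unfolding sum_lessThan_telescope[of "\<lambda>n. I n p x"] .
  hence "(\<lambda>n. (I n p x - I 0 p x) + I 0 p x) \<longlonglongrightarrow> (\<Sum>n. I (Suc n) p x - I n p x) + I 0 p x"
    by (intro tendsto_intros)
  hence "convergent (\<lambda>n. I n p x)" by (auto simp: convergent_def simp del: interpolant.simps)
  thus ?thesis unfolding self_similar_function_def by (simp add: convergent_LIMSEQ_iff)
qed

lemma L_near:
  assumes "Q p g" "x \<in> SG"
  shows "\<bar>L p x - I n p x\<bar> \<le> r ^ n * (g / (1 - r))"
proof (rule LIMSEQ_le_const2)
  have "(\<lambda>k. I (k + n) p x) \<longlonglongrightarrow> L p x" using L_limit[OF assms] by (rule LIMSEQ_ignore_initial_segment)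
  thus "(\<lambda>k. \<bar>I (k + n) p x - I n p x\<bar>) \<longlonglongrightarrow> \<bar>L p x - I n p x\<bar>" by (intro tendsto_intros)
  show "\<exists>N. \<forall>k\<ge>N. \<bar>I (k + n) p x - I n p x\<bar> \<le> r ^ n * (g / (1 - r))"
    using interpolant_near[OF assms, of n] by (metis add.commute)
qed

lemma L_cont:
  assumes "Q p g"
  shows "contSG (L p)"
proof (rule uniform_limit_theorem)
  show "uniform_limit SG (\<lambda>n. I n p) (L p) sequentially"
  proof (rule uniform_limitI)
    fix e :: real assume "e > 0"
    have "(\<lambda>n. r ^ n * (g / (1 - r))) \<longlonglongrightarrow> 0 * (g / (1 - r))"
      using r by (intro tendsto_intros LIMSEQ_power_zero) auto
    hence "\<forall>\<^sub>F n in sequentially. r ^ n * (g / (1 - r)) < e"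
      using \<open>e > 0\<close> by (intro order_tendstoD(2)[of _ 0]) auto
    thus "\<forall>\<^sub>F n in sequentially. \<forall>x\<in>SG. dist (I n p x) (L p x) < e"
    proof eventually_elim
      case (elim n)
      thus ?case using L_near[OF assms, of _ n] by (auto simp: dist_real_def abs_minus_commute intro: order.strict_trans1)
    qed
  qed
qed (use interpolant_cont[OF assms] in auto)

lemma L_q: "Q p g \<Longrightarrow> j < 3 \<Longrightarrow> L p (q j) = val p j"
  using L_limit[of p g "q j"] interpolant_q[of p g j] by (simp add: LIMSEQ_const_iff del: q_simps)

lemma L_F:
  assumes "Q p g" "i < 3" "x \<in> SG"
  shows "L p (F i x) = L (T i p) x"
proof -
  have "(\<lambda>n. I (Suc n) p (F i x)) \<longlonglongrightarrow> L p (F i x)"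
    using L_limit[OF assms(1) F_SG[OF assms(2,3)]] by (rule LIMSEQ_Suc)
  hence "(\<lambda>n. I n (T i p) x) \<longlonglongrightarrow> L p (F i x)" using interpolant_F[OF assms] by simp
  thus ?thesis using L_limit[OF Q_T[OF assms(1,2)] assms(3)] LIMSEQ_unique by blast
qed

lemma L_aff: "Q p g \<Longrightarrow> x \<in> SG \<Longrightarrow> \<bar>L p x - aff (val p) x\<bar> \<le> g / (1 - r)"
  using L_near[of p g x 0] by simp

end

section \<open>Harmonic functions\<close>

definition osc_le :: "(nat \<Rightarrow> real) \<Rightarrow> real \<Rightarrow> bool" where
  "osc_le a b \<longleftrightarrow> \<bar>a 0 - a 1\<bar> \<le> b \<and> \<bar>a 1 - a 2\<bar> \<le> b \<and> \<bar>a 0 - a 2\<bar> \<le> b"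

text \<open>\<open>3 - i - j\<close> is the index of the vertex opposite to the edge joining
  \<open>q i\<close> and \<open>q j\<close>.\<close>

definition harmonic_step :: "nat \<Rightarrow> (nat \<Rightarrow> real) \<Rightarrow> nat \<Rightarrow> real" where
  "harmonic_step i a j = (if i = j then a i else (2 * (a 0 + a 1 + a 2) - a (3 - i - j)) / 5)"

lemma harmonic_step_simps:
  "harmonic_step i a i = a i"
  "harmonic_step 0 a (Suc 0) = (2 * (a 0 + a 1 + a 2) - a 2) / 5"
  "harmonic_step 0 a 2 = (2 * (a 0 + a 1 + a 2) - a 1) / 5"
  "harmonic_step (Suc 0) a 0 = (2 * (a 0 + a 1 + a 2) - a 2) / 5"
  "harmonic_step (Suc 0) a 2 = (2 * (a 0 + a 1 + a 2) - a 0) / 5"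
  "harmonic_step 2 a 0 = (2 * (a 0 + a 1 + a 2) - a 1) / 5"
  "harmonic_step 2 a (Suc 0) = (2 * (a 0 + a 1 + a 2) - a 0) / 5"
  by (simp_all add: harmonic_step_def)

definition harmonic :: "(nat \<Rightarrow> real) \<Rightarrow> real \<times> real \<Rightarrow> real" where
  "harmonic = self_similar_function harmonic_step (\<lambda>a. a)"

text \<open>The factor 3/5 comes from differences such as
  \<open>(3 * a 0 - 2 * a 1 - a 2) / 5\<close>, which is 2/5 of one old difference plus 1/5 of
  another.\<close>

interpretation harmonic_scheme: self_similar_scheme harmonic_step "\<lambda>a. a" osc_le "3/5"
proof
  fix p :: "nat \<Rightarrow> real" and g i assume "osc_le p g" "i < (3::nat)"
  thus "osc_le (harmonic_step i p) (3/5 * g)"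
    unfolding osc_le_def
    by (elim less3_cases; simp add: harmonic_step_simps abs_le_iff field_simps)
next
  fix p :: "nat \<Rightarrow> real" and g i j assume *: "osc_le p g" "i < (3::nat)" "j < (3::nat)"
  show "\<bar>harmonic_step i p j - (p i + p j) / 2\<bar> \<le> g"
    using * unfolding osc_le_def
    by (elim less3_cases; simp add: harmonic_step_simps abs_le_iff field_simps)
qed (auto simp: harmonic_step_def add.commute)

lemma osc_le_exists: "\<exists>b. osc_le a b"
  unfolding osc_le_def by (rule exI[of _ "\<bar>a 0 - a 1\<bar> + \<bar>a 1 - a 2\<bar> + \<bar>a 0 - a 2\<bar>"]) auto

lemma harmonic_cont: "contSG (harmonic a)"
  using harmonic_scheme.L_cont osc_le_exists unfolding harmonic_def by blast

lemma harmonic_q: "j < 3 \<Longrightarrow> harmonic a (q j) = a j"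
  using harmonic_scheme.L_q osc_le_exists unfolding harmonic_def by metis

lemma harmonic_F: "i < 3 \<Longrightarrow> x \<in> SG \<Longrightarrow> harmonic a (F i x) = harmonic (harmonic_step i a) x"
  using harmonic_scheme.L_F osc_le_exists unfolding harmonic_def by metis

lemma harmonic_limit: "x \<in> SG \<Longrightarrow> (\<lambda>n. interpolant harmonic_step (\<lambda>a. a) n a x) \<longlonglongrightarrow> harmonic a x"
  using harmonic_scheme.L_limit osc_le_exists unfolding harmonic_def by metis

lemma harmonic_linear:
  assumes x: "x \<in> SG"
  shows "harmonic (\<lambda>j. a j + c * b j) x = harmonic a x + c * harmonic b x"
proof -
  have *: "interpolant harmonic_step (\<lambda>a. a) n (\<lambda>j. a j + c * b j) x
    = interpolant harmonic_step (\<lambda>a. a) n a x + c * interpolant harmonic_step (\<lambda>a. a) n b x" for n a b x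
  proof (induction n arbitrary: a b x)
    case 0
    thus ?case by (simp add: aff_def algebra_simps)
  next
    case (Suc n)
    have "harmonic_step i (\<lambda>j. a j + c * b j) = (\<lambda>j. harmonic_step i a j + c * harmonic_step i b j)" for i
      by (auto simp: harmonic_step_def field_simps)
    thus ?case using Suc by simp
  qed
  have "(\<lambda>n. interpolant harmonic_step (\<lambda>a. a) n a x + c * interpolant harmonic_step (\<lambda>a. a) n b x)
    \<longlonglongrightarrow> harmonic a x + c * harmonic b x" by (intro tendsto_intros harmonic_limit x)
  thus ?thesis using harmonic_limit[OF x, of "\<lambda>j. a j + c * b j"] LIMSEQ_unique unfolding * by blast
qed

lemma harmonic_cong: "a 0 = b 0 \<Longrightarrow> a 1 = b 1 \<Longrightarrow> a 2 = b 2 \<Longrightarrow> x \<in> SG \<Longrightarrow> harmonic a x = harmonic b x"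
proof -
  assume ab: "a 0 = b 0" "a 1 = b 1" "a 2 = b 2" and x: "x \<in> SG"
  have "interpolant harmonic_step (\<lambda>a. a) n a x = interpolant harmonic_step (\<lambda>a. a) n b x"
    if "x \<in> SG" for n x using that ab
  proof (induction n arbitrary: a b x)
    case 0
    thus ?case by (simp add: aff_def)
  next
    case (Suc n)
    obtain i y where i: "i < 3" "y \<in> SG" "x = F i y" using SG_cases[OF Suc.prems(1)] .
    obtain g g' where Q: "osc_le a g" "osc_le b g'" using osc_le_exists by metis
    have "harmonic_step i a j = harmonic_step i b j" if "j = 0 \<or> j = 1 \<or> j = 2" for j
      using i(1) that Suc.prems by (elim less3_cases disjE) (simp_all add: harmonic_step_def)
    hence "interpolant harmonic_step (\<lambda>a. a) n (harmonic_step i a) y = interpolant harmonic_step (\<lambda>a. a) n (harmonic_step i b) y"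
      using Suc.IH[OF i(2)] by blast
    thus ?case using harmonic_scheme.interpolant_F[OF Q(1) i(1,2)] harmonic_scheme.interpolant_F[OF Q(2) i(1,2)] i(3)
      by (simp del: interpolant.simps)
  qed
  thus ?thesis using x unfolding harmonic_def self_similar_function_def by simp
qed

lemma harmonic_bounds:
  assumes "\<And>j. j < 3 \<Longrightarrow> l \<le> a j \<and> a j \<le> u" "x \<in> SG"
  shows "l \<le> harmonic a x \<and> harmonic a x \<le> u"
proof -
  have *: "l \<le> interpolant harmonic_step (\<lambda>a. a) n a x \<and> interpolant harmonic_step (\<lambda>a. a) n a x \<le> u" for n
    using assms
  proof (induction n arbitrary: a x)
    case 0
    have lm: "lam 0 x \<ge> 0" "lam 1 x \<ge> 0" "lam 2 x \<ge> 0"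
      using 0(2) SG_subset_triangle by (auto simp: triangle_def)
    have "l * lam 0 x + l * lam 1 x + l * lam 2 x \<le> aff a x" "aff a x \<le> u * lam 0 x + u * lam 1 x + u * lam 2 x"
      unfolding aff_def using lm 0(1) by (intro add_mono mult_right_mono; simp)+
    thus ?case using lam_sum[of x] by (simp add: distrib_left[symmetric])
  next
    case (Suc n)
    obtain i y where i: "i < 3" "y \<in> SG" "x = F i y" using SG_cases[OF Suc.prems(2)] .
    obtain g where Q: "osc_le a g" using osc_le_exists by metis
    have a: "l \<le> a 0" "a 0 \<le> u" "l \<le> a 1" "a 1 \<le> u" "l \<le> a 2" "a 2 \<le> u"
      using Suc.prems(1)[of 0] Suc.prems(1)[of 1] Suc.prems(1)[of 2] by auto
    have "l \<le> harmonic_step i a j \<and> harmonic_step i a j \<le> u" if "j < 3" for j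
      using i(1) that a by (elim less3_cases) (simp_all add: harmonic_step_def)
    from Suc.IH[OF this i(2)] show ?case using harmonic_scheme.interpolant_F[OF Q i(1,2)] i(3)
      by (simp del: interpolant.simps)
  qed
  show ?thesis
    using LIMSEQ_le_const[OF harmonic_limit[OF assms(2), of a], of l]
      LIMSEQ_le_const2[OF harmonic_limit[OF assms(2), of a], of u] * by blast
qed

section \<open>The harmonic basis and moments against it\<close>

definition hb :: "nat \<Rightarrow> real \<times> real \<Rightarrow> real" where
  "hb j = harmonic (\<lambda>i. of_bool (i = j))"

lemma hb_cont [continuous_intros]: "contSG (hb j)"
  unfolding hb_def by (rule harmonic_cont)

lemma hb_bounds: "x \<in> SG \<Longrightarrow> 0 \<le> hb j x \<and> hb j x \<le> 1"
  unfolding hb_def by (rule harmonic_bounds) auto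

lemma harmonic_eq_hb:
  assumes x: "x \<in> SG"
  shows "harmonic a x = a 0 * hb 0 x + a 1 * hb 1 x + a 2 * hb 2 x"
proof -
  let ?e = "\<lambda>k i. of_bool (i = k) :: real"
  have "harmonic a x = harmonic (\<lambda>j. ((\<lambda>j. (\<lambda>j. 0 + a 0 * ?e 0 j) j + a 1 * ?e 1 j)) j + a 2 * ?e 2 j) x"
    by (rule harmonic_cong[OF _ _ _ x]) auto
  also have "\<dots> = harmonic (\<lambda>j. 0) x + a 0 * hb 0 x + a 1 * hb 1 x + a 2 * hb 2 x"
    unfolding harmonic_linear[OF x] hb_def by simp
  also have "harmonic (\<lambda>j. 0) x = 0" using harmonic_bounds[of 0 "\<lambda>_. 0" 0, OF _ x] by auto
  finally show ?thesis by simp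
qed

lemma hb_sum: "x \<in> SG \<Longrightarrow> hb 0 x + hb 1 x + hb 2 x = 1"
  using harmonic_eq_hb[of x "\<lambda>_. 1"] harmonic_bounds[of 1 "\<lambda>_. 1" 1 x] by simp

lemma hb_F:
  assumes "i < 3" "x \<in> SG"
  shows "hb j (F i x) = harmonic_step i (\<lambda>i. of_bool (i = j)) 0 * hb 0 x +
    harmonic_step i (\<lambda>i. of_bool (i = j)) 1 * hb 1 x + harmonic_step i (\<lambda>i. of_bool (i = j)) 2 * hb 2 x"
proof -
  have "hb j (F i x) = harmonic (harmonic_step i (\<lambda>i. of_bool (i = j))) x"
    unfolding hb_def by (rule harmonic_F[OF assms])
  also have "\<dots> = harmonic_step i (\<lambda>i. of_bool (i = j)) 0 * hb 0 x +
    harmonic_step i (\<lambda>i. of_bool (i = j)) 1 * hb 1 x + harmonic_step i (\<lambda>i. of_bool (i = j)) 2 * hb 2 x"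
    by (rule harmonic_eq_hb[OF assms(2)])
  finally show ?thesis .
qed

text \<open>By the Gauss-Green formula with test function \<open>hb j\<close>, this moment is the
  contribution of a source \<open>f\<close> to the normal derivative at \<open>q j\<close>; it
  reappears in \<open>nflux\<close>.\<close>

definition mom :: "(real \<times> real \<Rightarrow> real) \<Rightarrow> nat \<Rightarrow> real" where
  "mom f j = intg (\<lambda>x. f x * hb j x)"

lemma mom_cong: "(\<And>x. x \<in> SG \<Longrightarrow> f x = g x) \<Longrightarrow> mom f j = mom g j"
  unfolding mom_def by (rule intg_cong) simp

lemma mom_add: "contSG f \<Longrightarrow> contSG g \<Longrightarrow> mom (\<lambda>x. f x + c * g x) j = mom f j + c * mom g j"
proof -
  assume f: "contSG f" "contSG g"
  have "mom (\<lambda>x. f x + c * g x) j = intg (\<lambda>x. f x * hb j x + c * (g x * hb j x))"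
    unfolding mom_def by (rule intg_cong) (simp add: algebra_simps)
  also have "\<dots> = mom f j + c * mom g j"
    unfolding mom_def using f by (subst intg_add) (auto intro!: continuous_intros simp: intg_cmult)
  finally show ?thesis .
qed

lemma mom_divide: "mom (\<lambda>x. f x / c) j = mom f j / c"
  unfolding mom_def using intg_divide[of "\<lambda>x. f x * hb j x" c] by (simp add: field_simps)

lemma mom_0 [simp]: "mom (\<lambda>x. 0) j = 0" by (simp add: mom_def)

lemma mom_split:
  assumes f: "contSG f" and j: "j < 3"
  shows "mom f j = (\<Sum>i<3. harmonic_step i (\<lambda>i. of_bool (i = j)) 0 * mom (\<lambda>x. f (F i x)) 0 +
    harmonic_step i (\<lambda>i. of_bool (i = j)) 1 * mom (\<lambda>x. f (F i x)) 1 +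
    harmonic_step i (\<lambda>i. of_bool (i = j)) 2 * mom (\<lambda>x. f (F i x)) 2) / 3"
proof -
  have "mom f j = (\<Sum>i<3. intg (\<lambda>x. f (F i x) * hb j (F i x))) / 3"
    unfolding mom_def using f by (intro intg_split continuous_intros)
  moreover have "intg (\<lambda>x. f (F i x) * hb j (F i x)) = harmonic_step i (\<lambda>i. of_bool (i = j)) 0 * mom (\<lambda>x. f (F i x)) 0 +
    harmonic_step i (\<lambda>i. of_bool (i = j)) 1 * mom (\<lambda>x. f (F i x)) 1 +
    harmonic_step i (\<lambda>i. of_bool (i = j)) 2 * mom (\<lambda>x. f (F i x)) 2" if i: "i < 3" for i
  proof -
    let ?c = "\<lambda>k. harmonic_step i (\<lambda>i. of_bool (i = j)) k"
    have c: "contSG (\<lambda>x. f (F i x))" using contSG_F[OF f i] .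
    have "intg (\<lambda>x. f (F i x) * hb j (F i x)) =
      intg (\<lambda>x. ?c 0 * (f (F i x) * hb 0 x) + ?c 1 * (f (F i x) * hb 1 x) + ?c 2 * (f (F i x) * hb 2 x))"
      by (rule intg_cong) (simp add: hb_F[OF i] algebra_simps)
    also have "\<dots> = ?c 0 * mom (\<lambda>x. f (F i x)) 0 + ?c 1 * mom (\<lambda>x. f (F i x)) 1 + ?c 2 * mom (\<lambda>x. f (F i x)) 2"
      unfolding mom_def using c
      by (subst intg_add, (intro continuous_intros; assumption), (intro continuous_intros; assumption))+
        (simp add: intg_cmult)
    finally show ?thesis .
  qed
  ultimately show ?thesis by simp
qed

lemma mom_abs_le: "contSG f \<Longrightarrow> \<bar>mom f j\<bar> \<le> intg (\<lambda>x. \<bar>f x\<bar>)"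
proof -
  assume f: "contSG f"
  have "\<bar>mom f j\<bar> \<le> intg (\<lambda>x. \<bar>f x * hb j x\<bar>)"
    unfolding mom_def using f by (intro intg_abs continuous_intros)
  also have "\<dots> \<le> intg (\<lambda>x. \<bar>f x\<bar>)"
  proof (rule intg_mono)
    fix x assume "x \<in> SG"
    thus "\<bar>f x * hb j x\<bar> \<le> \<bar>f x\<bar>" using hb_bounds[of x j] by (simp add: abs_mult mult_left_le)
  qed (use f in \<open>auto intro!: continuous_intros\<close>)
  finally show ?thesis .
qed

lemma mom_sum: "contSG f \<Longrightarrow> mom f 0 + mom f 1 + mom f 2 = intg f"
proof -
  assume f: "contSG f"
  have "intg f = intg (\<lambda>x. f x * hb 0 x + f x * hb 1 x + f x * hb 2 x)"
    by (rule intg_cong) (simp add: hb_sum[simplified] distrib_left[symmetric])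
  also have "\<dots> = mom f 0 + mom f 1 + mom f 2"
    unfolding mom_def using f
    by (subst intg_add, (intro continuous_intros; assumption), (intro continuous_intros; assumption))+ simp
  finally show ?thesis by simp
qed

section \<open>The Poisson equation\<close>

declare q_simps [simp del]

text \<open>\<open>edge_load f k\<close> is the contribution of \<open>f\<close> to the junction equation at the
  midpoint opposite to \<open>q k\<close>; \<open>poisson_step i a f\<close> are the vertex values, on the
  \<open>i\<close>-th cell, of the solution of the Poisson equation with boundary values \<open>a\<close>.\<close>

definition edge_load :: "(real \<times> real \<Rightarrow> real) \<Rightarrow> nat \<Rightarrow> real" where
  "edge_load f k =
    (if k = 0 then - (mom (\<lambda>x. f (F 1 x)) 2 + mom (\<lambda>x. f (F 2 x)) 1) / 5
     else if k = 1 then - (mom (\<lambda>x. f (F 2 x)) 0 + mom (\<lambda>x. f (F 0 x)) 2) / 5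
     else - (mom (\<lambda>x. f (F 0 x)) 1 + mom (\<lambda>x. f (F 1 x)) 0) / 5)"

lemma edge_load_simps:
  "edge_load f 0 = - (mom (\<lambda>x. f (F 1 x)) 2 + mom (\<lambda>x. f (F 2 x)) 1) / 5"
  "edge_load f 1 = - (mom (\<lambda>x. f (F 2 x)) 0 + mom (\<lambda>x. f (F 0 x)) 2) / 5"
  "edge_load f (Suc 0) = - (mom (\<lambda>x. f (F 2 x)) 0 + mom (\<lambda>x. f (F 0 x)) 2) / 5"
  "edge_load f 2 = - (mom (\<lambda>x. f (F 0 x)) 1 + mom (\<lambda>x. f (F 1 x)) 0) / 5"
  by (simp_all add: edge_load_def)

definition poisson_step :: "nat \<Rightarrow> (nat \<Rightarrow> real) \<Rightarrow> (real \<times> real \<Rightarrow> real) \<Rightarrow> nat \<Rightarrow> real" where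
  "poisson_step i a f j = (if i = j then a i else (2 * (a 0 + a 1 + a 2) - a (3 - i - j)) / 5
     + (edge_load f 0 + edge_load f 1 + edge_load f 2 + 2 * edge_load f (3 - i - j)) / 10)"

lemma poisson_step_simps:
  "poisson_step i a f i = a i"
  "poisson_step 0 a f (Suc 0) = (2 * (a 0 + a 1 + a 2) - a 2) / 5 + (edge_load f 0 + edge_load f 1 + edge_load f 2 + 2 * edge_load f 2) / 10"
  "poisson_step 0 a f 2 = (2 * (a 0 + a 1 + a 2) - a 1) / 5 + (edge_load f 0 + edge_load f 1 + edge_load f 2 + 2 * edge_load f 1) / 10"
  "poisson_step (Suc 0) a f 0 = (2 * (a 0 + a 1 + a 2) - a 2) / 5 + (edge_load f 0 + edge_load f 1 + edge_load f 2 + 2 * edge_load f 2) / 10"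
  "poisson_step (Suc 0) a f 2 = (2 * (a 0 + a 1 + a 2) - a 0) / 5 + (edge_load f 0 + edge_load f 1 + edge_load f 2 + 2 * edge_load f 0) / 10"
  "poisson_step 2 a f 0 = (2 * (a 0 + a 1 + a 2) - a 1) / 5 + (edge_load f 0 + edge_load f 1 + edge_load f 2 + 2 * edge_load f 1) / 10"
  "poisson_step 2 a f (Suc 0) = (2 * (a 0 + a 1 + a 2) - a 0) / 5 + (edge_load f 0 + edge_load f 1 + edge_load f 2 + 2 * edge_load f 0) / 10"
  by (simp_all add: poisson_step_def)

text \<open>The source is divided by 5 because the energy of a restriction to a cell enters the
  total energy with the factor 5/3, while the measure of the cell is 1/3.\<close>

definition poisson_T :: "nat \<Rightarrow> (nat \<Rightarrow> real) \<times> (real \<times> real \<Rightarrow> real) \<Rightarrow> (nat \<Rightarrow> real) \<times> (real \<times> real \<Rightarrow> real)" where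
  "poisson_T i p = (poisson_step i (fst p) (snd p), \<lambda>x. snd p (F i x) / 5)"

text \<open>\<open>b\<close> bounds the oscillation of the boundary values and \<open>l\<close> the
  \<open>L^1\<close> norm of the source. One step turns them into \<open>3/5 * b + 9/10 * l\<close>
  and \<open>3/5 * l\<close>, and with the weight 3 on \<open>l\<close> the combination shrinks by
  9/10. Using the \<open>L^1\<close> norm rather than the maximum of the source makes the solution
  operator map \<open>L^2\<close> to bounded functions.\<close>

definition poisson_Q :: "(nat \<Rightarrow> real) \<times> (real \<times> real \<Rightarrow> real) \<Rightarrow> real \<Rightarrow> bool" where
  "poisson_Q p g \<longleftrightarrow> contSG (snd p) \<and>
     (\<exists>b l. osc_le (fst p) b \<and> intg (\<lambda>x. \<bar>snd p x\<bar>) \<le> l \<and> b + 3 * l \<le> g)"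

lemma edge_load_abs_le:
  assumes f: "contSG f" and l: "intg (\<lambda>x. \<bar>f x\<bar>) \<le> l" and k: "k < 3"
  shows "\<bar>edge_load f k\<bar> \<le> 6/5 * l"
proof -
  have m: "\<bar>mom (\<lambda>x. f (F i x)) j\<bar> \<le> 3 * l" if "i < 3" for i j
  proof -
    have "\<bar>mom (\<lambda>x. f (F i x)) j\<bar> \<le> intg (\<lambda>x. \<bar>f (F i x)\<bar>)" using mom_abs_le[OF contSG_F[OF f that]] .
    also have "\<dots> \<le> 3 * intg (\<lambda>x. \<bar>f x\<bar>)"
      using f that by (intro intg_cell_le[of "\<lambda>x. \<bar>f x\<bar>"]) (auto intro!: continuous_intros)
    finally show ?thesis using l by linarith
  qed
  have "\<bar>- (mom (\<lambda>x. f (F i x)) j + mom (\<lambda>x. f (F i' x)) j') / 5\<bar> \<le> 6/5 * l"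
    if "i < 3" "i' < 3" for i i' j j'
    using m[OF that(1), of j] m[OF that(2), of j'] by (simp add: abs_le_iff)
  thus ?thesis unfolding edge_load_def by simp
qed

interpretation poisson_scheme: self_similar_scheme poisson_T fst poisson_Q "9/10"
proof
  fix p g i assume "poisson_Q p g" and i: "i < (3::nat)"
  then obtain b l where *: "contSG (snd p)" "osc_le (fst p) b" "intg (\<lambda>x. \<bar>snd p x\<bar>) \<le> l" "b + 3 * l \<le> g"
    unfolding poisson_Q_def by blast
  have e: "edge_load (snd p) 0 \<le> 6/5 * l" "edge_load (snd p) 1 \<le> 6/5 * l" "edge_load (snd p) 2 \<le> 6/5 * l"
    "- edge_load (snd p) 0 \<le> 6/5 * l" "- edge_load (snd p) 1 \<le> 6/5 * l" "- edge_load (snd p) 2 \<le> 6/5 * l"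
  proof -
    have b: "edge_load (snd p) k \<le> 6/5 * l \<and> - edge_load (snd p) k \<le> 6/5 * l" if "k < 3" for k
      using edge_load_abs_le[OF *(1,3) that] unfolding abs_le_iff .
    show "edge_load (snd p) 0 \<le> 6/5 * l" "edge_load (snd p) 1 \<le> 6/5 * l" "edge_load (snd p) 2 \<le> 6/5 * l"
      "- edge_load (snd p) 0 \<le> 6/5 * l" "- edge_load (snd p) 1 \<le> 6/5 * l" "- edge_load (snd p) 2 \<le> 6/5 * l"
      using b[of 0] b[of 1] b[of 2] by simp_all
  qed
  have "0 \<le> intg (\<lambda>x. \<bar>snd p x\<bar>)" using *(1) by (intro intg_nonneg continuous_intros) auto
  hence l0: "0 \<le> l" using *(3) by linarith
  have "osc_le (poisson_step i (fst p) (snd p)) (3/5 * b + 9/10 * l)"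
    using i *(2) e l0 unfolding osc_le_def
    by (elim less3_cases; simp add: poisson_step_simps abs_le_iff field_simps)
  moreover have "intg (\<lambda>x. \<bar>snd p (F i x) / 5\<bar>) \<le> 3/5 * l"
  proof -
    have "intg (\<lambda>x. \<bar>snd p (F i x)\<bar>) \<le> 3 * intg (\<lambda>x. \<bar>snd p x\<bar>)"
      using *(1) i by (intro intg_cell_le[of "\<lambda>x. \<bar>snd p x\<bar>"]) (auto intro!: continuous_intros)
    thus ?thesis using *(3) intg_divide[of "\<lambda>x. \<bar>snd p (F i x)\<bar>" 5] by (simp add: abs_divide)
  qed
  moreover have "contSG (\<lambda>x. snd p (F i x) / 5)"
    using contSG_F[OF *(1) i] by (intro continuous_intros) auto
  moreover have "(3/5 * b + 9/10 * l) + 3 * (3/5 * l) \<le> 9/10 * g"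
  proof -
    have "0 \<le> b" using *(2) order.trans[OF abs_ge_zero] unfolding osc_le_def by blast
    thus ?thesis using *(4) l0 by (simp add: field_simps)
  qed
  ultimately show "poisson_Q (poisson_T i p) (9/10 * g)"
    unfolding poisson_Q_def poisson_T_def fst_conv snd_conv by blast
next
  fix p g i j assume "poisson_Q p g" and i: "i < (3::nat)" and j: "j < (3::nat)"
  then obtain b l where *: "contSG (snd p)" "osc_le (fst p) b" "intg (\<lambda>x. \<bar>snd p x\<bar>) \<le> l" "b + 3 * l \<le> g"
    unfolding poisson_Q_def by blast
  have e: "edge_load (snd p) 0 \<le> 6/5 * l" "edge_load (snd p) 1 \<le> 6/5 * l" "edge_load (snd p) 2 \<le> 6/5 * l"
    "- edge_load (snd p) 0 \<le> 6/5 * l" "- edge_load (snd p) 1 \<le> 6/5 * l" "- edge_load (snd p) 2 \<le> 6/5 * l"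
  proof -
    have b: "edge_load (snd p) k \<le> 6/5 * l \<and> - edge_load (snd p) k \<le> 6/5 * l" if "k < 3" for k
      using edge_load_abs_le[OF *(1,3) that] unfolding abs_le_iff .
    show "edge_load (snd p) 0 \<le> 6/5 * l" "edge_load (snd p) 1 \<le> 6/5 * l" "edge_load (snd p) 2 \<le> 6/5 * l"
      "- edge_load (snd p) 0 \<le> 6/5 * l" "- edge_load (snd p) 1 \<le> 6/5 * l" "- edge_load (snd p) 2 \<le> 6/5 * l"
      using b[of 0] b[of 1] b[of 2] by simp_all
  qed
  have "0 \<le> intg (\<lambda>x. \<bar>snd p x\<bar>)" using *(1) by (intro intg_nonneg continuous_intros) auto
  hence l0: "0 \<le> l" using *(3) by linarith
  show "\<bar>fst (poisson_T i p) j - (fst p i + fst p j) / 2\<bar> \<le> g"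
    using i j *(2,4) e l0 unfolding osc_le_def poisson_T_def fst_conv
    by (elim less3_cases; simp add: poisson_step_simps abs_le_iff field_simps)
next
  fix p g i j assume "i < (3::nat)" "j < (3::nat)"
  thus "fst (poisson_T i p) j = fst (poisson_T j p) i"
    by (elim less3_cases) (simp_all add: poisson_T_def poisson_step_simps)
qed (auto simp: poisson_T_def poisson_step_def)

definition poisson :: "(nat \<Rightarrow> real) \<Rightarrow> (real \<times> real \<Rightarrow> real) \<Rightarrow> real \<times> real \<Rightarrow> real" where
  "poisson a f = self_similar_function poisson_T fst (a, f)"

lemma poisson_Q_exists: "contSG f \<Longrightarrow> \<exists>g. poisson_Q (a, f) g"
  using osc_le_exists unfolding poisson_Q_def by (metis fst_conv order_refl snd_conv)

lemma poisson_cont: "contSG f \<Longrightarrow> contSG (poisson a f)"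
  using poisson_scheme.L_cont poisson_Q_exists unfolding poisson_def by metis

lemma poisson_q: "contSG f \<Longrightarrow> j < 3 \<Longrightarrow> poisson a f (q j) = a j"
  using poisson_scheme.L_q poisson_Q_exists unfolding poisson_def by (metis fst_conv)

lemma poisson_F:
  "contSG f \<Longrightarrow> i < 3 \<Longrightarrow> x \<in> SG \<Longrightarrow> poisson a f (F i x) = poisson (poisson_step i a f) (\<lambda>x. f (F i x) / 5) x"
proof -
  assume f: "contSG f" and i: "i < 3" "x \<in> SG"
  obtain g where "poisson_Q (a, f) g" using poisson_Q_exists[OF f] by blast
  from poisson_scheme.L_F[OF this i] show ?thesis unfolding poisson_def poisson_T_def by simp
qed

text \<open>The affine starting function is 0, and the initial bound
  \<open>3 * intg (\<lambda>x. \<bar>f x\<bar>)\<close> is divided by \<open>1 - 9/10\<close> in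
  summing the geometric series.\<close>

lemma poisson_zero_bound:
  assumes f: "contSG f" and x: "x \<in> SG"
  shows "\<bar>poisson (\<lambda>_. 0) f x\<bar> \<le> 30 * intg (\<lambda>x. \<bar>f x\<bar>)"
proof -
  have "poisson_Q (\<lambda>_. 0, f) (3 * intg (\<lambda>x. \<bar>f x\<bar>))"
    unfolding poisson_Q_def using f
    by (intro conjI exI[of _ "0::real"] exI[of _ "intg (\<lambda>x. \<bar>f x\<bar>)"]) (auto simp: osc_le_def)
  from poisson_scheme.L_aff[OF this x] show ?thesis unfolding poisson_def by (simp add: aff_def)
qed

section \<open>The Green formula at every level\<close>

definition bd :: "(real \<times> real \<Rightarrow> real) \<Rightarrow> nat \<Rightarrow> real" where
  "bd u j = u (q j)"

definition bmom :: "(real \<times> real \<Rightarrow> real) \<Rightarrow> (nat \<Rightarrow> real) \<Rightarrow> real" where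
  "bmom f b = b 0 * mom f 0 + b 1 * mom f 1 + b 2 * mom f 2"

text \<open>A quadrature rule: \<open>f\<close> is integrated against the function that agrees with
  \<open>v\<close> at the vertices of level \<open>m\<close> and is harmonic on each cell of that
  level.\<close>

fun level_mom :: "nat \<Rightarrow> (real \<times> real \<Rightarrow> real) \<Rightarrow> (real \<times> real \<Rightarrow> real) \<Rightarrow> real" where
  "level_mom 0 f v = bmom f (bd v)"
| "level_mom (Suc m) f v = (\<Sum>i<3. level_mom m (\<lambda>x. f (F i x)) (\<lambda>x. v (F i x))) / 3"

lemma level_mom_divide: "level_mom m (\<lambda>x. f x / c) v = level_mom m f v / c"
  by (induction m arbitrary: f v) (simp_all add: bmom_def mom_divide sum_less3 add_divide_distrib)

text \<open>The purely algebraic core. Here \<open>m0\<close>, \<open>m1\<close>, \<open>m2\<close>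
  are the midpoint values of the test function, \<open>y0\<close>, \<open>y1\<close>,
  \<open>y2\<close> those of the solution, and \<open>c00\<close> to \<open>c22\<close> the moments
  of the source on the cells. Both sides are linear in the values of the test function, so
  coefficients can be compared.\<close>

lemma poisson_step_identity_algebra:
  fixes a0 a1 a2 v0 v1 v2 m0 m1 m2 y0 y1 y2 E0 E1 E2 :: real
  assumes "E0 = - (c12 + c21) / 5" "E1 = - (c20 + c02) / 5" "E2 = - (c01 + c10) / 5"
    "y0 = (2 * (a0 + a1 + a2) - a0) / 5 + (E0 + E1 + E2 + 2 * E0) / 10"
    "y1 = (2 * (a0 + a1 + a2) - a1) / 5 + (E0 + E1 + E2 + 2 * E1) / 10"
    "y2 = (2 * (a0 + a1 + a2) - a2) / 5 + (E0 + E1 + E2 + 2 * E2) / 10"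
  shows "5/3 * (((a0 - y2) * (v0 - m2) + (y2 - y1) * (m2 - m1) + (a0 - y1) * (v0 - m1))
    + ((y2 - a1) * (m2 - v1) + (a1 - y0) * (v1 - m0) + (y2 - y0) * (m2 - m0))
    + ((y1 - y0) * (m1 - m0) + (y0 - a2) * (m0 - v2) + (y1 - a2) * (m1 - v2)))
    + ((v0 * c00 + m2 * c01 + m1 * c02) + (m2 * c10 + v1 * c11 + m0 * c12) + (m1 * c20 + m0 * c21 + v2 * c22)) / 3
    = ((a0 - a1) * (v0 - v1) + (a1 - a2) * (v1 - v2) + (a0 - a2) * (v0 - v2))
    + (v0 * ((c00 + 2/5 * c01 + 2/5 * c02 + 2/5 * c10 + 1/5 * c12 + 2/5 * c20 + 1/5 * c21) / 3)
     + v1 * ((c11 + 2/5 * c10 + 2/5 * c12 + 2/5 * c01 + 1/5 * c02 + 2/5 * c21 + 1/5 * c20) / 3)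
     + v2 * ((c22 + 2/5 * c20 + 2/5 * c21 + 2/5 * c02 + 1/5 * c01 + 2/5 * c12 + 1/5 * c10) / 3))"
proof -
  \<comment> \<open>The coefficients of the midpoint values, cancelled by the moments there: these
    are the junction equations that determine \<open>y0\<close>, \<open>y1\<close>,
    \<open>y2\<close>. The facts \<open>n\<close> below are the coefficients of the corner
    values.\<close>
  have k: "4 * y0 - a1 - a2 - y1 - y2 = - (c12 + c21) / 5" "4 * y1 - a0 - a2 - y0 - y2 = - (c20 + c02) / 5"
    "4 * y2 - a0 - a1 - y0 - y1 = - (c01 + c10) / 5"
    unfolding assms by (simp_all add: field_simps)
  have n: "5/3 * (2 * a0 - y1 - y2) = (2 * a0 - a1 - a2) + (2 * c01 + 2 * c02 + 2 * c10 + c12 + 2 * c20 + c21) / 15"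
    "5/3 * (2 * a1 - y0 - y2) = (2 * a1 - a0 - a2) + (2 * c10 + 2 * c12 + 2 * c01 + c02 + 2 * c21 + c20) / 15"
    "5/3 * (2 * a2 - y0 - y1) = (2 * a2 - a0 - a1) + (2 * c20 + 2 * c21 + 2 * c02 + c01 + 2 * c12 + c10) / 15"
    unfolding assms by (simp_all add: field_simps)
  have "5/3 * (((a0 - y2) * (v0 - m2) + (y2 - y1) * (m2 - m1) + (a0 - y1) * (v0 - m1))
    + ((y2 - a1) * (m2 - v1) + (a1 - y0) * (v1 - m0) + (y2 - y0) * (m2 - m0))
    + ((y1 - y0) * (m1 - m0) + (y0 - a2) * (m0 - v2) + (y1 - a2) * (m1 - v2)))
    = v0 * (5/3 * (2 * a0 - y1 - y2)) + v1 * (5/3 * (2 * a1 - y0 - y2)) + v2 * (5/3 * (2 * a2 - y0 - y1))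
    + 5/3 * (m0 * (4 * y0 - a1 - a2 - y1 - y2) + m1 * (4 * y1 - a0 - a2 - y0 - y2) + m2 * (4 * y2 - a0 - a1 - y0 - y1))"
    by (simp add: field_simps)
  thus ?thesis unfolding k n by (simp add: field_simps)
qed

lemma mom_split_explicit:
  assumes "contSG f"
  defines "c \<equiv> \<lambda>i j. mom (\<lambda>x. f (F i x)) j"
  shows "mom f 0 = (c 0 0 + 2/5 * c 0 1 + 2/5 * c 0 2 + 2/5 * c 1 0 + 1/5 * c 1 2 + 2/5 * c 2 0 + 1/5 * c 2 1) / 3"
    "mom f 1 = (c 1 1 + 2/5 * c 1 0 + 2/5 * c 1 2 + 2/5 * c 0 1 + 1/5 * c 0 2 + 2/5 * c 2 1 + 1/5 * c 2 0) / 3"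
    "mom f 2 = (c 2 2 + 2/5 * c 2 0 + 2/5 * c 2 1 + 2/5 * c 0 2 + 1/5 * c 0 1 + 2/5 * c 1 2 + 1/5 * c 1 0) / 3"
  unfolding c_def using mom_split[OF assms(1), of 0] mom_split[OF assms(1), of 1] mom_split[OF assms(1), of 2]
  by (simp_all add: sum_less3 harmonic_step_simps)

lemma poisson_step_identity:
  assumes f: "contSG f"
  shows "5/3 * (\<Sum>i<3. triangle_form (poisson_step i a f) (bd (\<lambda>x. v (F i x)))) + level_mom (Suc 0) f v
    = triangle_form a (bd v) + bmom f (bd v)"
proof -
  define c where "c i j = mom (\<lambda>x. f (F i x)) j" for i j
  define y0 y1 y2 where "y0 = poisson_step 1 a f 2" "y1 = poisson_step 0 a f 2" "y2 = poisson_step 0 a f 1"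
  note y = this
  define m0 m1 m2 where "m0 = v (F 1 (q 2))" "m1 = v (F 0 (q 2))" "m2 = v (F 0 (q 1))"
  note m = this
  have m': "v (F 2 (q 1)) = m0" "v (F 2 (q 0)) = m1" "v (F 1 (q 0)) = m2"
    unfolding m by (simp_all only: F_q_swap)
  have y': "poisson_step 2 a f 1 = y0" "poisson_step 2 a f 0 = y1" "poisson_step 1 a f 0 = y2"
    unfolding y by (simp_all add: poisson_step_simps)
  have D: "triangle_form (poisson_step 0 a f) (bd (\<lambda>x. v (F 0 x))) =
      (a 0 - y2) * (v (q 0) - m2) + (y2 - y1) * (m2 - m1) + (a 0 - y1) * (v (q 0) - m1)"
    "triangle_form (poisson_step 1 a f) (bd (\<lambda>x. v (F 1 x))) =
      (y2 - a 1) * (m2 - v (q 1)) + (a 1 - y0) * (v (q 1) - m0) + (y2 - y0) * (m2 - m0)"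
    "triangle_form (poisson_step 2 a f) (bd (\<lambda>x. v (F 2 x))) =
      (y1 - y0) * (m1 - m0) + (y0 - a 2) * (m0 - v (q 2)) + (y1 - a 2) * (m1 - v (q 2))"
    unfolding triangle_form_def bd_def m' y' m[symmetric] y[symmetric] poisson_step_simps(1) F_q_self by (rule refl)+
  have L: "level_mom (Suc 0) f v = ((v (q 0) * c 0 0 + m2 * c 0 1 + m1 * c 0 2) +
      (m2 * c 1 0 + v (q 1) * c 1 1 + m0 * c 1 2) + (m1 * c 2 0 + m0 * c 2 1 + v (q 2) * c 2 2)) / 3"
    unfolding level_mom.simps sum_less3 bmom_def bd_def m' m[symmetric] F_q_self c_def by (rule refl)
  have "y0 = (2 * (a 0 + a 1 + a 2) - a 0) / 5 + (edge_load f 0 + edge_load f 1 + edge_load f 2 + 2 * edge_load f 0) / 10"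
    "y1 = (2 * (a 0 + a 1 + a 2) - a 1) / 5 + (edge_load f 0 + edge_load f 1 + edge_load f 2 + 2 * edge_load f 1) / 10"
    "y2 = (2 * (a 0 + a 1 + a 2) - a 2) / 5 + (edge_load f 0 + edge_load f 1 + edge_load f 2 + 2 * edge_load f 2) / 10"
    unfolding y by (simp_all add: poisson_step_simps)
  note alg = poisson_step_identity_algebra[OF _ _ _ this]
  show ?thesis
    unfolding sum_less3 D L bmom_def mom_split_explicit[OF f, folded c_def] triangle_form_def[of a] bd_def
    by (rule alg) (simp_all only: edge_load_simps(1,2,4) c_def)
qed

text \<open>An exact identity at every level, by induction from
  \<open>poisson_step_identity\<close>. Only the quadrature depends on \<open>m\<close>, so
  convergence of the energies and their limit can be read off from
  \<open>level_mom_limit\<close>.\<close>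

lemma graph_energy_poisson:
  assumes "contSG f"
  shows "graph_energy m (poisson a f) v = triangle_form a (bd v) + bmom f (bd v) - level_mom m f v"
  using assms
proof (induction m arbitrary: a f v)
  case 0
  have "triangle_form (\<lambda>j. poisson a f (q j)) (\<lambda>j. v (q j)) = triangle_form a (bd v)"
    using poisson_q[OF 0, of 1] by (simp add: triangle_form_def poisson_q[OF 0] bd_def)
  thus ?case by simp
next
  case (Suc m)
  have "graph_energy m (\<lambda>x. poisson a f (F i x)) (\<lambda>x. v (F i x)) =
      triangle_form (poisson_step i a f) (bd (\<lambda>x. v (F i x))) + bmom (\<lambda>x. f (F i x)) (bd (\<lambda>x. v (F i x))) / 5
      - level_mom m (\<lambda>x. f (F i x)) (\<lambda>x. v (F i x)) / 5" if i: "i < 3" for i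
  proof -
    have c: "contSG (\<lambda>x. f (F i x) / 5)" using contSG_F[OF Suc.prems i] by (intro continuous_intros) auto
    have "graph_energy m (\<lambda>x. poisson a f (F i x)) (\<lambda>x. v (F i x)) =
      graph_energy m (poisson (poisson_step i a f) (\<lambda>x. f (F i x) / 5)) (\<lambda>x. v (F i x))"
      by (rule graph_energy_cong) (simp_all add: poisson_F[OF Suc.prems i])
    also have "\<dots> = triangle_form (poisson_step i a f) (bd (\<lambda>x. v (F i x))) + bmom (\<lambda>x. f (F i x) / 5) (bd (\<lambda>x. v (F i x)))
      - level_mom m (\<lambda>x. f (F i x) / 5) (\<lambda>x. v (F i x))" by (rule Suc.IH[OF c])
    also have "bmom (\<lambda>x. f (F i x) / 5) b = bmom (\<lambda>x. f (F i x)) b / 5" for b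
      by (simp add: bmom_def mom_divide add_divide_distrib)
    finally show ?thesis unfolding level_mom_divide .
  qed
  note k = this
  have i3: "0 < (3::nat)" "1 < (3::nat)" "2 < (3::nat)" by auto
  have "graph_energy (Suc m) (poisson a f) v = 5/3 * (\<Sum>i<3. triangle_form (poisson_step i a f) (bd (\<lambda>x. v (F i x))))
    + (\<Sum>i<3. bmom (\<lambda>x. f (F i x)) (bd (\<lambda>x. v (F i x)))) / 3 - level_mom (Suc m) f v"
    unfolding graph_energy.simps level_mom.simps sum_less3 k[OF i3(1)] k[OF i3(2)] k[OF i3(3)] by argo
  also have "(\<Sum>i<3. bmom (\<lambda>x. f (F i x)) (bd (\<lambda>x. v (F i x)))) / 3 = level_mom (Suc 0) f v" by simp
  finally show ?case using poisson_step_identity[OF Suc.prems, of a v] by linarith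
qed

text \<open>On each cell \<open>v\<close> is compared with a convex combination of its vertex
  values, the functions \<open>hb j\<close> being nonnegative with sum 1.\<close>

lemma level_mom_near:
  assumes "contSG f" "contSG v" "\<And>x. x \<in> SG \<Longrightarrow> \<bar>f x\<bar> \<le> C"
    "\<And>w x y. w \<in> words m \<Longrightarrow> x \<in> SG \<Longrightarrow> y \<in> SG \<Longrightarrow> \<bar>v (Fw w x) - v (Fw w y)\<bar> \<le> e"
  shows "\<bar>intg (\<lambda>x. f x * v x) - level_mom m f v\<bar> \<le> C * e"
  using assms
proof (induction m arbitrary: f v)
  case 0
  have C0: "C \<ge> 0" using order.trans[OF abs_ge_zero 0(3)[OF q_in_SG[of 0]]] by simp
  let ?g = "\<lambda>x. f x * (v x - (v (q 0) * hb 0 x + v (q 1) * hb 1 x + v (q 2) * hb 2 x))"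
  have "level_mom 0 f v = v (q 0) * intg (\<lambda>x. f x * hb 0 x) + v (q 1) * intg (\<lambda>x. f x * hb 1 x) + v (q 2) * intg (\<lambda>x. f x * hb 2 x)"
    by (simp add: bmom_def bd_def mom_def)
  also have "\<dots> = intg (\<lambda>x. v (q 0) * (f x * hb 0 x) + v (q 1) * (f x * hb 1 x) + v (q 2) * (f x * hb 2 x))"
    using 0(1) by (subst intg_add, (intro continuous_intros; assumption), (intro continuous_intros; assumption))+
        (simp add: intg_cmult)
  finally have "intg (\<lambda>x. f x * v x) - level_mom 0 f v = intg (\<lambda>x. f x * v x - (v (q 0) * (f x * hb 0 x) + v (q 1) * (f x * hb 1 x) + v (q 2) * (f x * hb 2 x)))"
    using 0(1,2) by (subst intg_diff) (auto intro!: continuous_intros)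
  also have "\<dots> = intg ?g" by (rule intg_cong) (simp add: algebra_simps)
  also have "\<bar>\<dots>\<bar> \<le> intg (\<lambda>x. \<bar>?g x\<bar>)" using 0(1,2) by (intro intg_abs continuous_intros)
  also have "\<dots> \<le> intg (\<lambda>_. C * e)"
  proof (rule intg_mono)
    show "contSG (\<lambda>x. \<bar>?g x\<bar>)" using 0(1,2) by (intro continuous_intros)
    fix x assume x: "x \<in> SG"
    have b: "0 \<le> hb 0 x" "0 \<le> hb 1 x" "0 \<le> hb 2 x" "hb 0 x + hb 1 x + hb 2 x = 1"
      using hb_bounds[OF x] hb_sum[OF x] by auto
    have d: "\<bar>v x - v (q j)\<bar> \<le> e" if "j < 3" for j
      using 0(4)[of "[]" x "q j"] x that by simp
    have "v x - (v (q 0) * hb 0 x + v (q 1) * hb 1 x + v (q 2) * hb 2 x)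
      = v x * (hb 0 x + hb 1 x + hb 2 x) - (v (q 0) * hb 0 x + v (q 1) * hb 1 x + v (q 2) * hb 2 x)" using b by simp
    also have "\<dots> = (v x - v (q 0)) * hb 0 x + (v x - v (q 1)) * hb 1 x + (v x - v (q 2)) * hb 2 x"
      by (simp add: algebra_simps)
    also have "\<bar>\<dots>\<bar> \<le> \<bar>v x - v (q 0)\<bar> * hb 0 x + \<bar>v x - v (q 1)\<bar> * hb 1 x + \<bar>v x - v (q 2)\<bar> * hb 2 x"
      using b by (intro order.trans[OF abs_triangle_ineq] add_mono) (auto simp: abs_mult)
    also have "\<dots> \<le> e * hb 0 x + e * hb 1 x + e * hb 2 x"
      using b d[of 0] d[of 1] d[of 2] by (intro add_mono mult_right_mono) (auto)
    also have "\<dots> = e" using b(4) by (simp only: distrib_left[symmetric])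
    finally show "\<bar>?g x\<bar> \<le> C * e" unfolding abs_mult using 0(3)[OF x] C0 by (intro mult_mono) auto
  qed auto
  also have "\<dots> = C * e" by (rule intg_const)
  finally show ?case .
next
  case (Suc m)
  have "\<bar>intg (\<lambda>x. f (F i x) * v (F i x)) - level_mom m (\<lambda>x. f (F i x)) (\<lambda>x. v (F i x))\<bar> \<le> C * e"
    if i: "i < 3" for i
  proof (rule Suc.IH[of "\<lambda>x. f (F i x)" "\<lambda>x. v (F i x)"])
    show "contSG (\<lambda>x. f (F i x))" "contSG (\<lambda>x. v (F i x))" using Suc.prems i by (auto intro: contSG_F)
    show "\<bar>f (F i x)\<bar> \<le> C" if "x \<in> SG" for x using Suc.prems(3) F_SG[OF i that] by blast
    show "\<bar>v (F i (Fw w x)) - v (F i (Fw w y))\<bar> \<le> e" if "w \<in> words m" "x \<in> SG" "y \<in> SG" for w x y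
      using Suc.prems(4)[of "i # w" x y] that i by (auto simp: words_Suc)
  qed
  from this[of 0] this[of 1] this[of 2] show ?case
    using intg_split3[of "\<lambda>x. f x * v x"] Suc.prems(1,2)
    by (simp add: sum_less3 continuous_on_mult abs_le_iff field_simps)
qed

lemma level_mom_limit:
  assumes f: "contSG f" and v: "contSG v"
  shows "(\<lambda>m. level_mom m f v) \<longlonglongrightarrow> intg (\<lambda>x. f x * v x)"
proof (rule LIMSEQ_I)
  fix r :: real assume "r > 0"
  obtain C where C: "C > 0" "\<And>x. x \<in> SG \<Longrightarrow> \<bar>f x\<bar> \<le> C" using contSG_bounded[OF f] by blast
  have "r / (2 * C) > 0" using C \<open>r > 0\<close> by simp
  then obtain M where M: "\<forall>m\<ge>M. \<forall>w\<in>words m. \<forall>x\<in>SG. \<forall>y\<in>SG. \<bar>v (Fw w x) - v (Fw w y)\<bar> \<le> r / (2 * C)"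
    using contSG_small_oscillation[OF v] by blast
  show "\<exists>M. \<forall>m\<ge>M. norm (level_mom m f v - intg (\<lambda>x. f x * v x)) < r"
  proof (intro exI[of _ M] allI impI)
    fix m assume m: "m \<ge> M"
    have "\<bar>intg (\<lambda>x. f x * v x) - level_mom m f v\<bar> \<le> C * (r / (2 * C))"
      using M m by (intro level_mom_near f v C(2)) blast+
    also have "\<dots> < r" using C \<open>r > 0\<close> by simp
    finally show "norm (level_mom m f v - intg (\<lambda>x. f x * v x)) < r" by (simp add: abs_minus_commute)
  qed
qed

text \<open>The weak Poisson equation \<open>\<Delta> u = f\<close>, tested against all continuous functions:
  the terms in the boundary values of \<open>v\<close> come from its harmonic extension.\<close>

definition sol :: "(real \<times> real \<Rightarrow> real) \<Rightarrow> (real \<times> real \<Rightarrow> real) \<Rightarrow> bool" where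
  "sol u f \<longleftrightarrow> contSG u \<and> contSG f \<and> (\<forall>v. contSG v \<longrightarrow>
     (\<lambda>m. graph_energy m u v) \<longlonglongrightarrow> triangle_form (bd u) (bd v) + bmom f (bd v) - intg (\<lambda>x. f x * v x))"

lemma sol_poisson: "contSG f \<Longrightarrow> sol (poisson a f) f"
  unfolding sol_def
proof (intro conjI allI impI)
  fix v assume f: "contSG f" and v: "contSG v"
  have "triangle_form (bd (poisson a f)) (bd v) = triangle_form a (bd v)"
    using poisson_q[OF f, of 1] by (simp add: triangle_form_def poisson_q[OF f] bd_def)
  thus "(\<lambda>m. graph_energy m (poisson a f) v) \<longlonglongrightarrow>
      triangle_form (bd (poisson a f)) (bd v) + bmom f (bd v) - intg (\<lambda>x. f x * v x)"
    unfolding graph_energy_poisson[OF f] by (auto intro!: tendsto_intros level_mom_limit f v)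
qed (auto intro: poisson_cont)

lemma triangle_form_add_left: "triangle_form (\<lambda>j. a j + c * b j) d = triangle_form a d + c * triangle_form b d"
  by (simp add: triangle_form_def algebra_simps)

lemma sol_linear:
  assumes "sol u f" "sol u' f'"
  shows "sol (\<lambda>x. u x + c * u' x) (\<lambda>x. f x + c * f' x)"
  unfolding sol_def
proof (intro conjI allI impI)
  have c: "contSG u" "contSG u'" "contSG f" "contSG f'" using assms unfolding sol_def by auto
  thus "contSG (\<lambda>x. u x + c * u' x)" "contSG (\<lambda>x. f x + c * f' x)" by (auto intro!: continuous_intros)
  fix v assume v: "contSG v"
  have "intg (\<lambda>x. (f x + c * f' x) * v x) = intg (\<lambda>x. f x * v x + c * (f' x * v x))"
    by (rule intg_cong) (simp add: algebra_simps)
  also have "\<dots> = intg (\<lambda>x. f x * v x) + c * intg (\<lambda>x. f' x * v x)"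
    using c v by (subst intg_add) (auto intro!: continuous_intros simp: intg_cmult)
  finally have i: "intg (\<lambda>x. (f x + c * f' x) * v x) = intg (\<lambda>x. f x * v x) + c * intg (\<lambda>x. f' x * v x)" .
  have b: "bmom (\<lambda>x. f x + c * f' x) (bd v) = bmom f (bd v) + c * bmom f' (bd v)"
    unfolding bmom_def mom_add[OF c(3,4)] by (simp add: algebra_simps)
  have d: "triangle_form (bd (\<lambda>x. u x + c * u' x)) (bd v) = triangle_form (bd u) (bd v) + c * triangle_form (bd u') (bd v)"
    unfolding bd_def by (rule triangle_form_add_left)
  have "(\<lambda>m. graph_energy m u v + c * graph_energy m u' v) \<longlonglongrightarrow> (triangle_form (bd u) (bd v) + bmom f (bd v) - intg (\<lambda>x. f x * v x))
      + c * (triangle_form (bd u') (bd v) + bmom f' (bd v) - intg (\<lambda>x. f' x * v x))"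
    using assms v unfolding sol_def by (intro tendsto_intros) auto
  thus "(\<lambda>m. graph_energy m (\<lambda>x. u x + c * u' x) v) \<longlonglongrightarrow> triangle_form (bd (\<lambda>x. u x + c * u' x)) (bd v)
      + bmom (\<lambda>x. f x + c * f' x) (bd v) - intg (\<lambda>x. (f x + c * f' x) * v x)"
    unfolding graph_energy_add_left i b d by (simp add: algebra_simps)
qed

lemma sol_cong:
  assumes "sol u f" and u: "\<And>x. x \<in> SG \<Longrightarrow> u x = u' x" and f: "\<And>x. x \<in> SG \<Longrightarrow> f x = f' x"
  shows "sol u' f'"
proof -
  have "contSG u'" "contSG f'" using assms continuous_on_cong unfolding sol_def by (metis (no_types))+
  moreover have "graph_energy m u v = graph_energy m u' v" for m v using u by (intro graph_energy_cong) auto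
  moreover have "bmom f b = bmom f' b" for b unfolding bmom_def using mom_cong[of f f'] f by simp
  moreover have "intg (\<lambda>x. f x * v x) = intg (\<lambda>x. f' x * v x)" for v using f by (intro intg_cong) simp
  moreover have "triangle_form (bd u) b = triangle_form (bd u') b" for b
    using u[OF q_in_SG[of 0]] u[OF q_in_SG[of 1]] u[OF q_in_SG[of 2]] by (simp add: triangle_form_def bd_def)
  ultimately show ?thesis using assms(1) unfolding sol_def by simp
qed

lemma sol_cont: "sol u f \<Longrightarrow> contSG u" "sol u f \<Longrightarrow> contSG f" unfolding sol_def by auto

lemma sol_limit_zero_boundary:
  assumes "sol u f" "contSG v" "\<And>j. j < 3 \<Longrightarrow> v (q j) = 0"
  shows "(\<lambda>m. graph_energy m u v) \<longlonglongrightarrow> - intg (\<lambda>x. f x * v x)"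
proof -
  have "v (q 0) = 0" "v (q 1) = 0" "v (q 2) = 0" using assms(3) by auto
  hence "triangle_form (bd u) (bd v) = 0" "bmom f (bd v) = 0" by (simp_all add: triangle_form_def bmom_def bd_def)
  thus ?thesis using assms(1,2) unfolding sol_def by fastforce
qed

section \<open>Uniqueness of weak solutions\<close>

lemma graph_energy_limit_0_imp:
  assumes "contSG u" "(\<lambda>m. graph_energy m u u) \<longlonglongrightarrow> 0" "u (q 0) = 0" "x \<in> SG"
  shows "u x = 0"
proof (rule graph_energy_eq_0_imp[OF assms(1) _ assms(3,4)])
  fix m
  have "incseq (\<lambda>m. graph_energy m u u)" by (rule incseq_SucI) (rule graph_energy_mono_Suc)
  hence "graph_energy m u u \<le> 0" using assms(2) incseq_le by blast
  thus "graph_energy m u u = 0" using graph_energy_nonneg[of m u] by linarith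
qed

text \<open>The energy of \<open>u\<close> is minus the integral and hence at most 0. Assuming an
  inequality instead of a vanishing source lets the lemma serve \<open>legendre_neq_sobolev\<close>
  besides uniqueness.\<close>

lemma sol_zero_boundary_le:
  assumes s: "sol u f" and 0: "\<And>j. j < 3 \<Longrightarrow> u (q j) = 0" and "0 \<le> intg (\<lambda>x. f x * u x)" "x \<in> SG"
  shows "u x = 0"
proof (rule graph_energy_limit_0_imp)
  have lim: "(\<lambda>m. graph_energy m u u) \<longlonglongrightarrow> - intg (\<lambda>x. f x * u x)"
    using sol_limit_zero_boundary[OF s sol_cont(1)[OF s] 0] .
  hence "0 \<le> - intg (\<lambda>x. f x * u x)" by (rule LIMSEQ_le_const) (auto simp: graph_energy_nonneg)
  hence "- intg (\<lambda>x. f x * u x) = 0" using assms(3) by linarith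
  thus "(\<lambda>m. graph_energy m u u) \<longlonglongrightarrow> 0" using lim by simp
qed (use sol_cont[OF s] 0 assms in auto)

lemma sol_unique:
  assumes "sol u f" "sol u' f'" "\<And>x. x \<in> SG \<Longrightarrow> f x = f' x" "\<And>j. j < 3 \<Longrightarrow> u (q j) = u' (q j)" "x \<in> SG"
  shows "u x = u' x"
proof -
  have "sol (\<lambda>x. u x + (-1) * u' x) (\<lambda>x. f x + (-1) * f' x)" by (rule sol_linear[OF assms(1,2)])
  hence "sol (\<lambda>x. u x - u' x) (\<lambda>x. 0)" by (rule sol_cong) (use assms(3) in auto)
  hence "u x - u' x = 0" by (rule sol_zero_boundary_le) (use assms in auto)
  thus ?thesis by simp
qed

text \<open>Testing with \<open>f\<close> times a function vanishing only on the boundary.\<close>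

lemma sol_zero_imp:
  assumes s: "sol u f" and u: "\<And>x. x \<in> SG \<Longrightarrow> u x = 0" and x: "x \<in> SG"
  shows "f x = 0"
proof -
  define d where "d x = dist x (q 0) * dist x (q 1) * dist x (q 2)" for x
  have f: "contSG f" using sol_cont[OF s] by blast
  have d: "contSG d" unfolding d_def by (intro continuous_intros)
  have "(\<lambda>m. graph_energy m u (\<lambda>x. f x * d x)) \<longlonglongrightarrow> - intg (\<lambda>x. f x * (f x * d x))"
    by (rule sol_limit_zero_boundary[OF s])
      (use f d in \<open>auto intro!: continuous_intros simp: d_def elim!: less3_cases\<close>)
  moreover have "graph_energy m u v = 0" for m v
    using graph_energy_cong[of u "\<lambda>x. 0" v v m] u graph_energy_add_left[of m "\<lambda>x. 0" "-1" "\<lambda>x. 0" v] by simp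
  ultimately have "intg (\<lambda>x. f x * (f x * d x)) = 0" by (simp add: LIMSEQ_const_iff)
  moreover have "contSG (\<lambda>x. f x * (f x * d x))" using f d by (intro continuous_intros)
  moreover have "f x * (f x * d x) \<ge> 0" for x by (simp add: d_def mult.assoc[symmetric])
  ultimately have 0: "f x * (f x * d x) = 0" if "x \<in> SG" for x
    using intg_eq_0_imp[of "\<lambda>x. f x * (f x * d x)" x] that by blast
  have *: "f x = 0" if "x \<in> SG" "x \<notin> {q 0, q 1, q 2}" for x
    using that(2) 0[OF that(1)] by (simp add: d_def)
  \<comment> \<open>The weight \<open>d\<close> says nothing about \<open>f\<close> at the corners.
    But every cell contains the image of the midpoint \<open>F 0 (q 1)\<close>, which is not a
    corner, so that continuity settles the remaining points.\<close>
  have "f (Fw w (F 0 (q 1))) = 0" if "w \<in> words m" for m w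
  proof (rule *)
    have m: "F 0 (q 1) \<in> SG" by (rule F_SG) auto
    thus "Fw w (F 0 (q 1)) \<in> SG" using Fw_SG[OF that] by blast
    show "Fw w (F 0 (q 1)) \<notin> {q 0, q 1, q 2}"
    proof
      assume "Fw w (F 0 (q 1)) \<in> {q 0, q 1, q 2}"
      then obtain j where j: "j < 3" "Fw w (F 0 (q 1)) = q j"
        using all_less3[of "\<lambda>j. Fw w (F 0 (q 1)) \<noteq> q j"] by blast
      show False using that j
      proof (induction m arbitrary: w)
        case 0
        thus ?case by (auto simp: F_eq q_simps elim!: less3_cases)
      next
        case (Suc m)
        then obtain i v where v: "i < 3" "v \<in> words m" "w = i # v" by (auto simp: words_Suc)
        have e: "F i (Fw v (F 0 (q 1))) = F j (q j)" using Suc.prems v by simp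
        have "i = j"
          using cells_meet(2)[OF v(1) Suc.prems(2) _ Fw_SG[OF v(2) m] q_in_SG[OF Suc.prems(2)] e]
            inj_q[OF Suc.prems(2) v(1)] by blast
        hence "Fw v (F 0 (q 1)) = q j" using e by (simp only: F_eq_iff)
        thus ?case using Suc.IH[OF v(2) Suc.prems(2)] by blast
      qed
    qed
  qed
  hence v0: "f (Fw w (F 0 (q 1))) = 0" if "w \<in> words m" for m w using that by blast
  show ?thesis
  proof (rule ccontr)
    assume "f x \<noteq> 0"
    hence "\<bar>f x\<bar> / 2 > 0" by simp
    then obtain M where M: "\<forall>m\<ge>M. \<forall>w\<in>words m. \<forall>y\<in>SG. \<forall>z\<in>SG. \<bar>f (Fw w y) - f (Fw w z)\<bar> \<le> \<bar>f x\<bar> / 2"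
      using contSG_small_oscillation[OF f] by blast
    obtain w y where w: "w \<in> words M" "y \<in> SG" "x = Fw w y" using SG_word[OF x] .
    have "F 0 (q 1) \<in> SG" by (rule F_SG) auto
    hence "\<bar>f x - f (Fw w (F 0 (q 1)))\<bar> \<le> \<bar>f x\<bar> / 2" using M w by blast
    thus False using v0[OF w(1)] \<open>f x \<noteq> 0\<close> by simp
  qed
qed

section \<open>Agreement with the Laplacian tested by functions of finite energy\<close>

lemma V0_iff: "(\<forall>x\<in>V0. v x = 0) \<longleftrightarrow> (\<forall>j<3. v (q j) = 0)"
  unfolding V0_def all_less3 by simp

lemma sol_dom_energy: "sol u f \<Longrightarrow> u \<in> dom_energy"
  unfolding dom_energy_def sol_def energy_level_eq_EL convergent_def by blast

lemma sol_has_laplacian: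
  assumes "sol u f"
  shows "has_laplacian u f"
  unfolding has_laplacian_def
proof (intro conjI ballI impI)
  fix v assume v: "v \<in> dom_energy" "\<forall>x\<in>V0. v x = 0"
  hence "contSG v" unfolding dom_energy_def by blast
  thus "energy u v = - (LINT x:SG|mu. f x * v x)"
    unfolding energy_def energy_level_eq_EL using sol_limit_zero_boundary[OF assms] v(2)
    by (intro limI) (simp add: V0_iff intg_def)
qed (use assms sol_dom_energy sol_cont in auto)

text \<open>The difference of \<open>u\<close> and the constructed solution vanishes on the boundary
  and has finite energy. So it is itself an admissible test function, and testing with it shows that
  its energy is 0.\<close>

lemma has_laplacian_sol:
  assumes h: "has_laplacian u f"
  shows "sol u f"
proof -
  have u: "contSG u" "convergent (\<lambda>m. graph_energy m u u)" and f: "contSG f"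
    using h unfolding has_laplacian_def dom_energy_def energy_level_eq_EL by auto
  define p where "p = poisson (bd u) f"
  have p: "sol p f" unfolding p_def by (rule sol_poisson[OF f])
  define w where "w x = u x - p x" for x
  have w: "contSG w" unfolding w_def using u sol_cont[OF p] by (intro continuous_intros)
  have w0: "w (q j) = 0" if "j < 3" for j
    unfolding w_def p_def using poisson_q[OF f that] by (simp add: bd_def)
  have graph_energy_w: "graph_energy m w v = graph_energy m u v - graph_energy m p v" for m v
    using graph_energy_add_left[of m u "-1" p v] unfolding w_def by simp
  have "convergent (\<lambda>m. graph_energy m p v)" if "contSG v" for v
    using p that unfolding sol_def convergent_def by blast
  hence conv_p: "convergent (\<lambda>m. graph_energy m p p)" "convergent (\<lambda>m. graph_energy m p u)" "convergent (\<lambda>m. graph_energy m p w)"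
    using u w sol_cont[OF p] by auto
  \<comment> \<open>\<open>energy\<close> is a \<open>lim\<close>, and its value says something
    about the sequence only once convergence is known.\<close>
  have conv_uw: "convergent (\<lambda>m. graph_energy m u w)"
  proof -
    have "graph_energy m u w = graph_energy m u u - graph_energy m p u" for m
      using graph_energy_w[of m u] graph_energy_sym[of m u w] by simp
    thus ?thesis using convergent_diff[OF u(2) conv_p(2)] by simp
  qed
  have "convergent (\<lambda>m. graph_energy m w w)" unfolding graph_energy_w[of _ w] using convergent_diff[OF conv_uw conv_p(3)] by simp
  hence "w \<in> dom_energy" unfolding dom_energy_def energy_level_eq_EL using w by simp
  moreover have "\<forall>x\<in>V0. w x = 0" unfolding V0_iff using w0 by blast
  ultimately have "energy u w = - intg (\<lambda>x. f x * w x)"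
    using h unfolding has_laplacian_def intg_def by blast
  hence "(\<lambda>m. graph_energy m u w) \<longlonglongrightarrow> - intg (\<lambda>x. f x * w x)"
    using conv_uw unfolding energy_def energy_level_eq_EL convergent_LIMSEQ_iff by simp
  moreover have "(\<lambda>m. graph_energy m p w) \<longlonglongrightarrow> - intg (\<lambda>x. f x * w x)"
    using sol_limit_zero_boundary[OF p w] w0 by blast
  ultimately have "(\<lambda>m. graph_energy m w w) \<longlonglongrightarrow> - intg (\<lambda>x. f x * w x) - (- intg (\<lambda>x. f x * w x))"
    unfolding graph_energy_w[of _ w] by (rule tendsto_diff)
  hence "w x = 0" if "x \<in> SG" for x using graph_energy_limit_0_imp[OF w _ _ that] w0[of 0] by simp
  thus ?thesis by (intro sol_cong[OF p]) (auto simp: w_def)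
qed

lemma has_laplacian_iff_sol: "has_laplacian u f \<longleftrightarrow> sol u f"
  using sol_has_laplacian has_laplacian_sol by blast

lemma laplacian_eq:
  assumes "sol u f"
  shows "laplacian u = (\<lambda>x. if x \<in> SG then f x else 0)"
  unfolding laplacian_def has_laplacian_iff_sol
proof (rule the_equality)
  show "sol u (\<lambda>x. if x \<in> SG then f x else 0) \<and> (\<forall>x. x \<notin> SG \<longrightarrow> (if x \<in> SG then f x else 0) = 0)"
    using sol_cong[OF assms, of u "\<lambda>x. if x \<in> SG then f x else 0"] by simp
  fix g assume g: "sol u g \<and> (\<forall>x. x \<notin> SG \<longrightarrow> g x = 0)"
  have "sol (\<lambda>x. u x + (-1) * u x) (\<lambda>x. f x + (-1) * g x)" using sol_linear assms g by blast
  hence "f x + (-1) * g x = 0" if "x \<in> SG" for x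
    using sol_zero_imp[of "\<lambda>x. u x + (-1) * u x" "\<lambda>x. f x + (-1) * g x" x] that by simp
  thus "g = (\<lambda>x. if x \<in> SG then f x else 0)" using g by fastforce
qed

section \<open>Monomials\<close>

text \<open>The outward normal derivative at \<open>q i\<close> of the solution with boundary values \<open>a\<close>.\<close>

definition nflux :: "nat \<Rightarrow> (nat \<Rightarrow> real) \<Rightarrow> (real \<times> real \<Rightarrow> real) \<Rightarrow> real" where
  "nflux i a f = 3 * a i - (a 0 + a 1 + a 2) + mom f i"

lemma nflux_cong:
  assumes "\<And>j. j < 3 \<Longrightarrow> a j = b j" "\<And>x. x \<in> SG \<Longrightarrow> f x = g x" "i < 3"
  shows "nflux i a f = nflux i b g"
  using assms(1)[of 0] assms(1)[of 1] assms(1)[of 2] assms(1)[OF assms(3)] mom_cong[of f g i] assms(2)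
  by (simp add: nflux_def)

lemma nflux_linear:
  "contSG f \<Longrightarrow> contSG g \<Longrightarrow>
    nflux i (\<lambda>j. a j + c * b j) (\<lambda>x. f x + c * g x) = nflux i a f + c * nflux i b g"
  by (simp add: nflux_def mom_add algebra_simps)

text \<open>The renormalization of the normal derivative: on the cell at \<open>q i\<close> the flux
  shrinks by exactly the factor that \<open>has_normal_derivative\<close> compensates with
  \<open>5/3\<close>.\<close>

lemma nflux_self:
  assumes "contSG f" "i < 3"
  shows "nflux i (poisson_step i a f) (\<lambda>x. f (F i x) / 5) = 3/5 * nflux i a f"
  using assms(2) unfolding nflux_def mom_divide
  by (elim less3_cases; simp add: poisson_step_simps mom_split_explicit[OF assms(1)]
    mom_split_explicit(2)[OF assms(1), unfolded One_nat_def] edge_load_def; argo)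

text \<open>\<open>F i (q j)\<close> and \<open>F j (q i)\<close> are the same midpoint, and
  \<open>edge_load\<close> is made such that the fluxes from the two cells cancel there.\<close>

lemma nflux_junction:
  assumes "contSG f" "i < 3" "j < 3" "i \<noteq> j"
  shows "nflux j (poisson_step i a f) (\<lambda>x. f (F i x) / 5) + nflux i (poisson_step j a f) (\<lambda>x. f (F j x) / 5) = 0"
  using assms(2-4) unfolding nflux_def mom_divide
  by (elim less3_cases; simp add: poisson_step_simps edge_load_def; argo)

lemma sol_eq_poisson: "sol u f \<Longrightarrow> x \<in> SG \<Longrightarrow> u x = poisson (bd u) f x"
  by (rule sol_unique[OF _ sol_poisson]) (auto simp: sol_cont poisson_q bd_def)

lemma sol_F:
  assumes s: "sol u f" and i: "i < 3"
  shows "sol (\<lambda>x. u (F i x)) (\<lambda>x. f (F i x) / 5)"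
proof -
  have f: "contSG f" using sol_cont[OF s] by blast
  have c: "contSG (\<lambda>x. f (F i x) / 5)" using contSG_F[OF f i] by (intro continuous_intros) auto
  show ?thesis
    by (rule sol_cong[OF sol_poisson[OF c]])
      (use sol_eq_poisson[OF s F_SG[OF i]] poisson_F[OF f i] in auto)
qed

lemma bd_F:
  assumes s: "sol u f" and i: "i < 3" and j: "j < 3"
  shows "bd (\<lambda>x. u (F i x)) j = poisson_step i (bd u) f j"
proof -
  have f: "contSG f" using sol_cont[OF s] by blast
  have c: "contSG (\<lambda>x. f (F i x) / 5)" using contSG_F[OF f i] by (intro continuous_intros) auto
  show ?thesis
    unfolding bd_def using sol_eq_poisson[OF s F_SG[OF i q_in_SG[OF j]]] poisson_F[OF f i q_in_SG[OF j]]
      poisson_q[OF c j] by (simp add: bd_def[symmetric] bd_def[of u, abs_def, symmetric])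
qed

lemma F_pow_q0: "(F 0 ^^ m) (q 0) = q 0"
  by (induction m) auto

lemma F_pow_SG: "x \<in> SG \<Longrightarrow> (F 0 ^^ m) x \<in> SG"
  by (induction m) (auto intro: F_SG)

lemma sol_F_pow:
  assumes "sol u f"
  shows "sol (\<lambda>x. u ((F 0 ^^ m) x)) (\<lambda>x. f ((F 0 ^^ m) x) / 5 ^ m) \<and>
    nflux 0 (bd (\<lambda>x. u ((F 0 ^^ m) x))) (\<lambda>x. f ((F 0 ^^ m) x) / 5 ^ m) = (3/5) ^ m * nflux 0 (bd u) f"
proof (induction m)
  case 0
  thus ?case using assms by simp
next
  case (Suc m)
  let ?u = "\<lambda>x. u ((F 0 ^^ m) x)" and ?f = "\<lambda>x. f ((F 0 ^^ m) x) / 5 ^ m"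
  have s: "sol ?u ?f" using Suc by blast
  have "sol (\<lambda>x. ?u (F 0 x)) (\<lambda>x. ?f (F 0 x) / 5)" by (rule sol_F[OF s]) simp
  moreover have "nflux 0 (bd (\<lambda>x. ?u (F 0 x))) (\<lambda>x. ?f (F 0 x) / 5) =
      nflux 0 (poisson_step 0 (bd ?u) ?f) (\<lambda>x. ?f (F 0 x) / 5)"
    by (rule nflux_cong) (use bd_F[OF s] in auto)
  ultimately show ?case
    using Suc nflux_self[OF sol_cont(2)[OF s], of 0 "bd ?u"] by (simp add: funpow_swap1 mult.commute)
qed

text \<open>The flux scales exactly. The difference quotient of level \<open>m\<close> misses it
  only by the moment of the source on the shrinking cell, which after renormalization is of order
  \<open>(1/3) ^ m\<close>.\<close>

lemma sol_normal_derivative: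
  assumes s: "sol u f"
  shows "has_normal_derivative u 0 (nflux 0 (bd u) f)"
proof -
  have f: "contSG f" using sol_cont[OF s] by blast
  obtain C where C: "C > 0" "\<And>x. x \<in> SG \<Longrightarrow> \<bar>f x\<bar> \<le> C" using contSG_bounded[OF f] by blast
  have cf: "contSG (\<lambda>x. f ((F 0 ^^ m) x))" for m
  proof (induction m)
    case (Suc m) thus ?case using contSG_F[OF Suc, of 0] by (simp add: funpow_swap1)
  qed (use f in simp)
  define M where "M m = mom (\<lambda>x. f ((F 0 ^^ m) x)) 0" for m
  have "\<bar>M m\<bar> \<le> C" for m
  proof -
    have "\<bar>M m\<bar> \<le> intg (\<lambda>x. \<bar>f ((F 0 ^^ m) x)\<bar>)" unfolding M_def by (rule mom_abs_le[OF cf])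
    also have "\<dots> \<le> intg (\<lambda>_. C)"
      using C(2) F_pow_SG cf by (intro intg_mono) (auto intro!: continuous_intros)
    finally show ?thesis by (simp add: intg_const)
  qed
  have eq: "(5/3) ^ m * (2 * u (q 0) - u ((F 0 ^^ m) (q (0 + 1))) - u ((F 0 ^^ m) (q (0 + 2))))
    = nflux 0 (bd u) f - (1/3) ^ m * M m" for m
  proof -
    have "nflux 0 (bd (\<lambda>x. u ((F 0 ^^ m) x))) (\<lambda>x. f ((F 0 ^^ m) x) / 5 ^ m)
      = 2 * u (q 0) - u ((F 0 ^^ m) (q (0 + 1))) - u ((F 0 ^^ m) (q (0 + 2))) + M m / 5 ^ m"
      by (simp add: nflux_def bd_def F_pow_q0 mom_divide M_def numeral_2_eq_2)
    hence "2 * u (q 0) - u ((F 0 ^^ m) (q (0 + 1))) - u ((F 0 ^^ m) (q (0 + 2)))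
      = (3/5) ^ m * nflux 0 (bd u) f - M m / 5 ^ m" using sol_F_pow[OF s, of m] by simp
    moreover have "(5/3::real) ^ m * (3/5) ^ m = 1" "(5/3::real) ^ m / 5 ^ m = (1/3) ^ m"
      by (simp_all add: power_mult_distrib[symmetric] power_divide[symmetric])
    ultimately show ?thesis by (simp add: right_diff_distrib mult.assoc[symmetric] flip: times_divide_eq_left)
  qed
  have "(\<lambda>m. (1/3) ^ m * M m) \<longlonglongrightarrow> 0"
  proof (rule Lim_null_comparison)
    show "\<forall>\<^sub>F m in sequentially. norm ((1/3) ^ m * M m) \<le> (1/3) ^ m * C"
      using \<open>\<And>m. \<bar>M m\<bar> \<le> C\<close> by (intro always_eventually allI) (simp add: abs_mult mult_left_mono)
    show "(\<lambda>m. (1/3) ^ m * C) \<longlonglongrightarrow> 0"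
      using tendsto_mult_right[OF LIMSEQ_power_zero[of "1/3::real"], of C] by simp
  qed
  hence "(\<lambda>m. nflux 0 (bd u) f - (1/3) ^ m * M m) \<longlonglongrightarrow> nflux 0 (bd u) f - 0"
    by (intro tendsto_intros)
  thus ?thesis unfolding has_normal_derivative_def eq by simp
qed

lemma edge_load_0 [simp]: "edge_load (\<lambda>x. 0) k = 0"
  by (simp add: edge_load_def)

text \<open>For a harmonic function the difference of the values at \<open>q 1\<close> and
  \<open>q 2\<close> is divided by exactly 5 in passing to the cell at \<open>q 0\<close>, so the
  defining sequence of the tangential derivative is constant.\<close>

lemma sol_tangential_harmonic:
  assumes "sol u (\<lambda>x. 0)"
  shows "5 ^ m * (u ((F 0 ^^ m) (q 1)) - u ((F 0 ^^ m) (q 2))) = u (q 1) - u (q 2)"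
proof (induction m)
  case (Suc m)
  let ?u = "\<lambda>x. u ((F 0 ^^ m) x)"
  have s: "sol ?u (\<lambda>x. 0)" using sol_F_pow[OF assms, of m] by simp
  have "bd (\<lambda>x. ?u (F 0 x)) 1 - bd (\<lambda>x. ?u (F 0 x)) 2 = (?u (q 1) - ?u (q 2)) / 5"
    using bd_F[OF s, of 0 1] bd_F[OF s, of 0 2] by (simp add: poisson_step_simps bd_def field_simps)
  hence e: "u ((F 0 ^^ Suc m) (q 1)) - u ((F 0 ^^ Suc m) (q 2)) = (?u (q 1) - ?u (q 2)) / 5"
    by (simp add: bd_def funpow_swap1)
  show ?case unfolding e using Suc by simp
qed simp

text \<open>A harmonic function has three degrees of freedom: the value at \<open>q 0\<close>, the
  flux, which gives the sum of the two other corner values, and the tangential derivative, which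
  gives their difference.\<close>

lemma sol_zero_Cauchy_data:
  assumes s: "sol d (\<lambda>x. 0)" and "d (q 0) = 0" "has_normal_derivative d 0 0"
    "has_tangential_derivative d 0 0" and x: "x \<in> SG"
  shows "d x = 0"
proof -
  have "nflux 0 (bd d) (\<lambda>x. 0) = 0"
    using sol_normal_derivative[OF s] assms(3) LIMSEQ_unique unfolding has_normal_derivative_def by blast
  hence "d (q 1) + d (q 2) = 0" using assms(2) by (simp add: nflux_def bd_def)
  moreover have "(\<lambda>m. d (q 1) - d (q 2)) \<longlonglongrightarrow> 0"
    using assms(4) sol_tangential_harmonic[OF s] unfolding has_tangential_derivative_def by (simp add: numeral_2_eq_2)
  hence "d (q 1) = d (q 2)" by (simp add: LIMSEQ_const_iff)
  ultimately have z: "d (q 0) = 0" "d (q 1) = 0" "d (q 2) = 0" using assms(2) by auto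
  have "d (q j) = 0" if "j < 3" for j using that z by (elim less3_cases) simp_all
  thus ?thesis using sol_zero_boundary_le[OF s _ _ x] by simp
qed

lemma poisson_eq_harmonic:
  assumes x: "x \<in> SG"
  shows "poisson a (\<lambda>x. 0) x = harmonic a x"
proof (rule contSG_eq_on_vertices[OF _ _ _ x])
  show "contSG (poisson a (\<lambda>x. 0))" by (rule poisson_cont) auto
  show "contSG (harmonic a)" by (rule harmonic_cont)
  show "poisson a (\<lambda>x. 0) (Fw w (q 0)) = harmonic a (Fw w (q 0))" if "w \<in> words m" for m w
    using that
  proof (induction m arbitrary: a w)
    case 0
    thus ?case using poisson_q[of "\<lambda>x. 0" 0 a] harmonic_q[of 0 a] by simp
  next
    case (Suc m)
    obtain i v where v: "i < 3" "v \<in> words m" "w = i # v" using Suc.prems by (auto simp: words_Suc)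
    have i: "Fw v (q 0) \<in> SG" by (rule Fw_SG[OF v(2)]) simp
    have "poisson_step i a (\<lambda>x. 0) = harmonic_step i a"
      by (rule ext) (simp add: poisson_step_def harmonic_step_def)
    thus ?case using Suc.IH[OF v(2), of "harmonic_step i a"] v
        poisson_F[of "\<lambda>x. 0" i "Fw v (q 0)" a] harmonic_F[OF v(1) i, of a] i by simp
  qed
qed

lemma sol_harmonic: "sol (harmonic a) (\<lambda>x. 0)"
  by (rule sol_cong[OF sol_poisson[of "\<lambda>x. 0" a]]) (auto simp: poisson_eq_harmonic)

section \<open>Construction of the monomials\<close>

definition restr :: "(real \<times> real \<Rightarrow> real) \<Rightarrow> real \<times> real \<Rightarrow> real" where
  "restr u x = (if x \<in> SG then u x else 0)"

lemma restr_SG [simp]: "x \<in> SG \<Longrightarrow> restr u x = u x" by (simp add: restr_def)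

text \<open>The monomials satisfy \<open>P (F 0 x) = monomial_scale k j * P x\<close>; the boundary values
  \<open>monomial_bd k j f\<close> at the next level are forced by this scaling and the Cauchy data at \<open>q 0\<close>.
  (For \<open>k = 1\<close>, \<open>j = 0\<close> the quotient is \<open>x / 0 = 0\<close>, as it should be.)\<close>

definition monomial_scale :: "nat \<Rightarrow> nat \<Rightarrow> real" where
  "monomial_scale k j = (if k = 1 then 1 else if k = 2 then 3/5 else 1/5) / 5 ^ j"

lemma monomial_scale_less_1:
  assumes "k \<in> {1, 2, 3}" "\<not> (k = 1 \<and> j = 0)"
  shows "0 < monomial_scale k j" "monomial_scale k j < 1"
proof -
  have p: "(5::real) ^ j \<ge> 1" by simp
  show "0 < monomial_scale k j" by (simp add: monomial_scale_def)
  show "monomial_scale k j < 1"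
  proof (cases "k = 1")
    case True
    hence "(5::real) ^ j > 1" using assms(2) by (intro one_less_power) auto
    thus ?thesis using True by (simp add: monomial_scale_def divide_less_eq)
  next
    case False
    have "(3/5 :: real) < 5 ^ j" "(1/5 :: real) < 5 ^ j" using p by linarith+
    thus ?thesis using False by (simp add: monomial_scale_def divide_less_eq)
  qed
qed

text \<open>The inhomogeneous part of the antisymmetric recursion: on the cell at
  \<open>q 0\<close>, the difference of the values at the two other corners becomes a fifth of
  itself plus \<open>tload f\<close>.\<close>

definition tload :: "(real \<times> real \<Rightarrow> real) \<Rightarrow> real" where
  "tload f = (edge_load f 2 - edge_load f 1) / 5"

definition monomial_bd :: "nat \<Rightarrow> nat \<Rightarrow> (real \<times> real \<Rightarrow> real) \<Rightarrow> nat \<Rightarrow> real" where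
  "monomial_bd k j f i = (if i = 0 then 0
     else if i = 1 then (mom f 0 + 5 * tload f / (monomial_scale k j - 1)) / 2
     else (mom f 0 - 5 * tload f / (monomial_scale k j - 1)) / 2)"

text \<open>The boundary values of the harmonic functions whose value, normal and tangential
  derivative at \<open>q 0\<close> are (1, 0, 0), (0, 1, 0) and (0, 0, 1).\<close>

definition monomial_base :: "nat \<Rightarrow> nat \<Rightarrow> real" where
  "monomial_base k i = (if k = 1 then 1 else if k = 2 then (if i = 0 then 0 else -1/2)
     else (if i = 0 then 0 else if i = 1 then 1/2 else -1/2))"

fun monomial :: "nat \<Rightarrow> nat \<Rightarrow> real \<times> real \<Rightarrow> real" where
  "monomial k 0 = restr (harmonic (monomial_base k))"
| "monomial k (Suc j) = restr (poisson (monomial_bd k j (monomial k j)) (monomial k j))"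

declare monomial.simps [simp del]

lemma monomial_sol:
  "sol (monomial k 0) (\<lambda>x. 0)" "sol (monomial k (Suc j)) (monomial k j)"
proof -
  show 0: "sol (monomial k 0) (\<lambda>x. 0)" by (rule sol_cong[OF sol_harmonic]) (auto simp: monomial.simps)
  have step: "sol (monomial k (Suc j)) (monomial k j)" if "contSG (monomial k j)" for j
    unfolding monomial.simps(2)[of k j] by (rule sol_cong[OF sol_poisson[OF that]]) (simp_all only: restr_SG)
  have "contSG (monomial k j) \<and> sol (monomial k (Suc j)) (monomial k j)" for j
  proof (induction j)
    case 0
    have "contSG (monomial k 0)" using sol_cont[OF \<open>sol (monomial k 0) (\<lambda>x. 0)\<close>] by blast
    thus ?case using step by blast
  next
    case (Suc j)
    hence "contSG (monomial k (Suc j))" using sol_cont by blast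
    thus ?case using step by blast
  qed
  thus "sol (monomial k (Suc j)) (monomial k j)" by blast
qed

lemma monomial_cont: "contSG (monomial k j)"
  using sol_cont(2)[OF monomial_sol(2)] .

lemma monomial_outside: "x \<notin> SG \<Longrightarrow> monomial k j x = 0"
  by (cases j) (auto simp: restr_def monomial.simps)

lemma monomial_q_0: "i < 3 \<Longrightarrow> monomial k 0 (q i) = monomial_base k i"
  using harmonic_q by (simp add: monomial.simps)

lemma monomial_q_Suc: "i < 3 \<Longrightarrow> monomial k (Suc j) (q i) = monomial_bd k j (monomial k j) i"
  using poisson_q[OF monomial_cont] by (simp add: monomial.simps)

text \<open>Self-similarity in the form of \<open>mom_split_explicit\<close> forces the three
  moments to be equal, and they sum to 1.\<close>

lemma mom_1: "i < 3 \<Longrightarrow> mom (\<lambda>x. 1) i = 1/3"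
proof -
  assume i: "i < 3"
  have s: "mom (\<lambda>x. 1) 0 + mom (\<lambda>x. 1) 1 + mom (\<lambda>x. 1) 2 = 1" using mom_sum[of "\<lambda>x. 1"] by (simp add: intg_const)
  have e: "3 * mom (\<lambda>x. 1) 0 = 9/5 * mom (\<lambda>x. 1) 0 + 3/5 * (mom (\<lambda>x. 1) 1 + mom (\<lambda>x. 1) 2)"
    "3 * mom (\<lambda>x. 1) 1 = 9/5 * mom (\<lambda>x. 1) 1 + 3/5 * (mom (\<lambda>x. 1) 0 + mom (\<lambda>x. 1) 2)"
    using mom_split_explicit(1,2)[of "\<lambda>x. 1", OF continuous_on_const] by (simp_all add: field_simps)
  have m0: "mom (\<lambda>x. 1) 0 = 1/3" using s e by argo
  have m1: "mom (\<lambda>x. 1) 1 = 1/3" using s e by argo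
  have "mom (\<lambda>x. 1) 2 = 1/3" using s m0 m1 by argo
  with m0 m1 have "mom (\<lambda>x. 1) 0 = 1/3" "mom (\<lambda>x. 1) 1 = 1/3" "mom (\<lambda>x. 1) 2 = 1/3" by blast+
  thus ?thesis using i by (elim less3_cases) simp_all
qed

lemma mom_cmult: "mom (\<lambda>x. c * f x) i = c * mom f i"
  unfolding mom_def using intg_cmult[of c "\<lambda>x. f x * hb i x"] by (simp add: mult.assoc)

lemma monomial_flux_tload:
  shows "monomial k (Suc j) (q 1) + monomial k (Suc j) (q 2) = mom (monomial k j) 0"
    "monomial k (Suc j) (q 1) - monomial k (Suc j) (q 2) = 5 * tload (monomial k j) / (monomial_scale k j - 1)"
    "monomial k (Suc j) (q 0) = 0"
  using monomial_q_Suc[of 0 k j] monomial_q_Suc[of 1 k j] monomial_q_Suc[of 2 k j]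
  by (simp_all add: monomial_bd_def field_simps)

lemma monomial_nflux:
  assumes "k \<in> {1, 2, 3}"
  shows "nflux 0 (bd (monomial k 0)) (\<lambda>x. 0) = of_bool (k = 2)"
    "nflux 0 (bd (monomial k (Suc j))) (monomial k j) = 0"
  using assms monomial_q_0[of 0 k] monomial_q_0[of 1 k] monomial_q_0[of 2 k] monomial_flux_tload[of k j]
  by (auto simp: nflux_def bd_def monomial_base_def)

text \<open>This settles the one case in which \<open>monomial_bd\<close> divides by 0: a constant
  source has no antisymmetric load.\<close>

lemma tload_mono_1_0: "tload (monomial 1 0) = 0"
proof -
  have "monomial 1 0 x = 1" if "x \<in> SG" for x
    using harmonic_bounds[of 1 "monomial_base 1" 1 x] that by (auto simp: monomial.simps monomial_base_def)
  hence "mom (\<lambda>x. monomial 1 0 (F i x)) j = mom (\<lambda>x. 1) j" if "i < 3" for i j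
    using that F_SG by (intro mom_cong) blast
  thus ?thesis by (simp add: tload_def edge_load_def mom_1)
qed

text \<open>Both sides have the same Laplacian by induction, so the corner values decide. On the
  cell, the vanishing flux at \<open>q 0\<close> fixes the sum of the two other values and
  \<open>tload\<close> their difference; \<open>monomial_bd\<close> is the choice for which both
  scale correctly.\<close>

lemma monomial_scaling:
  assumes k: "k \<in> {1, 2, 3}"
  shows "x \<in> SG \<Longrightarrow> monomial k j (F 0 x) = monomial_scale k j * monomial k j x"
proof (induction j arbitrary: x)
  case 0
  have "harmonic (monomial_base k) (F 0 x) = harmonic (harmonic_step 0 (monomial_base k)) x" using harmonic_F 0 by simp
  also have "\<dots> = harmonic (\<lambda>i. 0 + monomial_scale k 0 * monomial_base k i) x"
    using k by (intro harmonic_cong 0) (auto simp: harmonic_step_simps monomial_base_def monomial_scale_def harmonic_step_simps(2)[simplified])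
  also have "\<dots> = harmonic (\<lambda>i. 0) x + monomial_scale k 0 * harmonic (monomial_base k) x" by (rule harmonic_linear[OF 0])
  also have "harmonic (\<lambda>i. 0) x = 0" using harmonic_bounds[of 0 "\<lambda>_. 0" 0, OF _ 0] by auto
  finally show ?case using 0 F_SG[of 0 x] by (simp add: monomial.simps)
next
  case (Suc j)
  let ?u = "monomial k (Suc j)" and ?f = "monomial k j" and ?a = "bd (monomial k (Suc j))"
  define s where "s = monomial_scale k j"
  have s': "monomial_scale k (Suc j) = s / 5" by (simp add: monomial_scale_def s_def)
  note S = monomial_sol(2)[of k j]
  have f: "contSG ?f" by (rule monomial_cont)
  have "nflux 0 (poisson_step 0 ?a ?f) (\<lambda>x. ?f (F 0 x) / 5) = 0"
    using nflux_self[OF f, of 0 ?a] monomial_nflux(2)[OF k] by simp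
  moreover have "mom (\<lambda>x. ?f (F 0 x) / 5) 0 = s / 5 * mom ?f 0"
    using mom_cong[of "\<lambda>x. ?f (F 0 x) / 5" "\<lambda>x. (s / 5) * ?f x" 0] Suc.IH mom_cmult[of "s/5" ?f 0]
    by (simp add: s_def)
  ultimately have sum: "poisson_step 0 ?a ?f 1 + poisson_step 0 ?a ?f 2 = s / 5 * (?a 1 + ?a 2)"
    using monomial_flux_tload[of k j] by (simp add: nflux_def poisson_step_simps(1) bd_def)
  have "poisson_step 0 ?a ?f 1 - poisson_step 0 ?a ?f 2 = (?a 1 - ?a 2) / 5 + tload ?f"
    by (simp add: poisson_step_simps tload_def field_simps)
  also have "\<dots> = s / 5 * (?a 1 - ?a 2)"
  proof (cases "s = 1")
    case True
    hence "k = 1 \<and> j = 0" using monomial_scale_less_1[OF k, of j] unfolding s_def by fastforce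
    thus ?thesis using True tload_mono_1_0 by simp
  next
    case False
    have "?a 1 - ?a 2 = 5 * tload ?f / (s - 1)" using monomial_flux_tload(2)[of k j] by (simp add: bd_def s_def)
    hence "tload ?f = (s - 1) * (?a 1 - ?a 2) / 5" using False by (simp add: field_simps)
    thus ?thesis by (simp add: field_simps)
  qed
  finally have diff: "poisson_step 0 ?a ?f 1 - poisson_step 0 ?a ?f 2 = s / 5 * (?a 1 - ?a 2)" .
  have b: "poisson_step 0 ?a ?f i = s / 5 * ?a i" if "i < 3" for i
  proof -
    have "poisson_step 0 ?a ?f 0 = s / 5 * ?a 0" using monomial_flux_tload(3)[of k j] by (simp add: poisson_step_simps(1) bd_def)
    moreover have "poisson_step 0 ?a ?f 1 = s / 5 * ?a 1" "poisson_step 0 ?a ?f 2 = s / 5 * ?a 2"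
      using sum diff by (simp_all add: algebra_simps)
    ultimately show ?thesis using that by (elim less3_cases) simp_all
  qed
  have "sol (\<lambda>x. ?u (F 0 x)) (\<lambda>x. ?f (F 0 x) / 5)" by (rule sol_F[OF S]) simp
  moreover have "sol (\<lambda>x. 0 + (s / 5) * ?u x) (\<lambda>x. 0 + (s / 5) * ?f x)"
    by (rule sol_linear[OF _ S]) (rule sol_cong[OF sol_harmonic[of "\<lambda>_. 0"]], use harmonic_bounds[of 0 "\<lambda>_. 0" 0] in fastforce, simp)
  ultimately have "?u (F 0 x) = 0 + (s / 5) * ?u x"
  proof (rule sol_unique)
    show "?f (F 0 x) / 5 = 0 + s / 5 * ?f x" if "x \<in> SG" for x using Suc.IH[OF that] by (simp add: s_def)
    show "?u (F 0 (q i)) = 0 + s / 5 * ?u (q i)" if "i < 3" for i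
      using bd_F[OF S _ that, of 0] b[OF that] by (simp add: bd_def)
  qed (rule Suc.prems)
  thus ?case unfolding s' by (simp only: add_0)
qed

lemma monomial_scaling_pow:
  assumes "k \<in> {1, 2, 3}" "x \<in> SG"
  shows "monomial k j ((F 0 ^^ m) x) = monomial_scale k j ^ m * monomial k j x"
proof (induction m)
  case (Suc m)
  thus ?case using monomial_scaling[OF assms(1) F_pow_SG[OF assms(2)], of j m] by simp
qed simp

text \<open>By scaling, the defining sequence is geometric with ratio
  \<open>5 * monomial_scale k j\<close>. For \<open>j > 0\<close> the ratio is below 1, except for
  \<open>k = 1\<close> and \<open>j = 1\<close>, where it is 1 and the difference of the corner
  values vanishes.\<close>

lemma monomial_tangential:
  assumes k: "k \<in> {1, 2, 3}"
  shows "has_tangential_derivative (monomial k j) 0 (of_bool (j = 0 \<and> k = 3))"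
proof -
  define T where "T = monomial k j (q 1) - monomial k j (q 2)"
  have eq: "5 ^ m * (monomial k j ((F 0 ^^ m) (q (0 + 1))) - monomial k j ((F 0 ^^ m) (q (0 + 2)))) = (5 * monomial_scale k j) ^ m * T" for m
    using monomial_scaling_pow[OF k, of "q 1" j m] monomial_scaling_pow[OF k, of "q 2" j m]
    by (simp add: T_def power_mult_distrib algebra_simps numeral_2_eq_2)
  have "(\<lambda>m. (5 * monomial_scale k j) ^ m * T) \<longlonglongrightarrow> of_bool (j = 0 \<and> k = 3)"
  proof (cases j)
    case 0
    hence "T = of_bool (k = 3)" using k monomial_q_0[of 1 k] monomial_q_0[of 2 k] by (auto simp: T_def monomial_base_def)
    moreover have "k = 3 \<Longrightarrow> 5 * monomial_scale k j = 1" using 0 by (simp add: monomial_scale_def)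
    ultimately show ?thesis using 0 by (cases "k = 3") auto
  next
    case (Suc i)
    show ?thesis
    proof (cases "k = 1 \<and> i = 0")
      case True
      hence "T = 0" using monomial_flux_tload(2)[of 1 0] tload_mono_1_0 Suc unfolding T_def by simp
      thus ?thesis using Suc by simp
    next
      case False
      have "5 * monomial_scale k j = monomial_scale k i" using Suc by (simp add: monomial_scale_def)
      hence "0 \<le> 5 * monomial_scale k j" "5 * monomial_scale k j < 1" using monomial_scale_less_1[OF k False] by simp_all
      hence "(\<lambda>m. (5 * monomial_scale k j) ^ m * T) \<longlonglongrightarrow> 0 * T"
        by (intro tendsto_intros LIMSEQ_power_zero) simp
      thus ?thesis using Suc by simp
    qed
  qed
  thus ?thesis unfolding has_tangential_derivative_def eq .
qed

section \<open>Cauchy data and uniqueness of the monomials\<close>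

lemma laplacian_mono: "laplacian (monomial k (Suc j)) = monomial k j" "laplacian (monomial k 0) = (\<lambda>x. 0)"
  using laplacian_eq[OF monomial_sol(2)[of k j]] laplacian_eq[OF monomial_sol(1)[of k]] monomial_outside[of _ k j]
  by (auto)

lemma laplacian_pow_mono: "n \<le> j \<Longrightarrow> (laplacian ^^ n) (monomial k j) = monomial k (j - n)"
proof (induction n)
  case (Suc n)
  hence "(laplacian ^^ Suc n) (monomial k j) = laplacian (monomial k (Suc (j - Suc n)))"
    by (simp add: Suc_diff_Suc)
  thus ?case unfolding laplacian_mono .
qed simp

lemma monomial_sol': "sol (monomial k j) (case j of 0 \<Rightarrow> (\<lambda>x. 0) | Suc i \<Rightarrow> monomial k i)"
  by (cases j) (simp_all add: monomial_sol)

lemma monomial_Cauchy_data: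
  assumes k: "k \<in> {1, 2, 3}"
  shows "monomial k j (q 0) = of_bool (j = 0 \<and> k = 1)"
    "has_normal_derivative (monomial k j) 0 (of_bool (j = 0 \<and> k = 2))"
proof -
  show "monomial k j (q 0) = of_bool (j = 0 \<and> k = 1)"
    using k monomial_q_0[of 0 k] monomial_flux_tload(3)[of k] by (cases j) (auto simp: monomial_base_def)
  have "nflux 0 (bd (monomial k j)) (case j of 0 \<Rightarrow> (\<lambda>x. 0) | Suc i \<Rightarrow> monomial k i) = of_bool (j = 0 \<and> k = 2)"
    using monomial_nflux[OF k] by (cases j) (simp_all)
  thus "has_normal_derivative (monomial k j) 0 (of_bool (j = 0 \<and> k = 2))"
    using sol_normal_derivative[OF monomial_sol'[of k j]] by simp
qed

lemma is_monomial_mono: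
  assumes k: "k \<in> {1, 2, 3}"
  shows "is_monomial j k (monomial k j)"
  unfolding is_monomial_def
proof (intro conjI allI impI ballI)
  fix n assume n: "n \<le> j"
  show "\<exists>f. has_laplacian ((laplacian ^^ n) (monomial k j)) f"
    unfolding laplacian_pow_mono[OF n] has_laplacian_iff_sol using monomial_sol' by blast
  have e: "(j - n = 0) = (n = j)" using n by auto
  show "(laplacian ^^ n) (monomial k j) (q 0) = of_bool (n = j \<and> k = 1)"
    "has_normal_derivative ((laplacian ^^ n) (monomial k j)) 0 (of_bool (n = j \<and> k = 2))"
    "has_tangential_derivative ((laplacian ^^ n) (monomial k j)) 0 (of_bool (n = j \<and> k = 3))"
    unfolding laplacian_pow_mono[OF n]
    using monomial_Cauchy_data[OF k, of "j - n"] monomial_tangential[OF k, of "j - n"] unfolding e by auto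
next
  fix x
  show "(laplacian ^^ (j + 1)) (monomial k j) x = 0"
    using laplacian_pow_mono[of j j k] laplacian_mono(2)[of k] by (simp)
qed

text \<open>Downward induction from \<open>n = j\<close>: once the functions agree after
  \<open>n + 1\<close> Laplacians, their difference after \<open>n\<close> Laplacians is harmonic,
  and its Cauchy data vanish.\<close>

lemma monomial_unique:
  assumes k: "k \<in> {1, 2, 3}" and u: "is_monomial j k u" and n: "n \<le> j" "x \<in> SG"
  shows "(laplacian ^^ n) u x = monomial k (j - n) x"
  using n
proof (induction "j - n" arbitrary: n x)
  have step: "(laplacian ^^ n) u x = monomial k (j - n) x" if n: "n \<le> j" and
    L: "\<And>x. x \<in> SG \<Longrightarrow> (laplacian ^^ Suc n) u x = (case j - n of 0 \<Rightarrow> (\<lambda>x. 0) | Suc i \<Rightarrow> monomial k i) x" and x: "x \<in> SG" for n x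
  proof -
    let ?g = "(laplacian ^^ n) u" and ?P = "monomial k (j - n)" and ?G = "case j - n of 0 \<Rightarrow> (\<lambda>x. 0) | Suc i \<Rightarrow> monomial k i"
    obtain f where f: "sol ?g f" using u n unfolding is_monomial_def has_laplacian_iff_sol by blast
    have "f x = ?G x" if "x \<in> SG" for x
      using laplacian_eq[OF f] L[OF that] that by simp
    hence "sol (\<lambda>x. ?g x + (-1) * ?P x) (\<lambda>x. 0)"
      by (intro sol_cong[OF sol_linear[OF f monomial_sol'[of k "j - n"], of "-1"]]) auto
    hence s: "sol (\<lambda>x. ?g x - ?P x) (\<lambda>x. 0)" by simp
    have e: "(j - n = 0) = (n = j)" using n by auto
    have g: "?g (q 0) = of_bool (n = j \<and> k = 1)"
      "has_normal_derivative ?g 0 (of_bool (n = j \<and> k = 2))"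
      "has_tangential_derivative ?g 0 (of_bool (n = j \<and> k = 3))"
      using u n unfolding is_monomial_def by blast+
    note P = monomial_Cauchy_data[OF k, of "j - n"] monomial_tangential[OF k, of "j - n"]
    have "?g x - ?P x = 0"
    proof (rule sol_zero_Cauchy_data[OF s _ _ _ x])
      show "?g (q 0) - ?P (q 0) = 0" using g(1) P(1) e by simp
      show "has_normal_derivative (\<lambda>x. ?g x - ?P x) 0 0"
        using tendsto_diff[OF g(2)[unfolded has_normal_derivative_def] P(2)[unfolded has_normal_derivative_def]]
        unfolding has_normal_derivative_def e by (simp add: algebra_simps)
      show "has_tangential_derivative (\<lambda>x. ?g x - ?P x) 0 0"
        using tendsto_diff[OF g(3)[unfolded has_tangential_derivative_def] P(3)[unfolded has_tangential_derivative_def]]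
        unfolding has_tangential_derivative_def e by (simp add: algebra_simps)
    qed
    thus ?thesis by simp
  qed
  {
    case 0
    hence "n = j" by simp
    thus ?case using step[of n x] 0 u unfolding is_monomial_def by simp
  next
    case (Suc d)
    have "(laplacian ^^ Suc n) u x = (case j - n of 0 \<Rightarrow> (\<lambda>x. 0) | Suc i \<Rightarrow> monomial k i) x" if "x \<in> SG" for x
    proof -
      have d: "d = j - Suc n" "Suc n \<le> j" "j - n = Suc d" using Suc.hyps(2) by auto
      show ?thesis using Suc.hyps(1)[OF d(1,2) that] d(1) unfolding d(3) by simp
    qed
    thus ?case using step[of n x] Suc.prems by blast
  }
qed

lemma Pmon_eq_mono:
  assumes k: "k \<in> {1, 2, 3}"
  shows "Pmon j k = monomial k j"
  unfolding Pmon_def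
proof (rule the_equality)
  show "is_monomial j k (monomial k j) \<and> (\<forall>x. x \<notin> SG \<longrightarrow> monomial k j x = 0)"
    using is_monomial_mono[OF k] monomial_outside by blast
  fix u assume u: "is_monomial j k u \<and> (\<forall>x. x \<notin> SG \<longrightarrow> u x = 0)"
  show "u = monomial k j"
  proof
    fix x
    show "u x = monomial k j x"
    proof (cases "x \<in> SG")
      case True
      thus ?thesis using monomial_unique[OF k, of j u 0 x] u by simp
    next
      case False
      hence "u x = 0" using u by blast
      thus ?thesis using monomial_outside[OF False] by simp
    qed
  qed
qed

section \<open>The Dirichlet-to-Neumann power series\<close>

definition perm3 :: "(nat \<Rightarrow> nat) \<Rightarrow> bool" where
  "perm3 \<pi> \<longleftrightarrow> bij_betw \<pi> {..<3} {..<3}"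

lemma perm3_less: "perm3 \<pi> \<Longrightarrow> i < 3 \<Longrightarrow> \<pi> i < 3"
  unfolding perm3_def bij_betw_def by blast

lemma perm3_sum: "perm3 \<pi> \<Longrightarrow> (\<Sum>i<3. f (\<pi> i)) = (\<Sum>i<3. f i)"
  for f :: "nat \<Rightarrow> 'a::comm_monoid_add"
  unfolding perm3_def by (rule sum.reindex_bij_betw)

text \<open>The affine symmetry of the triangle that permutes the vertices according to \<open>\<pi>\<close>.\<close>

definition sig :: "(nat \<Rightarrow> nat) \<Rightarrow> real \<times> real \<Rightarrow> real \<times> real" where
  "sig \<pi> x = lam 0 x *\<^sub>R q (\<pi> 0) + lam 1 x *\<^sub>R q (\<pi> 1) + lam 2 x *\<^sub>R q (\<pi> 2)"

lemma sig_q: "i < 3 \<Longrightarrow> sig \<pi> (q i) = q (\<pi> i)"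
  by (elim less3_cases) (simp_all add: sig_def lam_q lam_q[of _ 1, simplified])

lemma sig_F: "i < 3 \<Longrightarrow> sig \<pi> (F i x) = F (\<pi> i) (sig \<pi> x)"
  by (elim less3_cases)
    (simp_all add: sig_def lam_F lam_F[of _ 1, simplified] lam_F[of 1, simplified] lam_F[of 1 1, simplified] F_eq[of "\<pi> 0"]
      F_eq[of "\<pi> (Suc 0)"] F_eq[of "\<pi> 2"] scaleR_add_left scaleR_add_right)

lemma sig_cont [continuous_intros]: "continuous_on S (sig \<pi>)"
  unfolding sig_def by (intro continuous_intros)

lemma lam_sig:
  assumes "j < 3" "\<And>i. i < 3 \<Longrightarrow> \<pi> i < 3"
  shows "lam j (sig \<pi> x) = lam 0 x * of_bool (\<pi> 0 = j) + lam 1 x * of_bool (\<pi> 1 = j) + lam 2 x * of_bool (\<pi> 2 = j)"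
proof -
  have aff: "lam j (a *\<^sub>R u + b *\<^sub>R v + c *\<^sub>R w) = a * lam j u + b * lam j v + c * lam j w"
    if "a + b + c = 1" for a b c u v w
  proof -
    have a: "a = 1 - b - c" using that by simp
    show ?thesis unfolding a lam_def by (simp add: algebra_simps add_divide_distrib diff_divide_distrib)
  qed
  show ?thesis
    unfolding sig_def aff[OF lam_sum] using assms(2)[of 0] assms(2)[of 1] assms(2)[of 2] assms(1)
    by (simp only: lam_q)
qed

lemma sig_inv:
  assumes \<pi>: "\<And>i. i < 3 \<Longrightarrow> \<pi> i < 3" and \<rho>: "\<And>i. i < 3 \<Longrightarrow> \<rho> (\<pi> i) = i"
  shows "sig \<rho> (sig \<pi> x) = x"
proof -
  have "sig \<rho> (sig \<pi> x) = (\<Sum>j<3. lam j (sig \<pi> x) *\<^sub>R q (\<rho> j))" by (simp add: sig_def sum_less3)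
  also have "\<dots> = (\<Sum>j<3. \<Sum>i<3. (lam i x * of_bool (\<pi> i = j)) *\<^sub>R q (\<rho> j))"
    by (intro sum.cong refl) (simp add: lam_sig[OF _ \<pi>] sum_less3 scaleR_add_left)
  also have "\<dots> = (\<Sum>i<3. \<Sum>j<3. (lam i x * of_bool (\<pi> i = j)) *\<^sub>R q (\<rho> j))" by (rule sum.swap)
  also have "\<dots> = (\<Sum>i<3. lam i x *\<^sub>R q i)"
  proof (intro sum.cong refl)
    fix i assume i: "i \<in> {..<3::nat}"
    have "(\<Sum>j<3. (lam i x * of_bool (\<pi> i = j)) *\<^sub>R q (\<rho> j)) = (\<Sum>j<3. if \<pi> i = j then lam i x *\<^sub>R q (\<rho> j) else 0)"
      by (intro sum.cong) auto
    also have "\<dots> = lam i x *\<^sub>R q i" using i \<pi> \<rho> by (simp add: sum.delta')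
    finally show "(\<Sum>j<3. (lam i x * of_bool (\<pi> i = j)) *\<^sub>R q (\<rho> j)) = lam i x *\<^sub>R q i" .
  qed
  also have "\<dots> = x" using point_eq_lam[of x] by (simp add: sum_less3)
  finally show ?thesis .
qed

lemma perm3_inverse:
  assumes "perm3 \<pi>"
  obtains \<rho> where "perm3 \<rho>" "\<And>x. sig \<rho> (sig \<pi> x) = x" "\<And>x. sig \<pi> (sig \<rho> x) = x"
    "\<And>i. i < 3 \<Longrightarrow> \<rho> (\<pi> i) = i" "\<And>i. i < 3 \<Longrightarrow> \<pi> (\<rho> i) = i"
proof -
  define \<rho> where "\<rho> = inv_into {..<3} \<pi>"
  have b: "bij_betw \<pi> {..<3} {..<3}" using assms unfolding perm3_def .
  have p: "perm3 \<rho>" unfolding perm3_def \<rho>_def by (rule bij_betw_inv_into[OF b])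
  have 1: "\<rho> (\<pi> i) = i" if "i < 3" for i unfolding \<rho>_def using bij_betw_inv_into_left[OF b] that by simp
  have 2: "\<pi> (\<rho> i) = i" if "i < 3" for i unfolding \<rho>_def using bij_betw_inv_into_right[OF b] that by simp
  have s1: "sig \<rho> (sig \<pi> x) = x" for x
    by (rule sig_inv[OF perm3_less[OF assms] 1])
  have s2: "sig \<pi> (sig \<rho> x) = x" for x
    by (rule sig_inv[OF perm3_less[OF p] 2])
  show ?thesis by (rule that[OF p s1 s2 1 2])
qed

lemma sig_image_SG:
  assumes p: "perm3 \<pi>"
  shows "sig \<pi> ` SG = SG"
proof -
  have "compact (sig \<pi> ` SG)" by (intro compact_continuous_image sig_cont compact_SG)
  moreover have "sig \<pi> ` SG \<noteq> {}" using SG_nonempty by simp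
  moreover have "sig \<pi> ` SG = (\<Union>i<3. F i ` sig \<pi> ` SG)"
  proof -
    have "sig \<pi> ` SG = sig \<pi> ` (\<Union>i<3. F i ` SG)" using SG_eq by simp
    also have "\<dots> = (\<Union>i<3. F (\<pi> i) ` sig \<pi> ` SG)"
      unfolding image_UN by (intro SUP_cong refl) (simp add: image_image sig_F)
    also have "\<dots> = (\<Union>j\<in>\<pi> ` {..<3}. F j ` sig \<pi> ` SG)" by simp
    also have "\<pi> ` {..<3} = {..<3}" using p unfolding perm3_def bij_betw_def by blast
    finally show ?thesis .
  qed
  ultimately show ?thesis using SG_unique by metis
qed

lemma sig_SG: "perm3 \<pi> \<Longrightarrow> x \<in> SG \<Longrightarrow> sig \<pi> x \<in> SG"
  using sig_image_SG by blast

lemma sig_SG_iff: "perm3 \<pi> \<Longrightarrow> sig \<pi> x \<in> SG \<longleftrightarrow> x \<in> SG"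
  using perm3_inverse[of \<pi>] sig_SG by metis

lemma sig_measurable [measurable]: "sig \<pi> \<in> borel_measurable borel"
  by (intro borel_measurable_continuous_onI sig_cont)

text \<open>The symmetry permutes the contractions by conjugation, so the image measure is again
  self-similar and uniqueness applies.\<close>

lemma mu_sig:
  assumes p: "perm3 \<pi>"
  shows "distr mu borel (sig \<pi>) = mu"
proof (rule self_similar_measure_unique)
  show M: "self_similar_measure mu" unfolding mu_eq by (rule self_similar_sg_measure)
  show "self_similar_measure (distr mu borel (sig \<pi>))"
    unfolding self_similar_measure_def
  proof (intro conjI ballI)
    show "prob_space (distr mu borel (sig \<pi>))" by (rule mu.prob_space_distr) measurable
    have "sig \<pi> -` SG = SG" using sig_SG_iff[OF p] by blast
    thus "measure (distr mu borel (sig \<pi>)) SG = 1"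
      by (subst measure_distr) (auto simp: mu_SG)
    fix A :: "(real \<times> real) set" assume A[measurable]: "A \<in> sets borel"
    have B: "sig \<pi> -` A \<in> sets borel" "F i -` A \<in> sets borel" for i
      using measurable_sets_borel[OF sig_measurable A] measurable_sets_borel[OF F_measurable A] by auto
    have "measure (distr mu borel (sig \<pi>)) A = measure mu (sig \<pi> -` A)"
      by (subst measure_distr) (auto simp: A)
    also have "\<dots> = (\<Sum>i<3. measure mu (F i -` (sig \<pi> -` A))) / 3"
      using M B unfolding self_similar_measure_def by blast
    also have "(\<Sum>i<3. measure mu (F i -` (sig \<pi> -` A))) = (\<Sum>i<3. measure mu (sig \<pi> -` (F (\<pi> i) -` A)))"
      by (intro sum.cong refl arg_cong[of _ _ "measure mu"]) (simp add: vimage_def sig_F)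
    also have "\<dots> = (\<Sum>i<3. measure mu (sig \<pi> -` (F i -` A)))" by (rule perm3_sum[OF p])
    also have "\<dots> = (\<Sum>i<3. measure (distr mu borel (sig \<pi>)) (F i -` A))"
      by (intro sum.cong refl, subst measure_distr) (auto simp: B)
    finally show "measure (distr mu borel (sig \<pi>)) A = (\<Sum>i<3. measure (distr mu borel (sig \<pi>)) (F i -` A)) / 3" .
  qed simp
qed

lemma contSG_sig: "contSG f \<Longrightarrow> perm3 \<pi> \<Longrightarrow> contSG (\<lambda>x. f (sig \<pi> x))"
  by (rule continuous_on_compose2[of SG f]) (auto intro: sig_cont sig_SG)

lemma intg_sig:
  assumes f: "contSG f" and p: "perm3 \<pi>"
  shows "intg (\<lambda>x. f (sig \<pi> x)) = intg f"
proof -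
  define g where "g x = indicat_real SG x *\<^sub>R f x" for x
  have [measurable]: "g \<in> borel_measurable borel"
    unfolding g_def using borel_measurable_continuous_on_indicator[OF _ f] by simp
  have "intg f = (\<integral>x. g x \<partial>distr mu borel (sig \<pi>))"
    unfolding mu_sig[OF p] intg_def set_lebesgue_integral_def g_def by simp
  also have "\<dots> = (\<integral>x. g (sig \<pi> x) \<partial>mu)" by (rule integral_distr) measurable
  also have "\<dots> = intg (\<lambda>x. f (sig \<pi> x))"
    unfolding intg_def set_lebesgue_integral_def g_def
    by (intro Bochner_Integration.integral_cong refl) (simp add: indicator_def sig_SG_iff[OF p])
  finally show ?thesis by simp
qed

lemma D_perm:
  assumes "perm3 \<pi>"
  shows "triangle_form (\<lambda>j. a (\<pi> j)) (\<lambda>j. b (\<pi> j)) = triangle_form a b"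
proof -
  have "triangle_form a b = 3 * (\<Sum>j<3. a j * b j) - (\<Sum>j<3. a j) * (\<Sum>j<3. b j)" for a b
    by (simp add: triangle_form_def sum_less3 algebra_simps)
  thus ?thesis using perm3_sum[OF assms, of "\<lambda>j. a j * b j"] perm3_sum[OF assms, of a] perm3_sum[OF assms, of b]
    by simp
qed

lemma graph_energy_sig:
  assumes p: "perm3 \<pi>"
  shows "graph_energy m (\<lambda>x. u (sig \<pi> x)) (\<lambda>x. v (sig \<pi> x)) = graph_energy m u v"
proof (induction m arbitrary: u v)
  case 0
  have "triangle_form (\<lambda>j. u (sig \<pi> (q j))) (\<lambda>j. v (sig \<pi> (q j))) = triangle_form (\<lambda>j. u (q (\<pi> j))) (\<lambda>j. v (q (\<pi> j)))"
    using sig_q[of 1 \<pi>] by (simp add: triangle_form_def sig_q)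
  thus ?case using D_perm[OF p, of "\<lambda>j. u (q j)" "\<lambda>j. v (q j)"] by simp
next
  case (Suc m)
  have "graph_energy m (\<lambda>x. u (sig \<pi> (F i x))) (\<lambda>x. v (sig \<pi> (F i x))) = graph_energy m (\<lambda>x. u (F (\<pi> i) x)) (\<lambda>x. v (F (\<pi> i) x))"
    if "i < 3" for i
    using Suc.IH[of "\<lambda>x. u (F (\<pi> i) x)" "\<lambda>x. v (F (\<pi> i) x)"] by (simp add: sig_F[OF that])
  hence "(\<Sum>i<3. graph_energy m (\<lambda>x. u (sig \<pi> (F i x))) (\<lambda>x. v (sig \<pi> (F i x)))) =
      (\<Sum>i<3. graph_energy m (\<lambda>x. u (F (\<pi> i) x)) (\<lambda>x. v (F (\<pi> i) x)))" by simp
  also have "\<dots> = (\<Sum>i<3. graph_energy m (\<lambda>x. u (F i x)) (\<lambda>x. v (F i x)))" by (rule perm3_sum[OF p])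
  finally show ?case by simp
qed

lemma sol_sig:
  assumes s: "sol u f" and p: "perm3 \<pi>"
  shows "sol (\<lambda>x. u (sig \<pi> x)) (\<lambda>x. f (sig \<pi> x))"
proof -
  obtain \<rho> where \<rho>: "perm3 \<rho>" "\<And>x. sig \<rho> (sig \<pi> x) = x" "\<And>x. sig \<pi> (sig \<rho> x) = x"
    using perm3_inverse[OF p] by metis
  note c = sol_cont[OF s]
  have "has_laplacian (\<lambda>x. u (sig \<pi> x)) (\<lambda>x. f (sig \<pi> x))"
    unfolding has_laplacian_def
  proof (intro conjI ballI impI)
    show "(\<lambda>x. u (sig \<pi> x)) \<in> dom_energy"
      using sol_dom_energy[OF s] contSG_sig[OF c(1) p]
      unfolding dom_energy_def energy_level_eq_EL by (simp add: graph_energy_sig[OF p])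
    show "contSG (\<lambda>x. f (sig \<pi> x))" by (rule contSG_sig[OF c(2) p])
    fix v assume v: "v \<in> dom_energy" "\<forall>x\<in>V0. v x = 0"
    hence cv: "contSG v" unfolding dom_energy_def by blast
    define v' where "v' x = v (sig \<rho> x)" for x
    have v': "contSG v'" unfolding v'_def by (rule contSG_sig[OF cv \<rho>(1)])
    have "v' (q j) = 0" if "j < 3" for j
      unfolding v'_def sig_q[OF that] using v(2) perm3_less[OF \<rho>(1) that] unfolding V0_iff by blast
    hence "(\<lambda>m. graph_energy m u v') \<longlonglongrightarrow> - intg (\<lambda>x. f x * v' x)" by (rule sol_limit_zero_boundary[OF s v'])
    moreover have "graph_energy m u v' = graph_energy m (\<lambda>x. u (sig \<pi> x)) v" for m
      using graph_energy_sig[OF p, of m u v'] unfolding v'_def \<rho>(2) by simp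
    moreover have "intg (\<lambda>x. f x * v' x) = intg (\<lambda>x. f (sig \<pi> x) * v x)"
      using intg_sig[OF continuous_on_mult[OF c(2) v'] p] unfolding v'_def \<rho>(2) by simp
    ultimately show "energy (\<lambda>x. u (sig \<pi> x)) v = - (LINT x:SG|mu. f (sig \<pi> x) * v x)"
      unfolding energy_def energy_level_eq_EL intg_def[symmetric] by (simp add: limI)
  qed
  thus ?thesis unfolding has_laplacian_iff_sol .
qed

lemma hb_q: "i < 3 \<Longrightarrow> hb j (q i) = of_bool (i = j)"
  unfolding hb_def by (rule harmonic_q)

lemma sol_hb: "sol (hb j) (\<lambda>x. 0)"
  unfolding hb_def by (rule sol_harmonic)

lemma perm3_inj: "perm3 \<pi> \<Longrightarrow> i < 3 \<Longrightarrow> j < 3 \<Longrightarrow> \<pi> i = \<pi> j \<longleftrightarrow> i = j"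
  unfolding perm3_def bij_betw_def inj_on_def by blast

lemma hb_sig:
  assumes p: "perm3 \<pi>" and "j < 3" "x \<in> SG"
  shows "hb (\<pi> j) (sig \<pi> x) = hb j x"
  by (rule sol_unique[OF sol_sig[OF sol_hb p] sol_hb])
    (use assms in \<open>simp_all add: sig_q hb_q perm3_less perm3_inj\<close>)

lemma mom_sig:
  assumes f: "contSG f" and p: "perm3 \<pi>" and j: "j < 3"
  shows "mom (\<lambda>x. f (sig \<pi> x)) j = mom f (\<pi> j)"
proof -
  have "mom (\<lambda>x. f (sig \<pi> x)) j = intg (\<lambda>x. f (sig \<pi> x) * hb (\<pi> j) (sig \<pi> x))"
    unfolding mom_def by (rule intg_cong) (simp add: hb_sig[OF p j])
  also have "\<dots> = mom f (\<pi> j)"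
    unfolding mom_def using f by (intro intg_sig[OF _ p, of "\<lambda>x. f x * hb (\<pi> j) x"] continuous_intros)
  finally show ?thesis .
qed

lemma nflux_sig:
  assumes f: "contSG f" and p: "perm3 \<pi>" and j: "j < 3"
  shows "nflux j (bd (\<lambda>x. u (sig \<pi> x))) (\<lambda>x. f (sig \<pi> x)) = nflux (\<pi> j) (bd u) f"
proof -
  have "nflux j a g = 3 * a j - (\<Sum>i<3. a i) + mom g j" for j a g by (simp add: nflux_def sum_less3)
  moreover have "(\<Sum>i<3. bd (\<lambda>x. u (sig \<pi> x)) i) = (\<Sum>i<3. bd u (\<pi> i))"
    by (intro sum.cong) (auto simp: bd_def sig_q)
  moreover have "(\<Sum>i<3. bd u (\<pi> i)) = (\<Sum>i<3. bd u i)" by (rule perm3_sum[OF p])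
  ultimately show ?thesis using mom_sig[OF f p j] by (simp add: bd_def sig_q[OF j])
qed

text \<open>Formal power series solutions \<open>\<Sum>\<^sub>n u\<^sub>n z\<^sup>n\<close> of \<open>\<Delta> u = z u\<close>.\<close>

definition prev :: "(nat \<Rightarrow> real \<times> real \<Rightarrow> real) \<Rightarrow> nat \<Rightarrow> real \<times> real \<Rightarrow> real" where
  "prev u n = (case n of 0 \<Rightarrow> (\<lambda>x. 0) | Suc m \<Rightarrow> u m)"

lemma prev_simps [simp]: "prev u 0 = (\<lambda>x. 0)" "prev u (Suc n) = u n"
  by (simp_all add: prev_def)

definition eigenseq :: "(nat \<Rightarrow> real \<times> real \<Rightarrow> real) \<Rightarrow> bool" where
  "eigenseq u \<longleftrightarrow> (\<forall>n. sol (u n) (prev u n))"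

lemma eigenseq_0: "eigenseq u \<Longrightarrow> sol (u 0) (\<lambda>x. 0)"
  unfolding eigenseq_def by (drule spec[of _ 0]) simp

lemma eigenseq_Suc: "eigenseq u \<Longrightarrow> sol (u (Suc n)) (u n)"
  unfolding eigenseq_def by (drule spec[of _ "Suc n"]) simp

definition vfps :: "(nat \<Rightarrow> real \<times> real \<Rightarrow> real) \<Rightarrow> nat \<Rightarrow> real fps" where
  "vfps u j = Abs_fps (\<lambda>n. u n (q j))"

definition ffps :: "(nat \<Rightarrow> real \<times> real \<Rightarrow> real) \<Rightarrow> nat \<Rightarrow> real fps" where
  "ffps u j = Abs_fps (\<lambda>n. nflux j (bd (u n)) (prev u n))"

text \<open>The formal solution of \<open>\<Delta> u = z u\<close> whose boundary value is the
  constant series 1 at \<open>q j\<close> and 0 at the two other corners.\<close>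

fun phi :: "nat \<Rightarrow> nat \<Rightarrow> real \<times> real \<Rightarrow> real" where
  "phi j 0 = hb j"
| "phi j (Suc n) = poisson (\<lambda>_. 0) (phi j n)"

lemma phi_cont: "contSG (phi j n)"
  by (induction n) (auto intro: hb_cont poisson_cont)

lemma eigenseq_phi: "eigenseq (phi j)"
  unfolding eigenseq_def
proof
  fix n show "sol (phi j n) (prev (phi j) n)"
    by (cases n) (simp_all add: sol_hb sol_poisson phi_cont)
qed

lemma phi_q: "i < 3 \<Longrightarrow> phi j n (q i) = of_bool (n = 0 \<and> i = j)"
  by (cases n) (simp_all add: hb_q poisson_q phi_cont)

lemma eigenseq_cont: "eigenseq u \<Longrightarrow> contSG (u n)" "eigenseq u \<Longrightarrow> contSG (prev u n)"
  unfolding eigenseq_def using sol_cont by blast+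

lemma sol_0: "sol (\<lambda>x. 0) (\<lambda>x. 0)"
  using sol_linear[OF sol_hb[of 0] sol_hb[of 0], of "-1"] by simp

lemma sol_sum:
  assumes "finite I" "\<And>i. i \<in> I \<Longrightarrow> sol (u i) (f i)"
  shows "sol (\<lambda>x. \<Sum>i\<in>I. c i * u i x) (\<lambda>x. \<Sum>i\<in>I. c i * f i x)"
  using assms
proof (induction I)
  case empty
  show ?case using sol_0 by simp
next
  case (insert i I)
  have "sol (\<lambda>x. (\<Sum>i\<in>I. c i * u i x) + c i * u i x) (\<lambda>x. (\<Sum>i\<in>I. c i * f i x) + c i * f i x)"
    using insert by (intro sol_linear) auto
  thus ?case using insert by (simp add: add.commute)
qed

lemma nflux_sum:
  assumes "finite I" "\<And>i. i \<in> I \<Longrightarrow> contSG (f i)"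
  shows "nflux j (\<lambda>k. \<Sum>i\<in>I. c i * a i k) (\<lambda>x. \<Sum>i\<in>I. c i * f i x) = (\<Sum>i\<in>I. c i * nflux j (a i) (f i))"
  using assms
proof (induction I)
  case empty
  show ?case by (simp add: nflux_def)
next
  case (insert i I)
  have "nflux j (\<lambda>k. (\<Sum>i\<in>I. c i * a i k) + c i * a i k) (\<lambda>x. (\<Sum>i\<in>I. c i * f i x) + c i * f i x)
      = nflux j (\<lambda>k. \<Sum>i\<in>I. c i * a i k) (\<lambda>x. \<Sum>i\<in>I. c i * f i x) + c i * nflux j (a i) (f i)"
    using insert by (intro nflux_linear continuous_on_sum continuous_on_mult) auto
  thus ?case using insert by (simp add: add.commute)
qed

lemma sum_shift:
  "(\<Sum>l\<le>Suc m. c l * prev g (Suc m - l) x) = (\<Sum>l\<le>m. c l * g (m - l) x)"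
proof -
  have "(\<Sum>l\<le>m. c l * prev g (Suc m - l) x) = (\<Sum>l\<le>m. c l * g (m - l) x)"
    by (intro sum.cong refl) (simp add: Suc_diff_le)
  thus ?thesis by simp
qed

lemma sum_pairs:
  "(\<Sum>p\<in>A \<times> B. g (fst p) (snd p)) = (\<Sum>j\<in>A. \<Sum>l\<in>B. g j l)"
  for g :: "_ \<Rightarrow> _ \<Rightarrow> 'a::comm_monoid_add"
  by (simp add: sum.cartesian_product case_prod_beta)

text \<open>Superposition: a formal solution is the combination of the \<open>phi j\<close> with its
  own boundary series as coefficients, the sum over \<open>l\<close> being the Cauchy product.
  Uniqueness of the Dirichlet problem is applied coefficient by coefficient.\<close>

lemma eigenseq_representation:
  assumes u: "eigenseq u" and x: "x \<in> SG"
  shows "u n x = (\<Sum>(j, l)\<in>{..<3} \<times> {..n}. u l (q j) * phi j (n - l) x)"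
  using x
proof (induction n arbitrary: x)
  have S: "sol (\<lambda>x. \<Sum>p\<in>{..<3} \<times> {..n}. u (snd p) (q (fst p)) * phi (fst p) (n - snd p) x)
     (\<lambda>x. \<Sum>p\<in>{..<3} \<times> {..n}. u (snd p) (q (fst p)) * prev (phi (fst p)) (n - snd p) x)" for n
    using eigenseq_phi unfolding eigenseq_def by (intro sol_sum) auto
  have B: "(\<Sum>(j, l)\<in>{..<3} \<times> {..n}. u l (q j) * phi j (n - l) (q i)) = u n (q i)" if i: "i < 3" for i n
  proof -
    have "(\<Sum>(j, l)\<in>{..<3} \<times> {..n}. u l (q j) * phi j (n - l) (q i)) =
      (\<Sum>p\<in>{..<3} \<times> {..n}. if p = (i, n) then u n (q i) else 0)"
      using i by (intro sum.cong refl) (auto simp: phi_q)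
    thus ?thesis using i by simp
  qed
  {
    case 0
    show ?case
    proof (rule sol_unique[OF _ _ _ _ 0])
      show "sol (u 0) (\<lambda>x. 0)" by (rule eigenseq_0[OF u])
      show "sol (\<lambda>x. \<Sum>(j, l)\<in>{..<3} \<times> {..0}. u l (q j) * phi j (0 - l) x) (\<lambda>x. 0)"
        using S[of 0] by (simp add: case_prod_beta)
      show "u 0 (q i) = (\<Sum>(j, l)\<in>{..<3} \<times> {..0}. u l (q j) * phi j (0 - l) (q i))" if "i < 3" for i
        using B[OF that, of 0] by simp
    qed simp
  next
    case (Suc n)
    show ?case
    proof (rule sol_unique[OF _ _ _ _ Suc.prems])
      show "sol (u (Suc n)) (u n)" by (rule eigenseq_Suc[OF u])
      show "sol (\<lambda>x. \<Sum>(j, l)\<in>{..<3} \<times> {..Suc n}. u l (q j) * phi j (Suc n - l) x)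
         (\<lambda>x. \<Sum>p\<in>{..<3} \<times> {..Suc n}. u (snd p) (q (fst p)) * prev (phi (fst p)) (Suc n - snd p) x)"
        using S[of "Suc n"] by (simp add: case_prod_beta)
      show "u (Suc n) (q i) = (\<Sum>(j, l)\<in>{..<3} \<times> {..Suc n}. u l (q j) * phi j (Suc n - l) (q i))" if "i < 3" for i
        using B[OF that, of "Suc n"] by simp
      show "u n x = (\<Sum>p\<in>{..<3} \<times> {..Suc n}. u (snd p) (q (fst p)) * prev (phi (fst p)) (Suc n - snd p) x)"
        if "x \<in> SG" for x
      proof -
        have "(\<Sum>p\<in>{..<3} \<times> {..Suc n}. u (snd p) (q (fst p)) * prev (phi (fst p)) (Suc n - snd p) x)
          = (\<Sum>j<3. \<Sum>l\<le>Suc n. u l (q j) * prev (phi j) (Suc n - l) x)"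
          by (rule sum_pairs)
        also have "\<dots> = (\<Sum>j<3. \<Sum>l\<le>n. u l (q j) * phi j (n - l) x)"
          unfolding sum_shift ..
        also have "\<dots> = u n x" unfolding Suc.IH[OF that] by (simp add: sum.cartesian_product)
        finally show ?thesis by simp
      qed
    qed
  }
qed

lemma ffps_representation:
  assumes u: "eigenseq u" and i: "i < 3"
  shows "ffps u i = (\<Sum>j<3. vfps u j * ffps (phi j) i)"
proof (rule fps_ext)
  fix n :: nat
  let ?I = "{..<3} \<times> {..n}"
  have "nflux i (bd (u n)) (prev u n) =
      nflux i (\<lambda>k. \<Sum>p\<in>?I. u (snd p) (q (fst p)) * bd (phi (fst p) (n - snd p)) k)
        (\<lambda>x. \<Sum>p\<in>?I. u (snd p) (q (fst p)) * prev (phi (fst p)) (n - snd p) x)"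
  proof (rule nflux_cong[OF _ _ i])
    fix j assume "j < (3::nat)"
    thus "bd (u n) j = (\<Sum>p\<in>?I. u (snd p) (q (fst p)) * bd (phi (fst p) (n - snd p)) j)"
      using eigenseq_representation[OF u, of "q j" n] by (simp add: bd_def case_prod_beta)
  next
    fix x assume x: "x \<in> SG"
    show "prev u n x = (\<Sum>p\<in>?I. u (snd p) (q (fst p)) * prev (phi (fst p)) (n - snd p) x)"
    proof (cases n)
      case 0
      thus ?thesis by simp
    next
      case (Suc m)
      have "(\<Sum>p\<in>?I. u (snd p) (q (fst p)) * prev (phi (fst p)) (n - snd p) x)
          = (\<Sum>j<3. \<Sum>l\<le>Suc m. u l (q j) * prev (phi j) (Suc m - l) x)"
        unfolding Suc by (rule sum_pairs)
      also have "\<dots> = (\<Sum>j<3. \<Sum>l\<le>m. u l (q j) * phi j (m - l) x)"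
        unfolding sum_shift ..
      also have "\<dots> = u m x" unfolding eigenseq_representation[OF u x, of m] by (simp add: sum.cartesian_product)
      finally show ?thesis using Suc by simp
    qed
  qed
  also have "\<dots> = (\<Sum>p\<in>?I. u (snd p) (q (fst p)) * nflux i (bd (phi (fst p) (n - snd p))) (prev (phi (fst p)) (n - snd p)))"
    by (rule nflux_sum) (auto intro: eigenseq_cont eigenseq_phi)
  also have "\<dots> = (\<Sum>j<3. \<Sum>l\<le>n. u l (q j) * nflux i (bd (phi j (n - l))) (prev (phi j) (n - l)))"
    by (rule sum_pairs)
  finally show "fps_nth (ffps u i) n = fps_nth (\<Sum>j<3. vfps u j * ffps (phi j) i) n"
    by (simp add: ffps_def vfps_def fps_sum_nth fps_mult_nth atMost_atLeast0)
qed

lemma phi_sig: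
  assumes p: "perm3 \<pi>" and j: "j < 3" and x: "x \<in> SG"
  shows "phi (\<pi> j) n (sig \<pi> x) = phi j n x"
  using x
proof (induction n arbitrary: x)
  case 0
  thus ?case using hb_sig[OF p j] by simp
next
  case (Suc n)
  show ?case
  proof (rule sol_unique[OF sol_sig[OF _ p] _ _ _ Suc.prems])
    show "sol (phi (\<pi> j) (Suc n)) (phi (\<pi> j) n)" "sol (phi j (Suc n)) (phi j n)"
      by (simp_all add: sol_poisson phi_cont)
    show "phi (\<pi> j) (Suc n) (sig \<pi> (q i)) = phi j (Suc n) (q i)" if "i < 3" for i
      unfolding sig_q[OF that] phi_q[OF that] phi_q[OF perm3_less[OF p that]] by simp
  qed (rule Suc.IH)
qed

lemma ffps_phi_sig:
  assumes p: "perm3 \<pi>" and i: "i < 3" and j: "j < 3"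
  shows "ffps (phi (\<pi> j)) (\<pi> i) = ffps (phi j) i"
proof (rule fps_ext)
  fix n
  have "nflux i (bd (phi j n)) (prev (phi j) n) =
    nflux i (bd (\<lambda>x. phi (\<pi> j) n (sig \<pi> x))) (\<lambda>x. prev (phi (\<pi> j)) n (sig \<pi> x))"
    by (rule nflux_cong[OF _ _ i]) (auto simp: bd_def phi_sig[OF p j] prev_def split: nat.split)
  also have "\<dots> = nflux (\<pi> i) (bd (phi (\<pi> j) n)) (prev (phi (\<pi> j)) n)"
    by (rule nflux_sig[OF eigenseq_cont(2)[OF eigenseq_phi] p i])
  finally show "fps_nth (ffps (phi (\<pi> j)) (\<pi> i)) n = fps_nth (ffps (phi j) i) n" by (simp add: ffps_def)
qed

text \<open>The Dirichlet-to-Neumann map: the flux at a vertex is \<open>A\<close> times the value there minus \<open>B\<close> times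
  the sum of the values at the two other vertices.\<close>

definition fpsA :: "real fps" where "fpsA = ffps (phi 0) 0"
definition fpsB :: "real fps" where "fpsB = - ffps (phi 0) 1"

lemma perm3I: "(\<And>i. i < 3 \<Longrightarrow> \<pi> i < 3) \<Longrightarrow> \<pi> 0 \<noteq> \<pi> 1 \<Longrightarrow> \<pi> 0 \<noteq> \<pi> 2 \<Longrightarrow> \<pi> 1 \<noteq> \<pi> 2 \<Longrightarrow> perm3 \<pi>"
proof -
  assume *: "\<And>i. i < 3 \<Longrightarrow> \<pi> i < 3" "\<pi> 0 \<noteq> \<pi> 1" "\<pi> 0 \<noteq> \<pi> 2" "\<pi> 1 \<noteq> \<pi> 2"
  have "inj_on \<pi> {..<3}"
  proof (rule inj_onI)
    fix i j assume "i \<in> {..<3}" "j \<in> {..<3}" "\<pi> i = \<pi> j"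
    thus "i = j" using *(2-4) by (auto elim!: less3_cases)
  qed
  moreover have "\<pi> ` {..<3} \<subseteq> {..<3}" using *(1) by auto
  ultimately show ?thesis unfolding perm3_def bij_betw_def using endo_inj_surj[of "{..<3}" \<pi>] by blast
qed

text \<open>The symmetries act transitively on the corners and on the ordered pairs of different
  corners, so the 3 by 3 matrix of fluxes has only two different entries.\<close>

lemma ffps_phi:
  assumes i: "i < 3" and j: "j < 3"
  shows "ffps (phi j) i = (if i = j then fpsA else - fpsB)"
proof (cases "i = j")
  case True
  define \<pi> where "\<pi> k = (if k = 0 then j else if k = j then 0 else k)" for k
  have "perm3 \<pi>" using j by (intro perm3I) (auto simp: \<pi>_def)
  from ffps_phi_sig[OF this, of 0 0] show ?thesis using True by (simp add: \<pi>_def fpsA_def)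
next
  case False
  define \<pi> where "\<pi> k = (if k = 0 then j else if k = 1 then i else 3 - i - j)" for k :: nat
  have "j \<noteq> 3 - i - j" "i \<noteq> 3 - i - j" using i j False by presburger+
  hence "perm3 \<pi>" using i j False by (intro perm3I) (auto simp: \<pi>_def)
  from ffps_phi_sig[OF this, of 1 0] show ?thesis using False by (simp add: \<pi>_def fpsB_def)
qed

lemma ffps_eq:
  assumes u: "eigenseq u"
  shows "ffps u 0 = fpsA * vfps u 0 - fpsB * (vfps u 1 + vfps u 2)"
    "ffps u 1 = fpsA * vfps u 1 - fpsB * (vfps u 0 + vfps u 2)"
    "ffps u 2 = fpsA * vfps u 2 - fpsB * (vfps u 0 + vfps u 1)"
  using ffps_representation[OF u, of 0] ffps_representation[OF u, of 1] ffps_representation[OF u, of 2]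
  by (simp_all add: sum_less3 ffps_phi algebra_simps)

section \<open>Restriction to cells as the dilation of \<open>z\<close> by 5\<close>

definition dil :: "real fps \<Rightarrow> real fps" where
  "dil f = f oo (fps_const 5 * fps_X)"

lemma dil_nth: "fps_nth (dil f) n = 5 ^ n * fps_nth f n"
  unfolding dil_def by (simp add: fps_compose_linear)

lemma dil_mult: "dil (f * g) = dil f * dil g"
  unfolding dil_def by (rule fps_compose_mult_distrib) simp

text \<open>Restriction to a cell divides the Laplacian by 5, and the factor \<open>5 ^ n\<close>
  restores the equation \<open>\<Delta> u = z u\<close>. In exchange the boundary series at the
  corner \<open>q i\<close> is dilated.\<close>

definition cellseq :: "(nat \<Rightarrow> real \<times> real \<Rightarrow> real) \<Rightarrow> nat \<Rightarrow> nat \<Rightarrow> real \<times> real \<Rightarrow> real" where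
  "cellseq u i n x = 5 ^ n * u n (F i x)"

lemma sol_cmult: "sol u f \<Longrightarrow> sol (\<lambda>x. c * u x) (\<lambda>x. c * f x)"
  using sol_linear[OF sol_0, of u f c] by simp

lemma prev_cellseq: "prev (cellseq u i) n x = 5 ^ n * (prev u n (F i x) / 5)"
  by (cases n) (simp_all add: cellseq_def)

lemma eigenseq_cellseq: "eigenseq u \<Longrightarrow> i < 3 \<Longrightarrow> eigenseq (cellseq u i)"
  unfolding eigenseq_def
proof
  fix n assume u: "\<forall>n. sol (u n) (prev u n)" and i: "i < 3"
  have "sol (\<lambda>x. 5 ^ n * u n (F i x)) (\<lambda>x. 5 ^ n * (prev u n (F i x) / 5))"
    using u by (intro sol_cmult sol_F i) blast
  thus "sol (cellseq u i n) (prev (cellseq u i) n)"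
    by (rule sol_cong) (simp_all add: cellseq_def prev_cellseq)
qed

lemma nflux_cmult: "nflux i (\<lambda>j. c * a j) (\<lambda>x. c * f x) = c * nflux i a f"
  by (simp add: nflux_def mom_cmult algebra_simps)

lemma ffps_junction:
  assumes u: "eigenseq u" and i: "i < 3" "j < 3" "i \<noteq> j"
  shows "ffps (cellseq u i) j + ffps (cellseq u j) i = 0"
proof (rule fps_ext)
  fix n
  have s: "sol (u n) (prev u n)" using u unfolding eigenseq_def by blast
  have *: "nflux j (bd (cellseq u i n)) (prev (cellseq u i) n) =
     5 ^ n * nflux j (poisson_step i (bd (u n)) (prev u n)) (\<lambda>x. prev u n (F i x) / 5)" if "i < 3" "j < 3" for i j
  proof -
    have "nflux j (bd (cellseq u i n)) (prev (cellseq u i) n) =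
      nflux j (\<lambda>k. 5 ^ n * poisson_step i (bd (u n)) (prev u n) k) (\<lambda>x. 5 ^ n * (prev u n (F i x) / 5))"
      by (rule nflux_cong[OF _ _ that(2)]) (use bd_F[OF s that(1)] in \<open>auto simp: prev_cellseq cellseq_def bd_def\<close>)
    thus ?thesis unfolding nflux_cmult .
  qed
  have "5 ^ n * nflux j (poisson_step i (bd (u n)) (prev u n)) (\<lambda>x. prev u n (F i x) / 5) +
    5 ^ n * nflux i (poisson_step j (bd (u n)) (prev u n)) (\<lambda>x. prev u n (F j x) / 5) = 0"
    using nflux_junction[OF sol_cont(2)[OF s] i, of "bd (u n)"] by (simp flip: distrib_left)
  thus "fps_nth (ffps (cellseq u i) j + ffps (cellseq u j) i) n = fps_nth 0 n"
    using *[OF i(1,2)] *[OF i(2,1)] by (simp add: ffps_def)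
qed

lemma vfps_cellseq_self: "vfps (cellseq u i) i = dil (vfps u i)"
  by (rule fps_ext) (simp add: vfps_def cellseq_def dil_nth)

lemma vfps_cellseq_swap: "vfps (cellseq u i) j = vfps (cellseq u j) i"
  unfolding vfps_def cellseq_def by (simp add: F_q_swap[of i j])

lemma fpsB_nonzero: "fpsB \<noteq> 0"
proof -
  have "fps_nth fpsB 0 = 1" by (simp add: fpsB_def ffps_def nflux_def bd_def hb_q hb_q[of 1, simplified])
  thus ?thesis by auto
qed

text \<open>Flux balance at the midpoints of the edges; \<open>Y k\<close> is the dilated value at the
  midpoint opposite to \<open>q k\<close>.\<close>

lemma midpoint_equations:
  assumes u: "eigenseq u"
  defines "Y0 \<equiv> vfps (cellseq u 1) 2" and "Y1 \<equiv> vfps (cellseq u 0) 2" and "Y2 \<equiv> vfps (cellseq u 0) 1"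
  shows "2 * fpsA * Y2 = fpsB * (dil (vfps u 0) + dil (vfps u 1) + Y0 + Y1)"
    "2 * fpsA * Y0 = fpsB * (dil (vfps u 1) + dil (vfps u 2) + Y1 + Y2)"
proof -
  have s: "vfps (cellseq u 2) 1 = Y0" "vfps (cellseq u 2) 0 = Y1" "vfps (cellseq u 1) 0 = Y2"
    unfolding Y0_def Y1_def Y2_def by (rule vfps_cellseq_swap)+
  have e: "eigenseq (cellseq u 0)" "eigenseq (cellseq u 1)" "eigenseq (cellseq u 2)"
    using eigenseq_cellseq[OF u] by simp_all
  note f = ffps_eq[OF e(1)] ffps_eq[OF e(2)] ffps_eq[OF e(3)]
  note f' = f[unfolded vfps_cellseq_self s Y0_def[symmetric] Y1_def[symmetric] Y2_def[symmetric]]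
  have "ffps (cellseq u 0) 1 + ffps (cellseq u 1) 0 = 0" "ffps (cellseq u 1) 2 + ffps (cellseq u 2) 1 = 0"
    using ffps_junction[OF u, of 0 1] ffps_junction[OF u, of 1 2] by simp_all
  thus "2 * fpsA * Y2 = fpsB * (dil (vfps u 0) + dil (vfps u 1) + Y0 + Y1)"
    "2 * fpsA * Y0 = fpsB * (dil (vfps u 1) + dil (vfps u 2) + Y1 + Y2)"
    unfolding f' by (simp_all add: algebra_simps mult_2)
qed

section \<open>3-adic valuations\<close>

text \<open>The rationals that are integral at 3, as a set of reals; \<open>unit3\<close> below
  contains those of valuation 0. Other valuations are expressed through explicit powers of 3 and
  factorials as multipliers.\<close>

definition int3 :: "real set" where
  "int3 = {x. \<exists>a b :: int. \<not> 3 dvd b \<and> x = of_int a / of_int b}"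

definition unit3 :: "real set" where
  "unit3 = {x. \<exists>a b :: int. \<not> 3 dvd a \<and> \<not> 3 dvd b \<and> x = of_int a / of_int b}"

lemma prime_3_int: "prime (3::int)" by simp

lemma not_3_dvd_mult: "\<not> (3::int) dvd a \<Longrightarrow> \<not> 3 dvd b \<Longrightarrow> \<not> 3 dvd a * b"
  using prime_dvd_mult_iff[OF prime_3_int] by blast

lemma int3_of_int [simp]: "of_int a \<in> int3"
  unfolding int3_def by (rule CollectI, rule exI[of _ a], rule exI[of _ 1]) simp

lemma int3_of_nat [simp]: "of_nat a \<in> int3"
  using int3_of_int[of "int a"] by simp

lemma int3_numeral [simp]: "numeral a \<in> int3" "1 \<in> int3" "0 \<in> int3"
  using int3_of_int[of "numeral a"] int3_of_int[of 1] int3_of_int[of 0] by simp_all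

lemma int3_add: "x \<in> int3 \<Longrightarrow> y \<in> int3 \<Longrightarrow> x + y \<in> int3"
proof -
  assume "x \<in> int3" "y \<in> int3"
  then obtain a b c d where *: "\<not> (3::int) dvd b" "x = of_int a / of_int b" "\<not> (3::int) dvd d" "y = of_int c / of_int d"
    unfolding int3_def by blast
  hence "b \<noteq> 0" "d \<noteq> 0" by auto
  hence "x + y = of_int (a * d + c * b) / of_int (b * d)" using * by (simp add: field_simps)
  thus ?thesis unfolding int3_def using not_3_dvd_mult[OF *(1,3)] by blast
qed

lemma int3_mult: "x \<in> int3 \<Longrightarrow> y \<in> int3 \<Longrightarrow> x * y \<in> int3"
proof -
  assume "x \<in> int3" "y \<in> int3"
  then obtain a b c d where *: "\<not> (3::int) dvd b" "x = of_int a / of_int b" "\<not> (3::int) dvd d" "y = of_int c / of_int d"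
    unfolding int3_def by blast
  hence "x * y = of_int (a * c) / of_int (b * d)" by simp
  thus ?thesis unfolding int3_def using not_3_dvd_mult[OF *(1,3)] by blast
qed

lemma int3_sum: "(\<And>i. i \<in> I \<Longrightarrow> f i \<in> int3) \<Longrightarrow> sum f I \<in> int3"
  by (induction I rule: infinite_finite_induct) (auto intro: int3_add)

lemma int3_power: "x \<in> int3 \<Longrightarrow> x ^ n \<in> int3"
  by (induction n) (auto intro: int3_mult)

lemma unit3_int3: "x \<in> unit3 \<Longrightarrow> x \<in> int3"
  unfolding unit3_def int3_def by blast

lemma unit3_of_int: "\<not> 3 dvd a \<Longrightarrow> of_int a \<in> unit3"
  unfolding unit3_def by (rule CollectI, rule exI[of _ a], rule exI[of _ 1]) simp

lemma unit3_mult: "x \<in> unit3 \<Longrightarrow> y \<in> unit3 \<Longrightarrow> x * y \<in> unit3"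
proof -
  assume "x \<in> unit3" "y \<in> unit3"
  then obtain a b c d where *: "\<not> (3::int) dvd b" "x = of_int a / of_int b" "\<not> (3::int) dvd d" "y = of_int c / of_int d"
    "\<not> (3::int) dvd a" "\<not> (3::int) dvd c" unfolding unit3_def by blast
  hence "x * y = of_int (a * c) / of_int (b * d)" by simp
  thus ?thesis unfolding unit3_def using not_3_dvd_mult[OF *(1,3)] not_3_dvd_mult[OF *(5,6)] by blast
qed

lemma unit3_inverse: "x \<in> unit3 \<Longrightarrow> inverse x \<in> unit3"
proof -
  assume "x \<in> unit3"
  then obtain a b where *: "\<not> (3::int) dvd a" "\<not> (3::int) dvd b" "x = of_int a / of_int b"
    unfolding unit3_def by blast
  hence "inverse x = of_int b / of_int a" by simp
  thus ?thesis unfolding unit3_def using *(1,2) by blast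
qed

lemma unit3_divide: "x \<in> unit3 \<Longrightarrow> y \<in> unit3 \<Longrightarrow> x / y \<in> unit3"
  using unit3_mult[OF _ unit3_inverse] by (simp add: divide_inverse)

lemma int3_divide: "x \<in> int3 \<Longrightarrow> y \<in> unit3 \<Longrightarrow> x / y \<in> int3"
  using int3_mult[OF _ unit3_int3[OF unit3_inverse]] by (simp add: divide_inverse)

lemma unit3_nonzero: "x \<in> unit3 \<Longrightarrow> x \<noteq> 0"
  unfolding unit3_def by auto

lemma unit3_add: "x \<in> unit3 \<Longrightarrow> y \<in> int3 \<Longrightarrow> x + 3 * y \<in> unit3"
proof -
  assume "x \<in> unit3" "y \<in> int3"
  then obtain a b c d where *: "\<not> (3::int) dvd b" "x = of_int a / of_int b" "\<not> (3::int) dvd d" "y = of_int c / of_int d"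
    "\<not> (3::int) dvd a" unfolding unit3_def int3_def by blast
  hence "b \<noteq> 0" "d \<noteq> 0" by auto
  hence "x + 3 * y = of_int (a * d + 3 * (c * b)) / of_int (b * d)"
    unfolding *(2,4) by (simp add: field_simps)
  moreover have "\<not> 3 dvd a * d + 3 * (c * b)"
    using not_3_dvd_mult[OF *(5,3)] by (simp add: dvd_add_left_iff)
  ultimately show ?thesis unfolding unit3_def using not_3_dvd_mult[OF *(1,3)] by blast
qed

lemma mod_3_pow_25: "(25::int) ^ m mod 3 = 1"
  by (induction m) (auto simp: mod_mult_right_eq[of _ "25 ^ _", symmetric])

text \<open>The 3-adic valuation of \<open>25 ^ m - 1\<close> is one more than that of
  \<open>m\<close>. If 3 divides \<open>m\<close>, the factorization of \<open>x ^ 3 - 1\<close>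
  passes to a third of the exponent and gains exactly one factor 3. Otherwise the geometric sum is
  congruent to \<open>m\<close> mod 3, and the factor 24 contributes a single 3.\<close>

lemma pow_25_minus_1:
  assumes "m > 0"
  shows "(25 ^ m - 1) / (3 * real m) \<in> unit3"
  using assms
proof (induction m rule: less_induct)
  case (less m)
  show ?case
  proof (cases "3 dvd m")
    case True
    then obtain k where k: "m = 3 * k" by blast
    hence k0: "k > 0" "k < m" using less.prems by auto
    define x where "x = (25::int) ^ k"
    obtain y where y: "x = 1 + 3 * y"
      using mod_3_pow_25[of k] unfolding x_def by (metis add.commute mult.commute div_mult_mod_eq)
    have "(25::real) ^ m - 1 = (of_int x - 1) * (of_int x ^ 2 + of_int x + 1)"
      unfolding k x_def by (simp add: power_mult power2_eq_square power3_eq_cube algebra_simps power_commutes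
          power_add[symmetric] mult_2_right numeral_3_eq_3)
    also have "(of_int x ^ 2 + of_int x + 1 :: real) = 3 * of_int (1 + 3 * (y + y ^ 2))"
      unfolding y by (simp add: power2_eq_square algebra_simps)
    finally have e: "(25::real) ^ m - 1 = (25 ^ k - 1) * (3 * of_int (1 + 3 * (y + y ^ 2)))"
      by (simp add: x_def)
    define w :: real where "w = of_int (1 + 3 * (y + y ^ 2))"
    have "(25 ^ m - 1) / (3 * real m) = ((25 ^ k - 1) / (3 * real k)) * of_int (1 + 3 * (y + y ^ 2))"
      unfolding e w_def[symmetric] using k0 by (simp add: k field_simps)
    moreover have "\<not> 3 dvd (1 + 3 * (y + y ^ 2) :: int)" by presburger
    ultimately show ?thesis using unit3_mult[OF less.IH[OF k0(2,1)] unit3_of_int] by metis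
  next
    case False
    define s where "s = (\<Sum>i<m. (25::int) ^ i)"
    have "s mod 3 = int m mod 3"
      unfolding s_def using mod_sum_eq[of "\<lambda>i. (25::int) ^ i" 3 "{..<m}"] mod_3_pow_25 by simp
    hence s: "\<not> 3 dvd s" using False by (metis dvd_eq_mod_eq_0 int_dvd_int_iff of_nat_numeral)
    have "(25::real) ^ m - 1 = 24 * of_int s"
      unfolding s_def using power_diff_1_eq[of "25::real" m] by simp
    hence "(25 ^ m - 1) / (3 * real m) = of_int (8 * s) / of_int (int m)" by simp
    moreover have "\<not> 3 dvd 8 * s" using not_3_dvd_mult[of 8 s] s by simp
    moreover have "\<not> 3 dvd int m" using False by (metis int_dvd_int_iff of_nat_numeral)
    ultimately show ?thesis unfolding unit3_def by blast
  qed
qed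

lemma pow_5_odd_unit3: "odd n \<Longrightarrow> 5 ^ n - 1 \<in> unit3"
proof -
  assume "odd n"
  then obtain k where k: "n = 2 * k + 1" using oddE by blast
  have "(5::int) ^ n - 1 = 5 * 25 ^ k - 1" unfolding k by (simp add: power_mult)
  also have "\<dots> mod 3 = 1" using mod_3_pow_25[of k] by presburger
  finally have "\<not> 3 dvd ((5::int) ^ n - 1)" by (simp add: dvd_eq_mod_eq_0)
  from unit3_of_int[OF this] show ?thesis by simp
qed

lemma fact_quotient_int3:
  assumes "p + s \<le> h"
  shows "fact h / (fact p * fact s) \<in> int3"
proof -
  have "(fact (p + s) :: nat) dvd fact h" using assms by (rule fact_dvd)
  moreover have "fact p * fact s dvd (fact (p + s) :: nat)" by (rule fact_fact_dvd_fact)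
  ultimately have "fact p * fact s dvd (fact h :: nat)" by (rule dvd_trans[rotated])
  then obtain c where "(fact h :: nat) = fact p * fact s * c" by blast
  hence "(fact h :: real) = fact p * fact s * of_nat c" by (metis of_nat_fact of_nat_mult)
  thus ?thesis by simp
qed

text \<open>These are the recurrences that the functional equations below yield for the values at
  \<open>q 1\<close> of the monomials with \<open>k = 1\<close> and \<open>k = 2\<close>.\<close>

locale vertex_recurrences =
  fixes al be :: "nat \<Rightarrow> real"
  assumes al_1: "al 1 = 1/6"
    and al_rec: "j \<ge> 2 \<Longrightarrow> (5 ^ j - 5) * al j = 4 * (\<Sum>l=1..j-1. al l * al (j - l))"
    and be_0: "be 0 = -1/2"
    and be_rec: "n \<ge> 1 \<Longrightarrow> 15 * (5 ^ n - 1) * be n =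
       2 * (\<Sum>l<n. be l * al (n - l) * (3 * 5 ^ (n - l) - 5 ^ (l + 1) + 6))"
begin

text \<open>Unfolded, \<open>al j\<close> consists of products of \<open>j\<close> copies of
  \<open>al 1 = 1/6\<close>, which explains \<open>3 ^ j\<close>. A division by
  \<open>5 ^ (j - 1) - 1\<close> costs a unit for even \<open>j\<close> and \<open>3 * m\<close>
  times a unit for \<open>j = 2 * m + 1\<close>; the factors \<open>3 ^ m\<close> and
  \<open>fact m\<close> pay for these.\<close>

lemma al_int3: "j \<ge> 1 \<Longrightarrow> al j * 3 ^ (j + (j - 1) div 2) * fact ((j - 1) div 2) \<in> int3"
proof (induction j rule: less_induct)
  case (less j)
  show ?case
  proof (cases "j = 1")
    case True
    have e: "al j * 3 ^ (j + (j - 1) div 2) * fact ((j - 1) div 2) = 1 / 2" unfolding True al_1 by simp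
    show ?thesis unfolding e using int3_divide[OF int3_numeral(2) unit3_of_int[of 2]] by simp
  next
    case False
    hence j: "j \<ge> 2" using less.prems by simp
    \<comment> \<open>\<open>h\<close> is the exponent that the products of two factors require,
      since \<open>p + s \<le> h\<close> for every splitting. The exponent \<open>m\<close> of the
      claim is \<open>h\<close> for even \<open>j\<close> and \<open>h + 1\<close> for odd
      \<open>j\<close>.\<close>
    define h where "h = (j - 2) div 2"
    define m where "m = (j - 1) div 2"
    define S where "S = (\<Sum>l=1..j-1. al l * al (j - l)) * (3 ^ (j + h) * fact h)"
    have "S \<in> int3" unfolding S_def sum_distrib_right
    proof (rule int3_sum)
      fix l assume l: "l \<in> {1..j-1}"
      define p s where "p = (l - 1) div 2" "s = (j - l - 1) div 2"
      note ps = this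
      have le: "p + s \<le> h" using l unfolding ps h_def by auto
      define X Y where "X = al l * 3 ^ (l + p) * fact p" "Y = al (j - l) * 3 ^ (j - l + s) * fact s"
      note XY = this
      have "al l * al (j - l) * (3 ^ (j + h) * fact h) = X * Y * 3 ^ (h - p - s) * (fact h / (fact p * fact s))"
      proof -
        have "j + h = (l + p) + (j - l + s) + (h - p - s)" using l le by auto
        hence "(3::real) ^ (j + h) = 3 ^ (l + p) * 3 ^ (j - l + s) * 3 ^ (h - p - s)" by (simp only: power_add)
        thus ?thesis unfolding XY by (simp add: field_simps)
      qed
      moreover have lj: "l < j" "1 \<le> l" "j - l < j" "1 \<le> j - l" using l j by auto
      have "X \<in> int3" unfolding XY ps by (rule less.IH[OF lj(1,2)])
      moreover have "Y \<in> int3" unfolding XY ps by (rule less.IH[OF lj(3,4)])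
      ultimately
      show "al l * al (j - l) * (3 ^ (j + h) * fact h) \<in> int3"
        using le by (simp only:) (intro int3_mult int3_power fact_quotient_int3 int3_numeral; assumption)
    qed
    have "(5::real) ^ j = 5 * 5 ^ (j - 1)" using j by (metis power_eq_if not_numeral_le_zero)
    hence rec: "5 * (5 ^ (j - 1) - 1) * al j * (3 ^ (j + h) * fact h) = 4 * S"
      using al_rec[OF j] unfolding S_def by (simp add: algebra_simps)
    show ?thesis
    proof (cases "even j")
      case True
      hence o: "odd (j - 1)" and m: "m = h" using j unfolding m_def h_def by presburger+
      have u: "5 * (5 ^ (j - 1) - 1) \<in> unit3"
        using unit3_mult[OF unit3_of_int[of 5] pow_5_odd_unit3[OF o]] by simp
      have "al j * (3 ^ (j + m) * fact m) = 4 * S / (5 * (5 ^ (j - 1) - 1))"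
        using rec unit3_nonzero[OF u] unfolding m by (simp add: field_simps)
      moreover have "\<dots> \<in> int3" using u \<open>S \<in> int3\<close> by (intro int3_divide int3_mult int3_numeral)
      ultimately show ?thesis unfolding m_def[symmetric] by (simp add: mult.assoc)
    next
      case False
      hence m: "m = Suc h" "j - 1 = 2 * m" using j unfolding m_def h_def by presburger+
      define u where "u = (25 ^ m - 1) / (3 * real m)"
      have u: "u \<in> unit3" unfolding u_def using m by (intro pow_25_minus_1) simp
      have e: "(5::real) ^ (j - 1) - 1 = 3 * real m * u"
        unfolding m(2) u_def using m(1) by (simp add: power_mult)
      have u5: "5 * u \<in> unit3" using unit3_mult[OF unit3_of_int[of 5] u] by simp
      have "al j * (3 ^ (j + m) * fact m) * (5 * u) = 5 * (3 * real m * u) * al j * (3 ^ (j + h) * fact h)"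
        unfolding m(1) by (simp add: algebra_simps)
      also have "\<dots> = 4 * S" using rec unfolding e .
      finally have "al j * (3 ^ (j + m) * fact m) = 4 * S / (5 * u)"
        using unit3_nonzero[OF u] by (simp add: field_simps)
      moreover have "\<dots> \<in> int3" using u5 \<open>S \<in> int3\<close> by (intro int3_divide int3_mult int3_numeral)
      ultimately show ?thesis unfolding m_def[symmetric] by (simp add: mult.assoc)
    qed
  qed
qed

text \<open>The valuation is exact because a single summand dominates. For \<open>l = n - 1\<close>
  the factor \<open>al 1 = 1/6\<close> brings a 3 into the denominator and the coefficient
  \<open>21 - 5 ^ n\<close> is prime to 3, whereas every other summand retains a spare factor
  3.\<close>

lemma be_unit3: "be n * 3 ^ (2 * n + n div 2) * fact (n div 2) \<in> unit3"
proof (induction n rule: less_induct)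
  case (less n)
  show ?case
  proof (cases "n = 0")
    case True
    thus ?thesis using be_0 unit3_divide[OF unit3_of_int[of "-1"] unit3_of_int[of 2]] by simp
  next
    case False
    define h where "h = (n - 1) div 2"
    define m where "m = n div 2"
    define c where "c l = (3 * 5 ^ (n - l) - 5 ^ (l + 1) + 6 :: real)" for l
    define t where "t l = be l * al (n - l) * c l * (3 ^ (2 * n - 1 + h) * fact h)" for l
    have t_small: "t l / 3 \<in> int3" if l: "l < n - 1" for l
    proof -
      define p s where "p = l div 2" "s = (n - l - 1) div 2"
      note ps = this
      have le: "p + s \<le> h" using l unfolding ps h_def by linarith
      \<comment> \<open>The final \<open>+ 1\<close> is the spare factor 3; it is available because
        \<open>l \<le> n - 2\<close>.\<close>
      have "2 * n - 1 + h = (2 * l + p) + (n - l + s) + (h - p - s) + (n - l - 2) + 1" using l le by linarith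
      hence "(3::real) ^ (2 * n - 1 + h) = 3 ^ (2 * l + p) * 3 ^ (n - l + s) * 3 ^ (h - p - s) * 3 ^ (n - l - 2) * 3"
        by (simp only: power_add power_one_right)
      moreover define X Y where "X = be l * 3 ^ (2 * l + p) * fact p" "Y = al (n - l) * 3 ^ (n - l + s) * fact s"
      ultimately have "t l / 3 = X * Y * 3 ^ (h - p - s) * 3 ^ (n - l - 2) * (fact h / (fact p * fact s)) * c l"
        unfolding t_def by (simp add: field_simps)
      moreover have "c l = of_int (3 * 5 ^ (n - l) - 5 ^ (l + 1) + 6)" unfolding c_def by simp
      hence "c l \<in> int3" by (simp only: int3_of_int)
      moreover have "X \<in> int3" "Y \<in> int3" unfolding X_Y_def ps
        using unit3_int3[OF less.IH[of l]] al_int3[of "n - l"] l by simp_all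
      ultimately show ?thesis
        using le by (simp only:) (intro int3_mult int3_power fact_quotient_int3 int3_numeral; assumption)
    qed
    have t_last: "t (n - 1) \<in> unit3"
    proof -
      have "2 * n - 1 + h = (2 * (n - 1) + h) + 1" using False by linarith
      hence p3: "(3::real) ^ (2 * n - 1 + h) = 3 ^ (2 * (n - 1) + h) * 3" by (simp only: power_add power_one_right)
      have n1: "n - (n - 1) = 1" "n - 1 + 1 = n" using False by auto
      have "c (n - 1) = of_int (21 - 5 ^ n)" unfolding c_def n1 by simp
      moreover have "\<not> 3 dvd (21 - 5 ^ n :: int)"
      proof
        assume "3 dvd (21 - 5 ^ n :: int)"
        hence "3 dvd (5 ^ n :: int)" by presburger
        hence "3 dvd (5 :: int)" using prime_dvd_power prime_3_int by blast
        thus False by simp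
      qed
      ultimately have c: "c (n - 1) \<in> unit3" using unit3_of_int by metis
      define X where "X = be (n - 1) * 3 ^ (2 * (n - 1) + h) * fact h"
      have e: "t (n - 1) = X * (1 / 2) * c (n - 1)" unfolding X_def t_def n1 p3 al_1 by simp
      have "X \<in> unit3" unfolding X_def h_def using less.IH[of "n - 1"] False by simp
      moreover have "1 / 2 \<in> unit3" using unit3_divide[OF unit3_of_int[of 1] unit3_of_int[of 2]] by simp
      ultimately show ?thesis unfolding e using c by (intro unit3_mult)
    qed
    define S where "S = (\<Sum>l<n. be l * al (n - l) * c l) * (3 ^ (2 * n - 1 + h) * fact h)"
    have "S = (\<Sum>l<n. t l)" unfolding S_def t_def by (simp add: sum_distrib_right)
    also have "\<dots> = (\<Sum>l<n-1. t l) + t (n - 1)"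
      using False sum.lessThan_Suc[of t "n - 1"] by simp
    also have "\<dots> = t (n - 1) + 3 * (\<Sum>l<n-1. t l / 3)" by (simp add: sum_divide_distrib[symmetric])
    finally have S_eq: "S = t (n - 1) + 3 * (\<Sum>l<n-1. t l / 3)" .
    have S: "S \<in> unit3" unfolding S_eq by (rule unit3_add[OF t_last int3_sum]) (use t_small in blast)
    have rec: "15 * (5 ^ n - 1) * be n * (3 ^ (2 * n - 1 + h) * fact h) = 2 * S"
      using be_rec[of n] False unfolding S_def c_def by (simp add: algebra_simps)
    have p3: "(3::real) ^ (2 * n + h) = 3 * 3 ^ (2 * n - 1 + h)"
      using False by (metis add_gr_0 gr0I mult_pos_pos power_minus_mult zero_less_numeral mult.commute Nat.add_diff_assoc2 One_nat_def Suc_leI)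
    show ?thesis
    proof (cases "odd n")
      case True
      hence m: "m = h" unfolding m_def h_def by presburger
      have u: "5 * (5 ^ n - 1) \<in> unit3"
        using unit3_mult[OF unit3_of_int[of 5] pow_5_odd_unit3[OF True]] by simp
      have "be n * (3 ^ (2 * n + m) * fact m) * (5 * (5 ^ n - 1)) = 2 * S"
        unfolding m p3 rec[symmetric] by (simp add: algebra_simps)
      hence "be n * (3 ^ (2 * n + m) * fact m) = 2 * S / (5 * (5 ^ n - 1))"
        using unit3_nonzero[OF u] by (simp only: eq_divide_eq) simp
      moreover have "\<dots> \<in> unit3" using unit3_divide[OF unit3_mult[OF unit3_of_int[of 2] S] u] by simp
      ultimately show ?thesis unfolding m_def[symmetric] by (simp add: mult.assoc)
    next
      case even: False
      hence m: "m = Suc h" "n = 2 * m" using False unfolding m_def h_def by presburger+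
      define u where "u = (25 ^ m - 1) / (3 * real m)"
      have u: "u \<in> unit3" unfolding u_def using m by (intro pow_25_minus_1) simp
      have e: "(5::real) ^ n - 1 = 3 * real m * u"
        using m(1) unfolding u_def by (subst m(2)) (simp add: power_mult)
      have u5: "5 * u \<in> unit3" using unit3_mult[OF unit3_of_int[of 5] u] by simp
      have "(3::real) ^ (2 * n + m) = 3 * (3 * 3 ^ (2 * n - 1 + h))" using p3 m(1) by simp
      hence "be n * (3 ^ (2 * n + m) * fact m) * (5 * u) = 15 * (3 * real m * u) * be n * (3 ^ (2 * n - 1 + h) * fact h)"
        unfolding m(1) by (simp add: algebra_simps)
      also have "\<dots> = 2 * S" using rec unfolding e .
      finally have "be n * (3 ^ (2 * n + m) * fact m) = 2 * S / (5 * u)"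
        using unit3_nonzero[OF u] by (simp add: field_simps)
      moreover have "\<dots> \<in> unit3" using unit3_divide[OF unit3_mult[OF unit3_of_int[of 2] S] u5] by simp
      ultimately show ?thesis unfolding m_def[symmetric] by (simp add: mult.assoc)
    qed
  qed
qed

text \<open>The two terms have different 3-adic valuations.\<close>

lemma al_be_nonzero:
  assumes n: "n \<ge> 1"
  shows "al n + be n \<noteq> 0"
proof -
  define h where "h = (n - 1) div 2"
  define m where "m = n div 2"
  have le: "h \<le> m" unfolding h_def m_def by (intro div_le_mono) simp
  have "2 * n + m = (n + h) + (n - 1) + (m - h) + 1" using le n by linarith
  hence p3: "(3::real) ^ (2 * n + m) = 3 ^ (n + h) * 3 ^ (n - 1) * 3 ^ (m - h) * 3"
    by (simp only: power_add power_one_right)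
  define X where "X = al n * 3 ^ (n + h) * fact h"
  define z where "z = X * 3 ^ (n - 1) * 3 ^ (m - h) * (fact m / (fact h * fact 0))"
  have "X \<in> int3" unfolding X_def h_def by (rule al_int3[OF n])
  moreover have "h + 0 \<le> m" using le by simp
  ultimately have z: "z \<in> int3" unfolding z_def
    by (intro int3_mult int3_power fact_quotient_int3 int3_numeral)
  have "al n * (3 ^ (2 * n + m) * fact m) = 3 * z"
    unfolding z_def X_def p3 by (simp add: field_simps)
  hence "(al n + be n) * (3 ^ (2 * n + m) * fact m) = be n * 3 ^ (2 * n + m) * fact m + 3 * z"
    by (simp add: algebra_simps)
  moreover have "\<dots> \<in> unit3" unfolding m_def by (rule unit3_add[OF be_unit3 z])
  ultimately show ?thesis using unit3_nonzero by force
qed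

end

section \<open>Boundary values of the monomials\<close>

lemma eigenseq_mono: "eigenseq (monomial k)"
  unfolding eigenseq_def prev_def using monomial_sol' by blast

section \<open>The reflection that fixes \<open>q 0\<close>, and generating functions of the
  boundary values\<close>

definition swap12 :: "nat \<Rightarrow> nat" where
  "swap12 i = (if i = 1 then 2 else if i = 2 then 1 else i)"

lemma perm3_swap12: "perm3 swap12"
  by (rule perm3I) (auto simp: swap12_def)

lemma sig_swap12_F_pow: "sig swap12 ((F 0 ^^ m) x) = (F 0 ^^ m) (sig swap12 x)"
  by (induction m) (simp_all add: sig_F swap12_def)

text \<open>The reflection multiplies value, normal and tangential derivative at \<open>q 0\<close>
  by 1, 1 and -1. So the reflected monomial and the monomial times the sign have equal Cauchy data
  and, inductively, equal Laplacians.\<close>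

lemma monomial_swap12:
  assumes k: "k \<in> {1, 2, 3}" and x: "x \<in> SG"
  shows "monomial k j (sig swap12 x) = (if k = 3 then - 1 else 1) * monomial k j x"
  using x
proof (induction j arbitrary: x)
  define e :: real where "e = (if k = 3 then - 1 else 1)"
  have step: "monomial k j (sig swap12 x) = e * monomial k j x"
    if x: "x \<in> SG" and IH: "\<And>x. x \<in> SG \<Longrightarrow> prev (monomial k) j (sig swap12 x) = e * prev (monomial k) j x" for j x
  proof -
    let ?d = "\<lambda>x. monomial k j (sig swap12 x) - e * monomial k j x"
    have s: "sol (monomial k j) (prev (monomial k) j)" using eigenseq_mono unfolding eigenseq_def by blast
    have "sol ?d (\<lambda>x. 0)"
      by (rule sol_cong[OF sol_linear[OF sol_sig[OF s perm3_swap12] s, of "- e"]]) (use IH in auto)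
    hence "?d x = 0"
    proof (rule sol_zero_Cauchy_data[OF _ _ _ _ x])
      have s0: "sig swap12 (q 0) = q 0" using sig_q[of 0 swap12] by (simp add: swap12_def)
      have s12: "sig swap12 (q 1) = q 2" "sig swap12 (q 2) = q 1"
        using sig_q[of 1 swap12] sig_q[of 2 swap12] by (simp_all add: swap12_def)
      note C = monomial_Cauchy_data[OF k, of j] monomial_tangential[OF k, of j]
      show "?d (q 0) = 0" unfolding s0 using C(1) by (auto simp: e_def)
      show "has_normal_derivative ?d 0 0"
      proof -
        have "(\<lambda>m. (1 - e) * ((5/3) ^ m * (2 * monomial k j (q 0) - monomial k j ((F 0 ^^ m) (q (0 + 1))) - monomial k j ((F 0 ^^ m) (q (0 + 2))))))
          \<longlonglongrightarrow> (1 - e) * of_bool (j = 0 \<and> k = 2)"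
          using C(2) unfolding has_normal_derivative_def by (intro tendsto_intros)
        moreover have z: "(1 - e) * of_bool (j = 0 \<and> k = 2) = 0" by (simp add: e_def)
        ultimately show ?thesis
          unfolding z unfolding has_normal_derivative_def sig_swap12_F_pow s0 add_0 s12 by (simp add: algebra_simps)
      qed
      show "has_tangential_derivative ?d 0 0"
      proof -
        have "(\<lambda>m. (- 1 - e) * (5 ^ m * (monomial k j ((F 0 ^^ m) (q (0 + 1))) - monomial k j ((F 0 ^^ m) (q (0 + 2))))))
          \<longlonglongrightarrow> (- 1 - e) * of_bool (j = 0 \<and> k = 3)"
          using C(3) unfolding has_tangential_derivative_def by (intro tendsto_intros)
        moreover have z: "(- 1 - e) * of_bool (j = 0 \<and> k = 3) = 0" by (simp add: e_def)
        ultimately show ?thesis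
          unfolding z unfolding has_tangential_derivative_def sig_swap12_F_pow add_0 s12 by (simp add: algebra_simps)
      qed
    qed
    thus ?thesis by simp
  qed
  {
    case 0
    show ?case using step[OF 0, of 0] unfolding e_def by simp
  next
    case (Suc j)
    show ?case using step[OF Suc.prems, of "Suc j"] Suc.IH unfolding e_def by simp
  }
qed

lemma monomial_q2:
  assumes "k \<in> {1, 2, 3}"
  shows "monomial k j (q 2) = (if k = 3 then - 1 else 1) * monomial k j (q 1)"
  using monomial_swap12[OF assms, of "q 1" j] sig_q[of 1 swap12] by (simp add: swap12_def)

lemma vfps_mono_0: "k \<in> {1, 2, 3} \<Longrightarrow> vfps (monomial k) 0 = (if k = 1 then 1 else 0)"
  by (rule fps_ext) (auto simp: vfps_def monomial_Cauchy_data(1))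

lemma vfps_mono_2: "k \<in> {1, 2, 3} \<Longrightarrow> vfps (monomial k) 2 = (if k = 3 then - vfps (monomial k) 1 else vfps (monomial k) 1)"
  by (rule fps_ext) (auto simp: vfps_def monomial_q2)

lemma ffps_mono_0: "k \<in> {1, 2, 3} \<Longrightarrow> ffps (monomial k) 0 = (if k = 2 then 1 else 0)"
proof (rule fps_ext)
  fix n assume "k \<in> {1, 2, 3}"
  thus "fps_nth (ffps (monomial k) 0) n = fps_nth (if k = 2 then 1 else 0) n"
    using monomial_nflux[of k] by (cases n) (auto simp: ffps_def)
qed

text \<open>The power of 5 in \<open>monomial_scale\<close> is exactly the one that
  \<open>cellseq\<close> removes. So on the cell at \<open>q 0\<close> the series are multiplied by
  a constant instead of being dilated, and comparing both descriptions gives functional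
  equations.\<close>

lemma vfps_cellseq_mono:
  assumes "k \<in> {1, 2, 3}" "j < 3"
  shows "vfps (cellseq (monomial k) 0) j = fps_const (monomial_scale k 0) * vfps (monomial k) j"
proof (rule fps_ext)
  fix n
  have "5 ^ n * monomial k n (F 0 (q j)) = 5 ^ n * monomial_scale k n * monomial k n (q j)"
    using monomial_scaling[OF assms(1), of "q j" n] assms(2) by simp
  also have "5 ^ n * monomial_scale k n = monomial_scale k 0" by (simp add: monomial_scale_def)
  finally show "fps_nth (vfps (cellseq (monomial k) 0) j) n = fps_nth (fps_const (monomial_scale k 0) * vfps (monomial k) j) n"
    by (simp add: vfps_def cellseq_def)
qed

text \<open>The generating functions of the usual \<open>\<alpha>\<^sub>j = P\<^sub>j\<^sub>,\<^sub>1(q\<^sub>1)\<close>, \<open>\<beta>\<^sub>j = P\<^sub>j\<^sub>,\<^sub>2(q\<^sub>1)\<close>, \<open>\<gamma>\<^sub>j = P\<^sub>j\<^sub>,\<^sub>3(q\<^sub>1)\<close>, and of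
  the normal derivatives of \<open>P\<^sub>j\<^sub>,\<^sub>1\<close> at \<open>q\<^sub>1\<close>.\<close>

definition alfps :: "real fps" where "alfps = vfps (monomial 1) 1"
definition befps :: "real fps" where "befps = vfps (monomial 2) 1"
definition gafps :: "real fps" where "gafps = vfps (monomial 3) 1"
definition etfps :: "real fps" where "etfps = ffps (monomial 1) 1"

lemma dil_add: "dil (f + g) = dil f + dil g"
  by (rule fps_ext) (simp add: dil_nth algebra_simps)

lemma dil_minus: "dil (- f) = - dil f"
  by (rule fps_ext) (simp add: dil_nth)

lemma dil_0_1 [simp]: "dil 0 = 0" "dil 1 = 1"
  by (rule fps_ext; simp add: dil_nth)+

lemma dil_numeral [simp]: "dil (numeral k) = numeral k"
  by (rule fps_ext) (simp add: dil_nth numeral_fps_const)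

lemma vfps_mono_1:
  "vfps (monomial 1) 0 = 1" "vfps (monomial 1) 1 = alfps" "vfps (monomial 1) 2 = alfps" "ffps (monomial 1) 0 = 0"
  using vfps_mono_0[of 1] vfps_mono_2[of 1] ffps_mono_0[of 1] unfolding alfps_def by simp_all

lemma vfps_mono_2':
  "vfps (monomial 2) 0 = 0" "vfps (monomial 2) 1 = befps" "vfps (monomial 2) 2 = befps" "ffps (monomial 2) 0 = 1"
  using vfps_mono_0[of 2] vfps_mono_2[of 2] ffps_mono_0[of 2] unfolding befps_def by simp_all

lemma vfps_mono_3:
  "vfps (monomial 3) 0 = 0" "vfps (monomial 3) 1 = gafps" "vfps (monomial 3) 2 = - gafps"
  using vfps_mono_0[of 3] vfps_mono_2[of 3] unfolding gafps_def by simp_all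

lemmas ffps_mono_1 = ffps_eq[OF eigenseq_mono[of 1], unfolded vfps_mono_1]
lemmas ffps_mono_2 = ffps_eq[OF eigenseq_mono[of 2], unfolded vfps_mono_2']
lemmas ffps_mono_3 = ffps_eq[OF eigenseq_mono[of 3], unfolded vfps_mono_3]

text \<open>The flux series of the monomials with \<open>k = 1\<close> vanishes at
  \<open>q 0\<close>, where their value series is 1, while it is \<open>alfps\<close> at both other
  corners.\<close>

lemma fpsA_eq: "fpsA = 2 * fpsB * alfps"
  using ffps_mono_1(1) by algebra

lemma fpsB_befps: "2 * fpsB * befps = - 1"
  using ffps_mono_2(1) by algebra

lemma nth_0s: "fps_nth alfps 0 = 1" "fps_nth befps 0 = - 1/2" "fps_nth gafps 0 = 1/2" "fps_nth etfps 0 = 0"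
proof -
  have m: "monomial k 0 (q 1) = monomial_base k 1" for k by (rule monomial_q_0) simp
  have b: "monomial_base 1 1 = 1" "monomial_base 2 1 = - 1/2" "monomial_base 3 1 = 1/2" by (simp_all add: monomial_base_def)
  show "fps_nth alfps 0 = 1" "fps_nth befps 0 = - 1/2" "fps_nth gafps 0 = 1/2"
    unfolding alfps_def befps_def gafps_def vfps_def fps_nth_Abs_fps m b by (rule refl)+
  have o: "monomial 1 0 (q i) = 1" if "i < 3" for i
    unfolding monomial_q_0[OF that] by (simp add: monomial_base_def)
  have "fps_nth etfps 0 = 3 * monomial 1 0 (q 1) - (monomial 1 0 (q 0) + monomial 1 0 (q 1) + monomial 1 0 (q 2)) + mom (\<lambda>x. 0) 1"
    unfolding etfps_def ffps_def nflux_def bd_def fps_nth_Abs_fps prev_simps ..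
  also have "\<dots> = 0" using o[of 0] o[of 1] o[of 2] by (simp only: mom_0)
  finally show "fps_nth etfps 0 = 0" .
qed

lemma nth_numeral_mult: "fps_nth (numeral k * f) n = numeral k * fps_nth f n" for f :: "real fps"
  by (simp only: numeral_fps_const fps_mult_left_const_nth)

lemma fps_nonzeroI: "fps_nth f 0 \<noteq> (0::real) \<Longrightarrow> f \<noteq> 0" by auto

text \<open>Eliminate the value \<open>Y\<close> at the midpoint opposite to \<open>q 0\<close> from
  the two midpoint equations and cancel a factor with nonzero constant term. For the series
  \<open>x = 4 - 4 * alfps\<close>, the eigenvalue of the graph Laplacian, this is spectral
  decimation: \<open>x\<close> dilates to \<open>x * (5 - x)\<close>.\<close>

lemma alfps_dil: "dil alfps = 4 * alfps * alfps - 3 * alfps"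
proof -
  define Y where "Y = vfps (cellseq (monomial 1) 1) 2"
  have c: "vfps (cellseq (monomial 1) 0) 2 = alfps" "vfps (cellseq (monomial 1) 0) 1 = alfps"
    using vfps_cellseq_mono[of 1 2, unfolded vfps_mono_1] vfps_cellseq_mono[of 1 1, unfolded vfps_mono_1]
    by (simp_all add: monomial_scale_def)
  note m = midpoint_equations[OF eigenseq_mono[of 1], unfolded c vfps_mono_1 Y_def[symmetric] fpsA_eq dil_0_1]
  have "fpsB * (4 * alfps * alfps) = fpsB * (1 + dil alfps + Y + alfps)" using m(1) by algebra
  hence 1: "4 * alfps * alfps = 1 + dil alfps + Y + alfps" using fpsB_nonzero by simp
  have "fpsB * (4 * alfps * Y) = fpsB * (dil alfps + dil alfps + alfps + alfps)" using m(2) by algebra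
  hence 2: "4 * alfps * Y = dil alfps + dil alfps + alfps + alfps" using fpsB_nonzero by (metis mult_left_cancel)
  have "(2 + 4 * alfps) * dil alfps = (2 + 4 * alfps) * (4 * alfps * alfps - 3 * alfps)"
    using 1 2 by algebra
  moreover have "2 + 4 * alfps \<noteq> 0" by (rule fps_nonzeroI) (simp add: nth_0s numeral_fps_const)
  ultimately show ?thesis by (metis mult_left_cancel)
qed

lemma befps_dil: "5 * (1 + 2 * alfps) * dil befps = 3 * befps * (2 * dil alfps + 4 * alfps - 1)"
proof -
  define Y where "Y = vfps (cellseq (monomial 2) 1) 2"
  define Z where "Z = fps_const (3/5) * befps"
  have Z: "5 * Z = 3 * befps" unfolding Z_def by (simp add: numeral_fps_const mult.assoc[symmetric])
  have c: "vfps (cellseq (monomial 2) 0) 2 = Z" "vfps (cellseq (monomial 2) 0) 1 = Z"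
    using vfps_cellseq_mono[of 2 2, unfolded vfps_mono_2'] vfps_cellseq_mono[of 2 1, unfolded vfps_mono_2']
    by (simp_all add: monomial_scale_def Z_def)
  note m = midpoint_equations[OF eigenseq_mono[of 2], unfolded c vfps_mono_2' Y_def[symmetric] fpsA_eq dil_0_1]
  have "fpsB * (4 * alfps * Z) = fpsB * (dil befps + Y + Z)" using m(1) by algebra
  hence 1: "4 * alfps * Z = dil befps + Y + Z" using fpsB_nonzero by (metis mult_left_cancel)
  have "fpsB * (4 * alfps * Y) = fpsB * (dil befps + dil befps + Z + Z)" using m(2) by algebra
  hence 2: "4 * alfps * Y = dil befps + dil befps + Z + Z" using fpsB_nonzero by (metis mult_left_cancel)
  have "2 * (5 * (1 + 2 * alfps) * dil befps) = 2 * (3 * befps * (2 * dil alfps + 4 * alfps - 1))"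
    using 1 2 Z alfps_dil by algebra
  moreover have "(2::real fps) \<noteq> 0" by simp
  ultimately show ?thesis by (metis mult_left_cancel)
qed

text \<open>By antisymmetry the value at the midpoint opposite to \<open>q 0\<close> vanishes, so a
  single midpoint equation remains.\<close>

lemma gafps_dil: "5 * dil gafps = (4 * alfps + 1) * gafps"
proof -
  define Y where "Y = vfps (cellseq (monomial 3) 1) 2"
  define Z where "Z = fps_const (1/5) * gafps"
  have Z: "5 * Z = gafps" unfolding Z_def by (simp add: numeral_fps_const mult.assoc[symmetric])
  have c: "vfps (cellseq (monomial 3) 0) 2 = - Z" "vfps (cellseq (monomial 3) 0) 1 = Z"
    using vfps_cellseq_mono[of 3 2, unfolded vfps_mono_3] vfps_cellseq_mono[of 3 1, unfolded vfps_mono_3]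
    by (simp_all add: monomial_scale_def Z_def)
  note m = midpoint_equations[OF eigenseq_mono[of 3], unfolded c vfps_mono_3 Y_def[symmetric] fpsA_eq dil_0_1 dil_minus]
  have "fpsB * (4 * alfps * Y) = 0" using m(2) by algebra
  moreover have "alfps \<noteq> 0" by (rule fps_nonzeroI) (simp add: nth_0s)
  ultimately have Y: "Y = 0" using fpsB_nonzero by simp
  have "fpsB * (4 * alfps * Z) = fpsB * (dil gafps - Z)" using m(1) Y by algebra
  hence "4 * alfps * Z = dil gafps - Z" using fpsB_nonzero by (metis mult_left_cancel)
  thus ?thesis using Z by algebra
qed

lemma etfps_eq: "etfps = fpsB * (2 * alfps + 1) * (alfps - 1)"
  unfolding etfps_def ffps_mono_1(2) fpsA_eq by algebra

lemma befps_etfps: "2 * befps * etfps = - ((2 * alfps + 1) * (alfps - 1))"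
  using etfps_eq fpsB_befps by algebra

text \<open>Dilate \<open>befps_etfps\<close> and eliminate \<open>dil befps\<close> and
  \<open>dil alfps\<close>. The multiplier introduced in the proof is the common factor that this
  leaves; its constant term is not 0.\<close>

lemma etfps_dil: "3 * dil etfps = 5 * etfps * (4 * alfps - 1)"
proof -
  have d: "2 * dil befps * dil etfps = - ((2 * dil alfps + 1) * (dil alfps - 1))"
  proof -
    have "dil (2 * befps * etfps) = dil (- ((2 * alfps + 1) * (alfps + - 1)))" using befps_etfps by simp
    thus ?thesis by (simp only: dil_mult dil_add dil_minus dil_numeral dil_0_1) simp
  qed
  have "(2 * befps * (2 * alfps - 1) * (4 * alfps + 1)) * (3 * dil etfps)
    = (2 * befps * (2 * alfps - 1) * (4 * alfps + 1)) * (5 * etfps * (4 * alfps - 1))"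
  proof -
    have f: "3 * befps * ((2 * alfps - 1) * (4 * alfps + 1)) = 5 * (1 + 2 * alfps) * dil befps"
      using befps_dil alfps_dil by algebra
    have "(2 * befps * (2 * alfps - 1) * (4 * alfps + 1)) * (3 * dil etfps)
      = 2 * dil etfps * (3 * befps * ((2 * alfps - 1) * (4 * alfps + 1)))" by algebra
    also have "\<dots> = 5 * (1 + 2 * alfps) * (2 * dil befps * dil etfps)" unfolding f by algebra
    also have "\<dots> = 5 * (1 + 2 * alfps) * (- ((2 * dil alfps + 1) * (dil alfps - 1)))" unfolding d ..
    also have "\<dots> = 5 * (2 * befps * etfps) * ((2 * alfps - 1) * (4 * alfps + 1) * (4 * alfps - 1))"
      unfolding befps_etfps alfps_dil by algebra
    finally show ?thesis by algebra
  qed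
  moreover have "2 * befps * (2 * alfps - 1) * (4 * alfps + 1) \<noteq> 0"
    by (rule fps_nonzeroI) (simp add: nth_0s numeral_fps_const)
  ultimately show ?thesis by (metis mult_left_cancel)
qed

section \<open>Recurrences for the coefficients\<close>

definition al :: "nat \<Rightarrow> real" where "al n = fps_nth alfps n"
definition be :: "nat \<Rightarrow> real" where "be n = fps_nth befps n"
definition ga :: "nat \<Rightarrow> real" where "ga n = fps_nth gafps n"
definition et :: "nat \<Rightarrow> real" where "et n = fps_nth etfps n"

text \<open>Gauss' theorem: in the sum of the three fluxes the corner values cancel, and the moments
  add up to the integral.\<close>

lemma intg_mono_flux:
  "intg (monomial k n) = fps_nth (ffps (monomial k) 0) (Suc n) + fps_nth (ffps (monomial k) 1) (Suc n) + fps_nth (ffps (monomial k) 2) (Suc n)"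
  using mom_sum[OF monomial_cont[of k n]] by (simp add: ffps_def nflux_def)

lemma monomial_1_0: "x \<in> SG \<Longrightarrow> monomial 1 0 x = 1"
  using harmonic_bounds[of 1 "monomial_base 1" 1 x] by (auto simp: monomial.simps monomial_base_def)

lemma intg_mono_1: "intg (monomial 1 n) = 2 * et (Suc n)"
proof -
  have "ffps (monomial 1) 2 = ffps (monomial 1) 1"
    unfolding ffps_mono_1 ..
  thus ?thesis using intg_mono_flux[of 1 n] ffps_mono_0[of 1] by (simp add: et_def etfps_def)
qed

lemma et_1: "et 1 = 1/2"
  using intg_mono_1[of 0] intg_cong[of "monomial 1 0" "\<lambda>_. 1"] monomial_1_0 by (simp add: intg_const)

text \<open>The quadratic functional equation \<open>alfps_dil\<close> leaves the linear coefficient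
  undetermined. It is fixed by the total mass 1 of the measure, through
  \<open>et 1 = 1/2\<close>.\<close>

lemma al_1: "al 1 = 1/6"
proof -
  have "fps_nth (2 * befps * etfps) 1 = fps_nth (- ((2 * alfps + 1) * (alfps - 1))) 1"
    unfolding befps_etfps ..
  thus ?thesis using nth_0s et_1
    by (simp add: fps_mult_nth_1 numeral_fps_const al_def et_def mult.assoc)
qed

lemma sum_split_last: "(\<Sum>i=0..n. f i) = f n + (\<Sum>i<n. f i)" for f :: "nat \<Rightarrow> real"
  by (simp add: atLeast0AtMost lessThan_Suc_atMost[symmetric])

lemma sum_split_ends:
  fixes f :: "nat \<Rightarrow> real"
  assumes "n \<ge> 1"
  shows "(\<Sum>i=0..n. f i) = f 0 + f n + (\<Sum>i=1..n-1. f i)"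
proof -
  obtain m where m: "n = Suc m" using assms by (cases n) auto
  have "(\<Sum>i=0..n. f i) = f 0 + (\<Sum>i=1..n. f i)" by (simp add: sum.atLeast_Suc_atMost)
  also have "(\<Sum>i=1..n. f i) = (\<Sum>i=1..m. f i) + f n" unfolding m by simp
  finally show ?thesis using m by simp
qed

lemma al_rec:
  assumes "j \<ge> 2"
  shows "(5 ^ j - 5) * al j = 4 * (\<Sum>l=1..j-1. al l * al (j - l))"
proof -
  have "fps_nth (dil alfps) j = fps_nth (4 * alfps * alfps - 3 * alfps) j" unfolding alfps_dil ..
  hence "5 ^ j * al j = 4 * (\<Sum>l=0..j. al l * al (j - l)) - 3 * al j"
    by (simp add: dil_nth nth_numeral_mult mult.assoc fps_mult_nth[of alfps] al_def)
  thus ?thesis using assms nth_0s(1) sum_split_ends[of j "\<lambda>l. al l * al (j - l)"]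
    by (simp add: al_def[of 0] algebra_simps)
qed

lemma be_rec:
  assumes "n \<ge> 1"
  shows "15 * (5 ^ n - 1) * be n = 2 * (\<Sum>l<n. be l * al (n - l) * (3 * 5 ^ (n - l) - 5 ^ (l + 1) + 6))"
proof -
  have "fps_nth (5 * dil befps + 10 * (dil befps * alfps)) n = fps_nth (6 * (befps * dil alfps) + 12 * (befps * alfps) - 3 * befps) n"
    using befps_dil by (intro arg_cong[of _ _ "\<lambda>f. fps_nth f n"]) algebra
  hence "5 * (5 ^ n * be n) + 10 * (\<Sum>l=0..n. 5 ^ l * be l * al (n - l)) =
    6 * (\<Sum>l=0..n. be l * (5 ^ (n - l) * al (n - l))) + 12 * (\<Sum>l=0..n. be l * al (n - l)) - 3 * be n"
    by (simp add: dil_nth nth_numeral_mult fps_mult_nth[of befps] fps_mult_nth[of "dil befps"] al_def be_def)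
  hence "15 * (5 ^ n - 1) * be n = 6 * (\<Sum>l<n. be l * (5 ^ (n - l) * al (n - l))) + 12 * (\<Sum>l<n. be l * al (n - l))
      - 10 * (\<Sum>l<n. 5 ^ l * be l * al (n - l))"
    unfolding sum_split_last using nth_0s(1) by (simp add: al_def[of 0] algebra_simps)
  also have "\<dots> = (\<Sum>l<n. 6 * (be l * (5 ^ (n - l) * al (n - l))) + 12 * (be l * al (n - l)) - 10 * (5 ^ l * be l * al (n - l)))"
    by (simp add: sum_distrib_left sum.distrib sum_subtractf)
  also have "\<dots> = 2 * (\<Sum>l<n. be l * al (n - l) * (3 * 5 ^ (n - l) - 5 ^ (l + 1) + 6))"
    unfolding sum_distrib_left by (intro sum.cong refl) (simp add: algebra_simps)
  finally show ?thesis .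
qed

lemma et_rec:
  assumes "n \<ge> 1"
  shows "3 * (5 ^ n - 5) * et n = 20 * (\<Sum>i=1..n-1. et i * al (n - i))"
proof -
  have "fps_nth (3 * dil etfps) n = fps_nth (20 * (etfps * alfps) - 5 * etfps) n"
    using etfps_dil by (intro arg_cong[of _ _ "\<lambda>f. fps_nth f n"]) algebra
  hence "3 * (5 ^ n * et n) = 20 * (\<Sum>i=0..n. et i * al (n - i)) - 5 * et n"
    by (simp add: dil_nth nth_numeral_mult fps_mult_nth[of etfps] al_def et_def)
  thus ?thesis using sum_split_ends[OF assms, of "\<lambda>i. et i * al (n - i)"] nth_0s(1,4)
    by (simp add: al_def[of 0] et_def[of 0] algebra_simps)
qed

interpretation V: vertex_recurrences al be
proof
  show "al 1 = 1/6" by (rule al_1)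
  show "be 0 = -1/2" using nth_0s by (simp add: be_def)
qed (use al_rec be_rec in auto)

lemma five_pow_gt: "j \<ge> 2 \<Longrightarrow> (5::real) ^ j - 5 > 0"
  using power_strict_increasing[of 1 j "5::real"] by simp

lemma al_pos: "al n > 0"
proof (induction n rule: less_induct)
  case (less n)
  consider "n = 0" | "n = 1" | "n \<ge> 2" by linarith
  thus ?case
  proof cases
    case 3
    have "(\<Sum>l=1..n-1. al l * al (n - l)) > 0"
      using 3 less by (intro sum_pos mult_pos_pos) auto
    hence "(5 ^ n - 5) * al n > 0" using al_rec[OF 3] by simp
    thus ?thesis using five_pow_gt[OF 3] zero_less_mult_pos by blast
  qed (use nth_0s al_1 in \<open>simp_all add: al_def\<close>)
qed

text \<open>Compare the recurrences multiplied by \<open>3 * (5 ^ n - 5)\<close>: that of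
  \<open>et\<close> produces the convolution of \<open>al\<close> with at least
  \<open>20 * 3 = 60\<close>, that of \<open>3 * al\<close> with only
  \<open>9 * 4 = 36\<close>.\<close>

lemma et_al:
  assumes "n \<ge> 1"
  shows "et n \<ge> 3 * al n" "n \<ge> 2 \<Longrightarrow> et n > 3 * al n"
proof -
  have "et n \<ge> 3 * al n \<and> (n \<ge> 2 \<longrightarrow> et n > 3 * al n)"
    using assms
  proof (induction n rule: less_induct)
    case (less n)
    show ?case
    proof (cases "n = 1")
      case True
      thus ?thesis using et_1 al_1 by simp
    next
      case False
      hence n: "n \<ge> 2" using less.prems by simp
      let ?S = "\<Sum>i=1..n-1. al i * al (n - i)"
      have S: "?S > 0" using n by (intro sum_pos mult_pos_pos al_pos) auto
      have "(\<Sum>i=1..n-1. 3 * al i * al (n - i)) \<le> (\<Sum>i=1..n-1. et i * al (n - i))"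
        using less.IH al_pos[THEN less_imp_le] by (intro sum_mono mult_right_mono) auto
      hence "3 * ?S \<le> (\<Sum>i=1..n-1. et i * al (n - i))" by (simp add: sum_distrib_left mult.assoc)
      hence "20 * (3 * ?S) \<le> 3 * (5 ^ n - 5) * et n" using et_rec[of n] n by simp
      moreover have "3 * (5 ^ n - 5) * (3 * al n) = 9 * ((5 ^ n - 5) * al n)" by simp
      hence "3 * (5 ^ n - 5) * (3 * al n) = 36 * ?S" unfolding al_rec[OF n] by simp
      ultimately have "3 * (5 ^ n - 5) * (3 * al n) < 3 * (5 ^ n - 5) * et n" using S by linarith
      hence "3 * al n < et n" using five_pow_gt[OF n] by (simp add: mult_less_cancel_left_pos)
      thus ?thesis by simp
    qed
  qed
  thus "et n \<ge> 3 * al n" "n \<ge> 2 \<Longrightarrow> et n > 3 * al n" by blast+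
qed

text \<open>After an index shift, the linear recurrence from \<open>gafps_dil\<close> is the
  quadratic one of \<open>al\<close> with one of the two factors replaced by
  \<open>ga\<close>.\<close>

lemma ga_eq: "ga n = 3 * al (Suc n)"
proof (induction n rule: less_induct)
  case (less n)
  show ?case
  proof (cases "n = 0")
    case True
    thus ?thesis using nth_0s al_1 by (simp add: ga_def)
  next
    case False
    have "fps_nth (5 * dil gafps) n = fps_nth (4 * (alfps * gafps) + gafps) n"
      using gafps_dil by (intro arg_cong[of _ _ "\<lambda>f. fps_nth f n"]) algebra
    hence "5 * (5 ^ n * ga n) = 4 * (\<Sum>i=0..n. al i * ga (n - i)) + ga n"
      by (simp add: dil_nth nth_numeral_mult fps_mult_nth[of alfps] al_def ga_def)
    moreover have "(\<Sum>i=0..n. al i * ga (n - i)) = ga n + (\<Sum>i=1..n. al i * ga (n - i))"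
      using nth_0s(1) by (simp add: sum.atLeast_Suc_atMost al_def)
    moreover have "(\<Sum>i=1..n. al i * ga (n - i)) = 3 * (\<Sum>i=1..n. al i * al (Suc n - i))"
      unfolding sum_distrib_left using less.IH by (intro sum.cong refl) (auto simp: Suc_diff_le)
    ultimately have "(5 ^ Suc n - 5) * ga n = 3 * (4 * (\<Sum>i=1..n. al i * al (Suc n - i)))"
      by (simp add: algebra_simps)
    also have "\<dots> = 3 * ((5 ^ Suc n - 5) * al (Suc n))" using al_rec[of "Suc n"] False by simp
    finally have "(5 ^ Suc n - 5) * ga n = (5 ^ Suc n - 5) * (3 * al (Suc n))" by simp
    moreover have "(5::real) ^ Suc n - 5 > 0" by (rule five_pow_gt) (use False in simp)
    ultimately show ?thesis by (metis less_irrefl mult_left_cancel)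
  qed
qed

section \<open>Integrals of the monomials against the one of degree 0\<close>

lemma mom_mono:
  assumes "i < 3"
  shows "mom (monomial k n) i = fps_nth (ffps (monomial k) i) (Suc n) - (3 * monomial k (Suc n) (q i)
     - (monomial k (Suc n) (q 0) + monomial k (Suc n) (q 1) + monomial k (Suc n) (q 2)))"
  by (simp add: ffps_def nflux_def bd_def)

lemma intg_mono_mono_0:
  "intg (\<lambda>x. monomial k n x * monomial k 0 x) = (\<Sum>i<3. monomial_base k i * mom (monomial k n) i)"
proof -
  have "intg (\<lambda>x. monomial k n x * monomial k 0 x) = intg (\<lambda>x. \<Sum>i<3. monomial_base k i * (monomial k n x * hb i x))"
    using harmonic_eq_hb by (intro intg_cong) (simp add: sum_less3 algebra_simps monomial.simps(1))
  also have "\<dots> = (\<Sum>i<3. monomial_base k i * mom (monomial k n) i)"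
    using monomial_cont by (subst intg_sum) (auto intro!: continuous_intros simp: intg_cmult mom_def)
  finally show ?thesis .
qed

text \<open>For \<open>k = 1, 3\<close> the integrals are positive; for \<open>k = 2\<close> their sign changes eventually, and
  only 3-adically one sees that they do not vanish.\<close>

lemma intg_mono_mono_0_nonzero:
  assumes k: "k \<in> {1, 2, 3}"
  shows "intg (\<lambda>x. monomial k n x * monomial k 0 x) \<noteq> 0"
proof -
  consider "k = 1" | "k = 2" | "k = 3" using k by auto
  thus ?thesis
  proof cases
    case 1
    have "intg (\<lambda>x. monomial k n x * monomial k 0 x) = intg (monomial 1 n)"
      using monomial_1_0 unfolding 1 by (intro intg_cong) simp
    also have "\<dots> > 0" using intg_mono_1[of n] et_al(1)[of "Suc n"] al_pos[of "Suc n"] by simp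
    finally show ?thesis by simp
  next
    case 2
    have f: "ffps (monomial 2) 2 = ffps (monomial 2) 1"
      unfolding ffps_mono_2 ..
    \<comment> \<open>The flux at \<open>q 1\<close> depends on \<open>alfps\<close> alone because
      \<open>2 * fpsB * befps\<close> is -1; the values \<open>be\<close> enter only through the
      corner terms of the moments.\<close>
    have "2 * ffps (monomial 2) 1 = 1 - 2 * alfps" using ffps_mono_2(2) fpsA_eq fpsB_befps by algebra
    hence "fps_nth (2 * ffps (monomial 2) 1) (Suc n) = fps_nth (1 - 2 * alfps) (Suc n)" by simp
    hence t: "fps_nth (ffps (monomial 2) 1) (Suc n) = - al (Suc n)" by (simp add: numeral_fps_const al_def)
    have b: "monomial 2 (Suc n) (q 1) = be (Suc n)" "monomial 2 (Suc n) (q 2) = be (Suc n)" "monomial 2 (Suc n) (q 0) = 0"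
      using monomial_q2[of 2 "Suc n"] monomial_flux_tload(3)[of 2 n] by (simp_all add: be_def befps_def vfps_def)
    have "mom (monomial 2 n) 1 = - al (Suc n) - be (Suc n)" "mom (monomial 2 n) 2 = - al (Suc n) - be (Suc n)"
      using mom_mono[of 1 2 n] mom_mono[of 2 2 n] unfolding f t b by simp_all
    hence "intg (\<lambda>x. monomial k n x * monomial k 0 x) = al (Suc n) + be (Suc n)"
      unfolding intg_mono_mono_0 2 by (simp add: sum_less3 monomial_base_def)
    thus ?thesis using V.al_be_nonzero[of "Suc n"] by simp
  next
    case 3
    have f: "ffps (monomial 3) 1 = fpsB * (2 * alfps + 1) * gafps" "ffps (monomial 3) 2 = - (fpsB * (2 * alfps + 1) * gafps)"
      unfolding ffps_mono_3 fpsA_eq by algebra+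
    \<comment> \<open>This is \<open>ga_eq\<close> for power series; it turns the flux at
      \<open>q 1\<close> into a shift of \<open>3 * etfps\<close>.\<close>
    have "fps_X * gafps = 3 * (alfps - 1)"
    proof (rule fps_ext)
      fix n show "fps_nth (fps_X * gafps) n = fps_nth (3 * (alfps - 1)) n"
        using ga_eq[of "n - 1"] nth_0s(1) by (cases n) (simp_all add: numeral_fps_const al_def ga_def)
    qed
    hence "fps_X * (fpsB * (2 * alfps + 1) * gafps) = 3 * etfps" using etfps_eq by algebra
    hence "fps_nth (fps_X * (fpsB * (2 * alfps + 1) * gafps)) (Suc (Suc n)) = fps_nth (3 * etfps) (Suc (Suc n))" by simp
    hence t: "fps_nth (fpsB * (2 * alfps + 1) * gafps) (Suc n) = 3 * et (Suc (Suc n))"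
      by (simp add: numeral_fps_const et_def)
    have b: "monomial 3 (Suc n) (q 1) = 3 * al (Suc (Suc n))" "monomial 3 (Suc n) (q 2) = - 3 * al (Suc (Suc n))" "monomial 3 (Suc n) (q 0) = 0"
      using monomial_q2[of 3 "Suc n"] monomial_flux_tload(3)[of 3 n] ga_eq[of "Suc n"]
      by (simp_all add: ga_def gafps_def vfps_def)
    have "mom (monomial 3 n) 1 = 3 * et (Suc (Suc n)) - 9 * al (Suc (Suc n))"
      "mom (monomial 3 n) 2 = - (3 * et (Suc (Suc n)) - 9 * al (Suc (Suc n)))"
      using mom_mono[of 1 3 n] mom_mono[of 2 3 n] unfolding f fps_neg_nth t b by simp_all
    hence "intg (\<lambda>x. monomial k n x * monomial k 0 x) = 3 * (et (Suc (Suc n)) - 3 * al (Suc (Suc n)))"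
      unfolding intg_mono_mono_0 3 by (simp add: sum_less3 monomial_base_def field_simps)
    thus ?thesis using et_al(2)[of "Suc (Suc n)"] by simp
  qed
qed

section \<open>Gram-Schmidt orthogonalization\<close>

text \<open>\<open>S\<close> singles out a space of functions on which \<open>B\<close> is bilinear
  and symmetric, since integrals and Laplacians are total functions without linearity elsewhere.
  \<open>B_monic\<close> expresses that no monic combination degenerates, so all the divisors in
  \<open>monic_orth\<close> are positive.\<close>

locale gram_schmidt =
  fixes B :: "('a \<Rightarrow> real) \<Rightarrow> ('a \<Rightarrow> real) \<Rightarrow> real" and v :: "nat \<Rightarrow> 'a \<Rightarrow> real" and S :: "('a \<Rightarrow> real) \<Rightarrow> bool"
  assumes S_v: "S (v n)"
    and S_add: "S u \<Longrightarrow> S w \<Longrightarrow> S (\<lambda>x. u x + c * w x)"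
    and B_sym: "S u \<Longrightarrow> S w \<Longrightarrow> B u w = B w u"
    and B_add: "S u \<Longrightarrow> S u' \<Longrightarrow> S w \<Longrightarrow> B (\<lambda>x. u x + c * u' x) w = B u w + c * B u' w"
    and B_nonneg: "S u \<Longrightarrow> B u u \<ge> 0"
    and B_monic: "B (\<lambda>x. v n x + (\<Sum>i<n. d i * v i x)) (\<lambda>x. v n x + (\<Sum>i<n. d i * v i x)) \<noteq> 0"
begin

abbreviation "m n \<equiv> monic_orth B v n"

definition spn :: "nat \<Rightarrow> ('a \<Rightarrow> real) \<Rightarrow> bool" where
  "spn n u \<longleftrightarrow> (\<exists>c. u = (\<lambda>x. \<Sum>i<n. c i * v i x))"

lemma spn_add: "spn n u \<Longrightarrow> spn n w \<Longrightarrow> spn n (\<lambda>x. u x + a * w x)"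
proof -
  assume "spn n u" "spn n w"
  then obtain c d where "u = (\<lambda>x. \<Sum>i<n. c i * v i x)" "w = (\<lambda>x. \<Sum>i<n. d i * v i x)"
    unfolding spn_def by blast
  hence "(\<lambda>x. u x + a * w x) = (\<lambda>x. \<Sum>i<n. (c i + a * d i) * v i x)"
    by (simp add: sum.distrib sum_distrib_left algebra_simps)
  thus ?thesis unfolding spn_def by (intro exI[of _ "\<lambda>i. c i + a * d i"])
qed

lemma spn_0: "spn n (\<lambda>x. 0)"
  unfolding spn_def by (rule exI[of _ "\<lambda>_. 0"]) simp

lemma spn_mono: "n \<le> k \<Longrightarrow> spn n u \<Longrightarrow> spn k u"
proof -
  assume n: "n \<le> k" and "spn n u"
  then obtain c where c: "u = (\<lambda>x. \<Sum>i<n. c i * v i x)" unfolding spn_def by blast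
  have "(\<Sum>i<n. c i * v i x) = (\<Sum>i<k. (if i < n then c i else 0) * v i x)" for x
    using n by (intro sum.mono_neutral_cong_left) auto
  thus ?thesis unfolding spn_def c by (intro exI[of _ "\<lambda>i. if i < n then c i else 0"]) simp
qed

lemma spn_v: "i < n \<Longrightarrow> spn n (v i)"
  unfolding spn_def
  by (rule exI[of _ "\<lambda>j. of_bool (j = i)"]) (auto simp: of_bool_def if_distrib[of "\<lambda>c. c * _"] cong: if_cong)

lemma spn_sum: "finite I \<Longrightarrow> (\<And>i. i \<in> I \<Longrightarrow> spn n (u i)) \<Longrightarrow> spn n (\<lambda>x. \<Sum>i\<in>I. c i * u i x)"
proof (induction I rule: finite_induct)
  case (insert i I)
  have "spn n (\<lambda>x. (\<Sum>i\<in>I. c i * u i x) + c i * u i x)" using insert by (intro spn_add) auto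
  thus ?case using insert by (simp add: add.commute)
qed (simp add: spn_0)

lemma S_0: "S (\<lambda>x. 0)"
  using S_add[OF S_v[of 0] S_v[of 0], of "-1"] by simp

lemma S_sum: "finite I \<Longrightarrow> (\<And>i. i \<in> I \<Longrightarrow> S (u i)) \<Longrightarrow> S (\<lambda>x. \<Sum>i\<in>I. c i * u i x)"
proof (induction I rule: finite_induct)
  case (insert i I)
  have "S (\<lambda>x. (\<Sum>i\<in>I. c i * u i x) + c i * u i x)" using insert by (intro S_add) auto
  thus ?case using insert by (simp add: add.commute)
qed (simp add: S_0)

lemma B_0: "S w \<Longrightarrow> B (\<lambda>x. 0) w = 0"
  using B_add[OF S_0 S_0, of w "-1"] by simp

lemma B_sum:
  assumes "finite I" "\<And>i. i \<in> I \<Longrightarrow> S (u i)" "S w"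
  shows "B (\<lambda>x. \<Sum>i\<in>I. c i * u i x) w = (\<Sum>i\<in>I. c i * B (u i) w)"
  using assms
proof (induction I rule: finite_induct)
  case (insert i I)
  have "B (\<lambda>x. (\<Sum>i\<in>I. c i * u i x) + c i * u i x) w = B (\<lambda>x. \<Sum>i\<in>I. c i * u i x) w + c i * B (u i) w"
    using insert by (intro B_add S_sum) auto
  thus ?case using insert by (simp add: add.commute)
qed (simp add: B_0)

lemma spn_S: "spn n u \<Longrightarrow> S u"
  unfolding spn_def using S_sum[of "{..<n}" v] S_v by blast

lemma m_eq: "m n = (\<lambda>x. v n x + (-1) * (\<Sum>i<n. (B (v n) (m i) / B (m i) (m i)) * m i x))"
  by (subst monic_orth.simps) simp

lemma m_monic: "spn n (\<lambda>x. m n x + (-1) * v n x)"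
proof (induction n rule: less_induct)
  case (less n)
  have "spn n (m i)" if "i < n" for i
  proof -
    have "spn (Suc i) (\<lambda>x. (m i x + (-1) * v i x) + 1 * v i x)"
      by (rule spn_add[OF spn_mono[OF _ less[OF that]] spn_v]) auto
    thus ?thesis using spn_mono[of "Suc i" n "m i"] that by simp
  qed
  hence "spn n (\<lambda>x. 0 + (-1) * (\<Sum>i<n. (B (v n) (m i) / B (m i) (m i)) * m i x))"
    by (intro spn_add spn_0 spn_sum) auto
  thus ?case by (subst m_eq) simp
qed

lemma m_monic_obtain: obtains c where "m n = (\<lambda>x. v n x + (\<Sum>i<n. c i * v i x))"
proof -
  obtain c where "(\<lambda>x. m n x + (-1) * v n x) = (\<lambda>x. \<Sum>i<n. c i * v i x)"
    using m_monic unfolding spn_def by blast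
  hence "m n x = v n x + (\<Sum>i<n. c i * v i x)" for x by (simp add: fun_eq_iff algebra_simps)
  thus ?thesis using that by blast
qed

lemma spn_m: "spn (Suc n) (m n)"
proof -
  have "spn (Suc n) (\<lambda>x. (m n x + (-1) * v n x) + 1 * v n x)"
    by (rule spn_add[OF spn_mono[OF _ m_monic] spn_v]) auto
  thus ?thesis by simp
qed

lemma S_m: "S (m n)" using spn_S spn_m by blast

lemma B_m_pos: "B (m n) (m n) > 0"
proof -
  obtain c where "m n = (\<lambda>x. v n x + (\<Sum>i<n. c i * v i x))" using m_monic_obtain .
  hence "B (m n) (m n) \<noteq> 0" using B_monic[of n c] by simp
  thus ?thesis using B_nonneg[OF S_m[of n]] by simp
qed

lemma m_orth: "j < n \<Longrightarrow> B (m n) (m j) = 0"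
proof (induction n arbitrary: j rule: less_induct)
  case (less n)
  have o: "B (m i) (m j) = 0" if "i < n" "i \<noteq> j" for i
    using less.IH[of i j] less.IH[of j i] less.prems that B_sym[OF S_m S_m, of i j]
    by (cases "i < j") auto
  have "B (m n) (m j) = B (v n) (m j) + (-1) * B (\<lambda>x. \<Sum>i<n. (B (v n) (m i) / B (m i) (m i)) * m i x) (m j)"
    by (subst m_eq) (intro B_add S_v S_sum S_m; simp)
  also have "B (\<lambda>x. \<Sum>i<n. (B (v n) (m i) / B (m i) (m i)) * m i x) (m j)
     = (\<Sum>i<n. (B (v n) (m i) / B (m i) (m i)) * B (m i) (m j))"
    by (intro B_sum S_m) simp
  also have "\<dots> = (\<Sum>i<n. if i = j then B (v n) (m j) else 0)"
    using o B_m_pos[of j] by (intro sum.cong refl) auto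
  also have "\<dots> = B (v n) (m j)" using less.prems by (simp add: sum.delta)
  finally show ?case by simp
qed

lemma m_orth_v: "j < n \<Longrightarrow> B (m n) (v j) = 0"
proof (induction j rule: less_induct)
  case (less j)
  obtain c where c: "m j = (\<lambda>x. v j x + (\<Sum>i<j. c i * v i x))" using m_monic_obtain .
  have Ss: "S (\<lambda>x. \<Sum>i<j. c i * v i x)" by (intro S_sum S_v) simp
  have "B (\<lambda>x. \<Sum>i<j. c i * v i x) (m n) = (\<Sum>i<j. c i * B (v i) (m n))" by (intro B_sum S_v S_m) simp
  also have "\<dots> = 0" using less by (intro sum.neutral) (auto simp: B_sym[OF S_v S_m])
  finally have z: "B (\<lambda>x. \<Sum>i<j. c i * v i x) (m n) = 0" .
  have "B (\<lambda>x. v j x + 1 * (\<Sum>i<j. c i * v i x)) (m n) = B (v j) (m n) + 1 * B (\<lambda>x. \<Sum>i<j. c i * v i x) (m n)"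
    by (intro B_add S_v S_m Ss)
  hence "B (m j) (m n) = B (v j) (m n)" using z c by simp
  thus ?case using m_orth[OF less.prems] B_sym[OF S_m S_m] B_sym[OF S_m S_v] by metis
qed

lemma m_orth_spn: "spn n w \<Longrightarrow> B (m n) w = 0"
proof -
  assume "spn n w"
  then obtain c where c: "w = (\<lambda>x. \<Sum>i<n. c i * v i x)" unfolding spn_def by blast
  have "B w (m n) = (\<Sum>i<n. c i * B (v i) (m n))" unfolding c by (intro B_sum S_v S_m) simp
  also have "\<dots> = 0" using m_orth_v by (intro sum.neutral) (auto simp: B_sym[OF S_v S_m])
  finally show ?thesis using B_sym[OF S_m spn_S[OF \<open>spn n w\<close>]] by simp
qed

lemma pythagoras:
  assumes w: "spn n w"
  shows "B (\<lambda>x. m n x + w x) (\<lambda>x. m n x + w x) = B (m n) (m n) + B w w"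
proof -
  note S = S_m[of n] spn_S[OF w]
  have Sm: "S (\<lambda>x. m n x + 1 * w x)" by (intro S_add S)
  have "B (\<lambda>x. m n x + 1 * w x) (\<lambda>x. m n x + 1 * w x)
      = B (m n) (\<lambda>x. m n x + 1 * w x) + 1 * B w (\<lambda>x. m n x + 1 * w x)" by (intro B_add S Sm)
  also have "B (m n) (\<lambda>x. m n x + 1 * w x) = B (m n) (m n) + 1 * B w (m n)"
    unfolding B_sym[OF S(1) Sm] by (intro B_add S)
  also have "B w (\<lambda>x. m n x + 1 * w x) = B (m n) w + 1 * B w w"
    unfolding B_sym[OF S(2) Sm] by (intro B_add S)
  finally show ?thesis using m_orth_spn[OF w] B_sym[OF S] by simp
qed

lemma monic_pythagoras:
  assumes "spn n (\<lambda>x. u x + (-1) * v n x)"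
  shows "spn n (\<lambda>x. u x - m n x)" "B u u = B (m n) (m n) + B (\<lambda>x. u x - m n x) (\<lambda>x. u x - m n x)"
proof -
  have "spn n (\<lambda>x. (u x + (-1) * v n x) + (-1) * (m n x + (-1) * v n x))"
    by (rule spn_add[OF assms m_monic])
  thus s: "spn n (\<lambda>x. u x - m n x)" by simp
  show "B u u = B (m n) (m n) + B (\<lambda>x. u x - m n x) (\<lambda>x. u x - m n x)"
    using pythagoras[OF s] by simp
qed

lemma m_minimal: "spn n (\<lambda>x. u x + (-1) * v n x) \<Longrightarrow> B (m n) (m n) \<le> B u u"
  using monic_pythagoras[of n u] B_nonneg[OF spn_S] by fastforce

text \<open>The combination \<open>u\<close> is the representer of \<open>L\<close> on the span of
  the first \<open>N\<close> polynomials: both \<open>L u\<close> and \<open>B u u\<close> equal the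
  sum \<open>s\<close> in question, so the bound reads \<open>s \<le> C * sqrt s\<close>.\<close>

lemma bessel:
  assumes lin: "\<And>N c. L (\<lambda>x. \<Sum>i<N. c i * m i x) = (\<Sum>i<N. c i * L (m i))"
    and bound: "\<And>u. S u \<Longrightarrow> \<bar>L u\<bar> \<le> C * sqrt (B u u)" and C: "C \<ge> 0"
  shows "(\<Sum>i<N. (L (m i))\<^sup>2 / B (m i) (m i)) \<le> C\<^sup>2"
proof -
  define s where "s = (\<Sum>i<N. (L (m i))\<^sup>2 / B (m i) (m i))"
  define c where "c i = L (m i) / B (m i) (m i)" for i
  define u where "u = (\<lambda>x. \<Sum>i<N. c i * m i x)"
  have Su: "S u" unfolding u_def by (intro S_sum S_m) simp
  have "B u u = (\<Sum>i<N. c i * B (m i) u)" by (subst u_def) (intro B_sum S_m Su; simp)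
  also have "\<dots> = (\<Sum>i<N. (L (m i))\<^sup>2 / B (m i) (m i))"
  proof (intro sum.cong refl)
    fix i assume i: "i \<in> {..<N}"
    have "B u (m i) = (\<Sum>j<N. c j * B (m j) (m i))" unfolding u_def by (intro B_sum S_m) simp
    also have "\<dots> = (\<Sum>j<N. if j = i then c i * B (m i) (m i) else 0)"
      using m_orth B_sym[OF S_m S_m] by (intro sum.cong refl) (metis linorder_neqE_nat mult_zero_right)
    also have "\<dots> = c i * B (m i) (m i)" using i by (simp add: sum.delta)
    finally have "B (m i) u = L (m i)" using B_sym[OF Su S_m] B_m_pos[of i] by (simp add: c_def)
    thus "c i * B (m i) u = (L (m i))\<^sup>2 / B (m i) (m i)" by (simp add: c_def power2_eq_square)
  qed
  finally have Bu: "B u u = s" unfolding s_def .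
  have "L u = (\<Sum>i<N. c i * L (m i))" unfolding u_def by (rule lin)
  also have "\<dots> = s" unfolding s_def c_def by (intro sum.cong refl) (simp add: power2_eq_square)
  finally have "s \<le> C * sqrt s" using bound[OF Su] Bu by simp
  moreover have s0: "s \<ge> 0" unfolding s_def using B_m_pos by (intro sum_nonneg divide_nonneg_pos) auto
  ultimately have "sqrt s \<le> C"
    using mult_le_cancel_right_pos[of "sqrt s" "sqrt s" C] C by (cases "s = 0") auto
  hence "(sqrt s)\<^sup>2 \<le> C\<^sup>2" using s0 by (intro power_mono) auto
  thus ?thesis using s0 unfolding s_def by simp
qed

end

section \<open>Legendre and Sobolev-Legendre polynomials\<close>

definition poly_on_SG :: "nat \<Rightarrow> (real \<times> real \<Rightarrow> real) \<Rightarrow> bool" where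
  "poly_on_SG k u \<longleftrightarrow> (\<exists>n c. u = (\<lambda>x. \<Sum>i<n. c i * monomial k i x))"

lemma sol_mono_sum:
  "sol (\<lambda>x. \<Sum>i<n. c i * monomial k i x) (\<lambda>x. \<Sum>i<n. c i * prev (monomial k) i x)"
  using eigenseq_mono unfolding eigenseq_def by (intro sol_sum) auto

lemma prev_mono_outside: "x \<notin> SG \<Longrightarrow> prev (monomial k) i x = 0"
  by (cases i) (simp_all add: monomial_outside)

lemma laplacian_mono_sum:
  "laplacian (\<lambda>x. \<Sum>i<n. c i * monomial k i x) = (\<lambda>x. \<Sum>i<n. c i * prev (monomial k) i x)"
  unfolding laplacian_eq[OF sol_mono_sum] by (rule ext) (simp add: prev_mono_outside)

lemma poly_sol: "poly_on_SG k u \<Longrightarrow> sol u (laplacian u)"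
proof -
  assume "poly_on_SG k u"
  then obtain n c where u: "u = (\<lambda>x. \<Sum>i<n. c i * monomial k i x)" unfolding poly_on_SG_def by blast
  show ?thesis unfolding u laplacian_mono_sum by (rule sol_mono_sum)
qed

lemma poly_cont: "poly_on_SG k u \<Longrightarrow> contSG u" "poly_on_SG k u \<Longrightarrow> contSG (laplacian u)"
  using sol_cont[OF poly_sol] by blast+

lemma poly_outside: "poly_on_SG k u \<Longrightarrow> x \<notin> SG \<Longrightarrow> u x = 0"
  unfolding poly_on_SG_def by (auto simp: monomial_outside)

lemma poly_mono: "poly_on_SG k (monomial k n)"
  unfolding poly_on_SG_def
  by (intro exI[of _ "Suc n"] exI[of _ "\<lambda>j. of_bool (j = n)"])
    (auto simp: of_bool_def if_distrib[of "\<lambda>c. c * _"] cong: if_cong)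

lemma poly_add:
  assumes "poly_on_SG k u" "poly_on_SG k w"
  shows "poly_on_SG k (\<lambda>x. u x + a * w x)"
proof -
  obtain n c n' d where u: "u = (\<lambda>x. \<Sum>i<n. c i * monomial k i x)" and w: "w = (\<lambda>x. \<Sum>i<n'. d i * monomial k i x)"
    using assms unfolding poly_on_SG_def by blast
  define N where "N = max n n'"
  have "(\<Sum>i<n. c i * monomial k i x) = (\<Sum>i<N. (if i < n then c i else 0) * monomial k i x)" for x
    by (intro sum.mono_neutral_cong_left) (auto simp: N_def)
  moreover have "(\<Sum>i<n'. d i * monomial k i x) = (\<Sum>i<N. (if i < n' then d i else 0) * monomial k i x)" for x
    by (intro sum.mono_neutral_cong_left) (auto simp: N_def)
  ultimately have "(\<lambda>x. u x + a * w x) =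
      (\<lambda>x. \<Sum>i<N. ((if i < n then c i else 0) + a * (if i < n' then d i else 0)) * monomial k i x)"
    unfolding u w by (simp add: sum_distrib_left sum.distrib[symmetric] distrib_right mult.assoc)
  thus ?thesis unfolding poly_on_SG_def
    by (intro exI[of _ N] exI[of _ "\<lambda>i. (if i < n then c i else 0) + a * (if i < n' then d i else 0)"])
qed

lemma laplacian_add:
  assumes "poly_on_SG k u" "poly_on_SG k w"
  shows "laplacian (\<lambda>x. u x + a * w x) = (\<lambda>x. laplacian u x + a * laplacian w x)"
proof -
  have o: "laplacian u x = 0" if "poly_on_SG k u" "x \<notin> SG" for u x
    using laplacian_eq[OF poly_sol[OF that(1)]] that(2) by metis
  show ?thesis
    unfolding laplacian_eq[OF sol_linear[OF poly_sol[OF assms(1)] poly_sol[OF assms(2)]]]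
    using o[OF assms(1)] o[OF assms(2)] by (intro ext) simp
qed

lemma ip2_eq: "ip2 f g = intg (\<lambda>x. f x * g x)"
  by (simp add: ip2_def intg_def)

lemma ipS_eq: "ipS chi f g = ip2 f g + chi * ip2 (laplacian f) (laplacian g)"
  by (simp add: ipS_def ip2_def)

lemma ip2_sym: "ip2 f g = ip2 g f"
  by (simp add: ip2_eq mult.commute)

lemma ip2_add:
  assumes "contSG f" "contSG f'" "contSG g"
  shows "ip2 (\<lambda>x. f x + c * f' x) g = ip2 f g + c * ip2 f' g"
proof -
  have "ip2 (\<lambda>x. f x + c * f' x) g = intg (\<lambda>x. f x * g x + c * (f' x * g x))"
    unfolding ip2_eq by (rule intg_cong) (simp add: algebra_simps)
  thus ?thesis using assms unfolding ip2_eq by (subst (asm) intg_add) (auto intro!: continuous_intros simp: intg_cmult)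
qed

lemma ip2_nonneg: "contSG f \<Longrightarrow> ip2 f f \<ge> 0"
  unfolding ip2_eq by (intro intg_nonneg continuous_intros) auto

lemma ip2_eq_0_imp: "contSG f \<Longrightarrow> ip2 f f = 0 \<Longrightarrow> x \<in> SG \<Longrightarrow> f x = 0"
  using intg_eq_0_imp[of "\<lambda>x. f x * f x" x] unfolding ip2_eq by (simp add: continuous_on_mult)

text \<open>The Laplacian lowers the degree and keeps the leading coefficient, so a vanishing monic
  combination would lead down to \<open>monomial k 0\<close>, which is nonzero at
  \<open>q 1\<close>.\<close>

lemma monic_nonzero:
  "\<exists>x\<in>SG. monomial k n x + (\<Sum>i<n. d i * monomial k i x) \<noteq> 0"
proof (induction n arbitrary: d)
  case 0
  have "monomial k 0 (q 1) \<noteq> 0" using monomial_q_0[of 1 k] by (simp add: monomial_base_def)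
  thus ?case using q_in_SG[of 1] by (intro bexI[of _ "q 1"]) simp_all
next
  case (Suc n)
  show ?case
  proof (rule ccontr)
    assume *: "\<not> ?thesis"
    let ?c = "\<lambda>i. if i = Suc n then 1 else d i"
    have "(\<Sum>i<Suc (Suc n). ?c i * monomial k i x) = monomial k (Suc n) x + (\<Sum>i<Suc n. d i * monomial k i x)" for x
      unfolding sum.lessThan_Suc[of _ "Suc n"] by (simp)
    hence z: "(\<Sum>i<Suc (Suc n). ?c i * monomial k i x) = 0" if "x \<in> SG" for x using * that by metis
    have "(\<Sum>i<Suc (Suc n). ?c i * prev (monomial k) i x) = monomial k n x + (\<Sum>i<n. d (Suc i) * monomial k i x)" for x
    proof -
      have "(\<Sum>i<Suc (Suc n). ?c i * prev (monomial k) i x) = (\<Sum>i<Suc n. ?c (Suc i) * monomial k i x)"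
        by (subst sum.lessThan_Suc_shift) simp
      thus ?thesis by (simp)
    qed
    hence "monomial k n x + (\<Sum>i<n. d (Suc i) * monomial k i x) = 0" if "x \<in> SG" for x
      using sol_zero_imp[OF sol_mono_sum[where n = "Suc (Suc n)" and c = ?c and k = k] z that] by metis
    thus False using Suc.IH[of "\<lambda>i. d (Suc i)"] by blast
  qed
qed

lemma ip2_monic_nonzero:
  "ip2 (\<lambda>x. monomial k n x + (\<Sum>i<n. d i * monomial k i x)) (\<lambda>x. monomial k n x + (\<Sum>i<n. d i * monomial k i x)) \<noteq> 0"
proof
  let ?u = "\<lambda>x. monomial k n x + (\<Sum>i<n. d i * monomial k i x)"
  assume "ip2 ?u ?u = 0"
  moreover have "contSG ?u" by (intro continuous_intros monomial_cont)
  ultimately show False using ip2_eq_0_imp[of ?u] monic_nonzero[of k n d] by blast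
qed

locale monomial_family =
  fixes k :: nat and chi :: real
  assumes k: "k \<in> {1, 2, 3}" and chi: "chi > 0"

sublocale monomial_family \<subseteq> Leg: gram_schmidt ip2 "monomial k" "poly_on_SG k"
  by unfold_locales (rule poly_mono ip2_monic_nonzero | erule (1) poly_add | rule ip2_sym |
    (intro ip2_add ip2_nonneg poly_cont; assumption))+

context monomial_family
begin

lemma spn_poly: "Leg.spn n u \<Longrightarrow> poly_on_SG k u"
  by (rule Leg.spn_S)

lemma ipS_ge_ip2: "poly_on_SG k u \<Longrightarrow> ipS chi u u \<ge> ip2 u u"
  unfolding ipS_eq using chi ip2_nonneg[OF poly_cont(2)] by simp

end

sublocale monomial_family \<subseteq> Sob: gram_schmidt "ipS chi" "monomial k" "poly_on_SG k"
proof unfold_locales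
  show "poly_on_SG k (monomial k n)" for n by (rule poly_mono)
  show "poly_on_SG k (\<lambda>x. u x + c * w x)" if "poly_on_SG k u" "poly_on_SG k w" for u w c
    using that by (rule poly_add)
  show "ipS chi u w = ipS chi w u" if "poly_on_SG k u" "poly_on_SG k w" for u w
    unfolding ipS_eq using ip2_sym by metis
  show "ipS chi (\<lambda>x. u x + c * u' x) w = ipS chi u w + c * ipS chi u' w"
    if "poly_on_SG k u" "poly_on_SG k u'" "poly_on_SG k w" for u u' w c
    unfolding ipS_eq laplacian_add[OF that(1,2)] using that
    by (simp add: ip2_add poly_cont algebra_simps)
  show "ipS chi u u \<ge> 0" if "poly_on_SG k u" for u
    using ipS_ge_ip2[OF that] ip2_nonneg[OF poly_cont(1)[OF that]] by linarith
  fix n d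
  let ?u = "\<lambda>x. monomial k n x + (\<Sum>i<n. d i * monomial k i x)"
  have "poly_on_SG k (\<lambda>x. monomial k n x + 1 * (\<Sum>i<n. d i * monomial k i x))"
    by (intro poly_add poly_mono Leg.S_sum) simp
  hence u: "poly_on_SG k ?u" by simp
  have "ip2 ?u ?u > 0" using ip2_monic_nonzero[of k n d] ip2_nonneg[OF poly_cont(1)[OF u]] by simp
  thus "ipS chi ?u ?u \<noteq> 0" using ipS_ge_ip2[OF u] by simp
qed

context monomial_family
begin

lemma Pmon_mono: "Pmon j k = monomial k j" by (rule Pmon_eq_mono[OF k])

lemma legendre_eq: "legendre n k = Leg.m n"
  unfolding legendre_def Pmon_mono ..

lemma sobolev_eq: "sobolev_legendre chi n k = Sob.m n"
  unfolding sobolev_legendre_def Pmon_mono ..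

lemma norm2_sq: "poly_on_SG k u \<Longrightarrow> (norm2 u)\<^sup>2 = ip2 u u"
  unfolding norm2_def using ip2_nonneg[OF poly_cont(1)] by simp

lemma normS_sq: "poly_on_SG k u \<Longrightarrow> (normS chi u)\<^sup>2 = ipS chi u u"
  unfolding normS_def using Sob.B_nonneg by simp

lemma laplacian_spn:
  assumes "Leg.spn n u"
  shows "Leg.spn (n - 1) (laplacian u)"
proof (cases n)
  case 0
  hence "u = (\<lambda>x. \<Sum>i<0. 0 * monomial k i x)" using assms unfolding Leg.spn_def by simp
  hence "laplacian u = (\<lambda>x. 0)" using laplacian_mono_sum[where n = 0 and k = k and c = "\<lambda>_. 0"] by simp
  thus ?thesis using Leg.spn_0 by simp
next
  case (Suc m)
  obtain c where "u = (\<lambda>x. \<Sum>i<n. c i * monomial k i x)" using assms unfolding Leg.spn_def by blast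
  hence "laplacian u = (\<lambda>x. \<Sum>i<n. c i * prev (monomial k) i x)" using laplacian_mono_sum by simp
  also have "\<dots> = (\<lambda>x. \<Sum>i<m. c (Suc i) * monomial k i x)"
    unfolding Suc sum.lessThan_Suc_shift by simp
  finally show ?thesis unfolding Leg.spn_def Suc by auto
qed

lemma laplacian_monic:
  assumes "Leg.spn (Suc n) (\<lambda>x. u x + (-1) * monomial k (Suc n) x)"
  shows "Leg.spn n (\<lambda>x. laplacian u x + (-1) * monomial k n x)"
proof -
  let ?w = "\<lambda>x. u x + (-1) * monomial k (Suc n) x"
  have "laplacian (\<lambda>x. ?w x + 1 * monomial k (Suc n) x) = (\<lambda>x. laplacian ?w x + 1 * laplacian (monomial k (Suc n)) x)"
    by (rule laplacian_add[OF spn_poly[OF assms] poly_mono])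
  hence "laplacian u = (\<lambda>x. laplacian ?w x + monomial k n x)" unfolding laplacian_mono(1) by simp
  moreover have "Leg.spn n (laplacian ?w)" using laplacian_spn[OF assms] by simp
  ultimately show ?thesis by simp
qed

lemma monic_pos:
  assumes "Leg.spn n (\<lambda>x. u x + (-1) * monomial k n x)"
  shows "ip2 u u > 0"
  using Leg.m_minimal[OF assms] Leg.B_m_pos[of n] by linarith

lemma m_eq_if_small:
  assumes "Leg.spn n (\<lambda>x. u x - w x)" "ip2 (\<lambda>x. u x - w x) (\<lambda>x. u x - w x) = 0"
  shows "u = w"
proof
  fix x
  note p = spn_poly[OF assms(1)]
  show "u x = w x"
    using ip2_eq_0_imp[OF poly_cont(1)[OF p] assms(2), of x] poly_outside[OF p, of x] by (cases "x \<in> SG") auto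
qed

lemma ip2_mono_nonzero: "ip2 (monomial k n) (monomial k 0) \<noteq> 0"
  unfolding ip2_eq by (rule intg_mono_mono_0_nonzero[OF k])

text \<open>For \<open>k = 2, 3\<close> the boundary values of \<open>u\<close> vanish at
  \<open>q 0\<close> and are symmetric or antisymmetric at the other corners, hence a multiple of
  those of \<open>P\<^sub>0\<close>. So \<open>bmom\<close> is a multiple of the inner product of
  \<open>f\<close> with \<open>P\<^sub>0\<close>.\<close>

lemma bmom_bd_eq_0:
  assumes k23: "k \<noteq> 1" and u: "Leg.spn n u" and f: "ip2 f (monomial k 0) = 0" "contSG f"
  shows "bmom f (bd u) = 0"
proof -
  obtain c where c: "u = (\<lambda>x. \<Sum>i<n. c i * monomial k i x)" using u unfolding Leg.spn_def by blast
  have u0: "u (q 0) = 0" unfolding c using monomial_Cauchy_data(1)[OF k] k23 by simp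
  have u2: "u (q 2) = (if k = 3 then - 1 else 1) * u (q 1)"
    unfolding c sum_distrib_left monomial_q2[OF k] by (simp add: algebra_simps)
  have "ip2 f (monomial k 0) = intg (\<lambda>x. monomial_base k 0 * (f x * hb 0 x) + monomial_base k 1 * (f x * hb 1 x) + monomial_base k 2 * (f x * hb 2 x))"
    unfolding ip2_eq using harmonic_eq_hb by (intro intg_cong) (simp add: algebra_simps monomial.simps)
  also have "\<dots> = monomial_base k 0 * mom f 0 + monomial_base k 1 * mom f 1 + monomial_base k 2 * mom f 2"
    unfolding mom_def using f(2)
    by (subst intg_add, (intro continuous_intros; assumption), (intro continuous_intros; assumption))+
      (simp add: intg_cmult)
  finally have "monomial_base k 0 * mom f 0 + monomial_base k 1 * mom f 1 + monomial_base k 2 * mom f 2 = 0" using f(1) by simp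
  hence "u (q 1) * ((if k = 3 then - 1 else 1) * mom f 2 + mom f 1) = 0"
    using k k23 by (cases "k = 2") (simp_all add: monomial_base_def)
  thus ?thesis unfolding bmom_def bd_def u0 u2 by (simp add: algebra_simps split: if_splits)
qed

text \<open>If both orthogonalizations gave the same \<open>p\<close>, then \<open>\<Delta> p\<close> would be orthogonal to \<open>p\<close> and to
  \<open>P\<^sub>0\<close>; subtracting the harmonic part of \<open>p\<close> leaves a function without energy.\<close>

lemma legendre_neq_sobolev:
  assumes n: "n \<ge> 2"
  shows "Leg.m n \<noteq> Sob.m n"
proof
  assume eq: "Leg.m n = Sob.m n"
  define p f where "p = Leg.m n" "f = laplacian p"
  note pf = this
  have pp: "poly_on_SG k p" unfolding pf by (rule Leg.S_m)
  have fc: "contSG f" unfolding pf(2) by (rule poly_cont[OF pp])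
  have "Suc (n - 1) = n" using n by simp
  hence fm: "Leg.spn (n - 1) (\<lambda>x. f x + (-1) * monomial k (n - 1) x)"
    using laplacian_monic[of "n - 1" p] Leg.m_monic[of n] unfolding pf by simp
  \<comment> \<open>The two inner products of \<open>p\<close> with \<open>P\<^sub>1\<close> differ
    by \<open>chi\<close> times that of \<open>\<Delta> p\<close> with
    \<open>\<Delta> P\<^sub>1 = P\<^sub>0\<close>, and both vanish since
    \<open>1 < n\<close>.\<close>
  have "ipS chi p (monomial k 1) = 0" unfolding pf eq by (rule Sob.m_orth_v) (use n in simp)
  moreover have "ip2 p (monomial k 1) = 0" unfolding pf by (rule Leg.m_orth_v) (use n in simp)
  ultimately have f0: "ip2 f (monomial k 0) = 0"
    using chi unfolding ipS_eq pf(2) One_nat_def laplacian_mono by simp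
  have "Leg.spn n f"
    using Leg.spn_mono[of "n" n, OF _ laplacian_spn[OF Leg.spn_m[of n], simplified]] unfolding pf by simp
  hence pf0: "ip2 p f = 0" unfolding pf by (rule Leg.m_orth_spn)
  let ?u = "\<lambda>x. p x + (-1) * harmonic (bd p) x"
  have s: "sol ?u (\<lambda>x. f x + (-1) * 0)" unfolding pf(2) by (rule sol_linear[OF poly_sol[OF pp] sol_harmonic])
  have intu: "intg (\<lambda>x. (f x + (-1) * 0) * ?u x) = - bmom f (bd p)"
  proof -
    have "intg (\<lambda>x. (f x + (-1) * 0) * ?u x) = intg (\<lambda>x. p x * f x - (bd p 0 * (f x * hb 0 x) + bd p 1 * (f x * hb 1 x) + bd p 2 * (f x * hb 2 x)))"
      by (intro intg_cong) (simp add: harmonic_eq_hb algebra_simps)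
    also have "\<dots> = intg (\<lambda>x. p x * f x) - intg (\<lambda>x. bd p 0 * (f x * hb 0 x) + bd p 1 * (f x * hb 1 x) + bd p 2 * (f x * hb 2 x))"
      using fc poly_cont(1)[OF pp] by (intro intg_diff continuous_intros)
    also have "intg (\<lambda>x. bd p 0 * (f x * hb 0 x) + bd p 1 * (f x * hb 1 x) + bd p 2 * (f x * hb 2 x)) = bmom f (bd p)"
      unfolding bmom_def mom_def using fc
      by (subst intg_add, (intro continuous_intros; assumption), (intro continuous_intros; assumption))+
        (simp add: intg_cmult)
    finally show ?thesis using pf0 unfolding ip2_eq by simp
  qed
  have "bmom f (bd p) \<le> 0"
  proof (cases "k = 1")
    case False
    thus ?thesis using bmom_bd_eq_0[OF False Leg.spn_m[of n] f0 fc] unfolding pf by simp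
  next
    case True
    \<comment> \<open>Here \<open>P\<^sub>0\<close> is constant and the boundary values of
      \<open>p\<close> may fail to be a multiple of it. Instead every monomial has flux 0 at
      \<open>q 0\<close>, which ties \<open>mom f 0\<close> to the corner values and makes
      \<open>bmom\<close> minus twice a square.\<close>
    obtain c where c: "p = (\<lambda>x. \<Sum>i<Suc n. c i * monomial k i x)" using Leg.spn_m[of n] unfolding Leg.spn_def pf by blast
    have p2: "p (q 2) = p (q 1)" unfolding c monomial_q2[OF k] using True by simp
    have fs: "f = (\<lambda>x. \<Sum>i<Suc n. c i * prev (monomial k) i x)" unfolding pf(2) unfolding c by (rule laplacian_mono_sum)
    have "bd p = (\<lambda>k'. \<Sum>i<Suc n. c i * bd (monomial k i) k')" by (rule ext) (simp add: c bd_def)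
    hence "nflux 0 (bd p) f = (\<Sum>i<Suc n. c i * nflux 0 (bd (monomial k i)) (prev (monomial k) i))"
      unfolding fs using nflux_sum[of "{..<Suc n}" "prev (monomial k)" 0 c "\<lambda>i. bd (monomial k i)"] eigenseq_cont(2)[OF eigenseq_mono]
      by (simp del: sum.lessThan_Suc)
    also have "\<dots> = (\<Sum>i<Suc n. c i * fps_nth (ffps (monomial k) 0) i)" by (simp add: ffps_def)
    also have "\<dots> = 0" unfolding ffps_mono_0[OF k] using True by simp
    finally have m0: "mom f 0 = - 2 * (p (q 0) - p (q 1))" using p2 by (simp add: nflux_def bd_def)
    have "ip2 f (monomial k 0) = intg f" unfolding ip2_eq using monomial_1_0 True by (intro intg_cong) simp
    hence "mom f 0 + mom f 1 + mom f 2 = 0" using f0 mom_sum[OF fc] by simp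
    hence "mom f 1 + mom f 2 = - mom f 0" by linarith
    moreover have "bmom f (bd p) = p (q 0) * mom f 0 + p (q 1) * (mom f 1 + mom f 2)"
      using p2 by (simp add: bmom_def bd_def algebra_simps)
    ultimately have "bmom f (bd p) = (p (q 0) - p (q 1)) * mom f 0" by (simp add: algebra_simps)
    also have "\<dots> = - 2 * (p (q 0) - p (q 1))\<^sup>2" unfolding m0 by (simp add: power2_eq_square algebra_simps)
    also have "\<dots> \<le> 0" by simp
    finally show ?thesis .
  qed
  hence "?u x = 0" if "x \<in> SG" for x
    using sol_zero_boundary_le[OF s _ _ that] intu harmonic_q by (simp add: bd_def)
  hence "f x + (-1) * 0 = 0" if "x \<in> SG" for x using sol_zero_imp[OF s _ that] by blast
  hence "intg (\<lambda>x. f x * f x) = intg (\<lambda>x. 0)" by (intro intg_cong) simp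
  hence "ip2 f f = 0" unfolding ip2_eq by simp
  thus False using monic_pos[OF fm] by simp
qed

text \<open>For \<open>k = 1\<close> the solution with zero boundary values is
  \<open>P\<^sub>n\<^sub>+\<^sub>1\<close> minus a multiple of \<open>1 - hb 0\<close>, the factor
  being half the moment at \<open>q 0\<close>; subtracting the same multiple of \<open>hb 0\<close>
  leaves a constant. For \<open>k = 2, 3\<close> the harmonic difference already is a multiple of
  \<open>P\<^sub>0\<close>.\<close>

definition theta :: real where "theta = (if k = 1 then 1/2 else 0)"

text \<open>A solution operator that maps \<open>P\<^sub>n\<close> to \<open>P\<^sub>n\<^sub>+\<^sub>1\<close> up to a multiple of \<open>P\<^sub>0\<close>.\<close>

definition Top :: "(real \<times> real \<Rightarrow> real) \<Rightarrow> real \<times> real \<Rightarrow> real" where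
  "Top f = restr (\<lambda>x. poisson (\<lambda>_. 0) f x - theta * mom f 0 * hb 0 x)"

lemma sol_Top: "contSG f \<Longrightarrow> sol (Top f) f"
  by (rule sol_cong[OF sol_linear[OF sol_poisson[of f "\<lambda>_. 0"] sol_hb[of 0], of "- theta * mom f 0"]])
    (simp_all add: Top_def)

text \<open>30 comes from \<open>poisson_zero_bound\<close> and 1 from the correction by
  \<open>hb 0\<close>; the \<open>L^1\<close> norm is then estimated by the \<open>L^2\<close>
  norm.\<close>

lemma Top_bound:
  assumes f: "contSG f" and x: "x \<in> SG"
  shows "\<bar>Top f x\<bar> \<le> 31 * sqrt (ip2 f f)"
proof -
  let ?I = "intg (\<lambda>x. \<bar>f x\<bar>)"
  have "0 \<le> ?I" using f by (intro intg_nonneg continuous_intros) auto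
  have "\<bar>theta * mom f 0 * hb 0 x\<bar> = theta * (\<bar>mom f 0\<bar> * hb 0 x)"
    using hb_bounds[OF x, of 0] by (simp add: theta_def abs_mult)
  also have "\<dots> \<le> 1 * (?I * 1)"
    using hb_bounds[OF x, of 0] mom_abs_le[OF f, of 0] \<open>0 \<le> ?I\<close>
    by (intro mult_mono) (auto simp: theta_def)
  finally have "\<bar>Top f x\<bar> \<le> 30 * ?I + ?I"
    using poisson_zero_bound[OF f x] x unfolding Top_def by simp
  also have "\<dots> \<le> 31 * sqrt (ip2 f f)" using intg_abs_le_sqrt[OF f] unfolding ip2_eq by simp
  finally show ?thesis .
qed

lemma Top_sum:
  assumes I: "finite I" and u: "\<And>i. i \<in> I \<Longrightarrow> contSG (u i)"
  shows "Top (\<lambda>x. \<Sum>i\<in>I. c i * u i x) x = (\<Sum>i\<in>I. c i * Top (u i) x)"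
proof (cases "x \<in> SG")
  case True
  let ?f = "\<lambda>x. \<Sum>i\<in>I. c i * u i x"
  have f: "contSG ?f" using u by (intro continuous_intros) auto
  have "poisson (\<lambda>_. 0) ?f x = (\<Sum>i\<in>I. c i * poisson (\<lambda>_. 0) (u i) x)"
  proof (rule sol_unique[OF sol_poisson[OF f] sol_sum[OF I sol_poisson] _ _ True])
    show "poisson (\<lambda>_. 0) ?f (q j) = (\<Sum>i\<in>I. c i * poisson (\<lambda>_. 0) (u i) (q j))" if "j < 3" for j
      using poisson_q[OF f that] poisson_q[OF u that] by simp
  qed (use u in auto)
  moreover have "mom ?f 0 = (\<Sum>i\<in>I. c i * mom (u i) 0)"
  proof -
    have "mom ?f 0 = intg (\<lambda>x. \<Sum>i\<in>I. c i * (u i x * hb 0 x))"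
      unfolding mom_def by (intro intg_cong) (simp add: sum_distrib_right mult.assoc)
    also have "\<dots> = (\<Sum>i\<in>I. c i * mom (u i) 0)"
      using u by (subst intg_sum) (auto intro!: continuous_intros simp: intg_cmult mom_def)
    finally show ?thesis .
  qed
  ultimately show ?thesis using True
    by (simp add: Top_def sum_subtractf sum_distrib_left sum_distrib_right algebra_simps)
qed (simp add: Top_def restr_def)

lemma Top_mono: "\<exists>b. Top (monomial k n) = (\<lambda>x. monomial k (Suc n) x + b * monomial k 0 x)"
proof -
  define a where "a = bd (monomial k (Suc n))"
  have a0: "a 0 = 0" unfolding a_def bd_def using monomial_flux_tload(3) by simp
  have a2: "a 2 = (if k = 3 then - 1 else 1) * a 1" unfolding a_def bd_def by (rule monomial_q2[OF k])
  have a1: "k = 1 \<Longrightarrow> mom (monomial k n) 0 = 2 * a 1"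
    using monomial_flux_tload(1)[of k n] a2 unfolding a_def bd_def by simp
  define b where "b = (if k = 1 then - a 1 else if k = 2 then 2 * a 1 else - 2 * a 1)"
  have "Top (monomial k n) x = monomial k (Suc n) x + b * monomial k 0 x" if x: "x \<in> SG" for x
  proof -
    have "monomial k (Suc n) x = poisson (\<lambda>_. 0) (monomial k n) x + 1 * harmonic a x"
    proof (rule sol_unique[OF monomial_sol(2) sol_linear[OF sol_poisson[OF monomial_cont] sol_harmonic] _ _ x])
      show "monomial k (Suc n) (q j) = poisson (\<lambda>_. 0) (monomial k n) (q j) + 1 * harmonic a (q j)" if "j < 3" for j
        unfolding poisson_q[OF monomial_cont that] harmonic_q[OF that] a_def bd_def by simp
    qed simp
    moreover have "monomial k 0 x = monomial_base k 0 * hb 0 x + monomial_base k 1 * hb 1 x + monomial_base k 2 * hb 2 x"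
      using x harmonic_eq_hb[OF x] by (simp add: monomial.simps)
    moreover have "hb 2 x = 1 - hb 0 x - hb 1 x" using hb_sum[OF x] by simp
    moreover have "Top (monomial k n) x = poisson (\<lambda>_. 0) (monomial k n) x - theta * mom (monomial k n) 0 * hb 0 x"
      using x by (simp add: Top_def)
    ultimately have "Top (monomial k n) x - monomial k (Suc n) x - b * monomial k 0 x =
        - (theta * mom (monomial k n) 0 * hb 0 x) - (a 1 * hb 1 x + a 2 * (1 - hb 0 x - hb 1 x))
        - b * (monomial_base k 0 * hb 0 x + monomial_base k 1 * hb 1 x + monomial_base k 2 * (1 - hb 0 x - hb 1 x))"
      unfolding harmonic_eq_hb[OF x] a0 by (simp)
    also have "\<dots> = 0"
    proof -
      consider "k = 1" | "k = 2" | "k = 3" using k by blast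
      thus ?thesis
      proof cases
        case 1
        have "theta = 1 / 2" unfolding theta_def using 1 by (rule if_P)
        moreover have "b = - a 1" "a 2 = a 1" "monomial_base k i = 1" for i
          using 1 a2 by (simp_all add: b_def monomial_base_def)
        ultimately show ?thesis using a1[OF 1] by (simp add: algebra_simps)
      next
        case 2
        have "theta = 0" unfolding theta_def using 2 by simp
        thus ?thesis by (simp add: 2 b_def a2 monomial_base_def algebra_simps)
      next
        case 3
        have "theta = 0" unfolding theta_def using 3 by simp
        thus ?thesis by (simp add: 3 b_def a2 monomial_base_def algebra_simps)
      qed
    qed
    finally show ?thesis by linarith
  qed
  hence "Top (monomial k n) x = monomial k (Suc n) x + b * monomial k 0 x" for x
    by (cases "x \<in> SG") (auto simp: Top_def restr_def monomial_outside)
  thus ?thesis by blast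
qed

lemma Top_monic: "Leg.spn (Suc n) (\<lambda>x. Top (Leg.m n) x + (-1) * monomial k (Suc n) x)"
proof -
  obtain c where c: "Leg.m n = (\<lambda>x. monomial k n x + (\<Sum>i<n. c i * monomial k i x))" using Leg.m_monic_obtain .
  obtain b where b: "Top (monomial k i) = (\<lambda>x. monomial k (Suc i) x + b i * monomial k 0 x)" for i using Top_mono by metis
  let ?c = "\<lambda>i. if i = n then 1 else c i"
  have "Leg.m n = (\<lambda>x. \<Sum>i<Suc n. ?c i * monomial k i x)" unfolding c by (simp add: add.commute)
  hence "Top (Leg.m n) x = (\<Sum>i<Suc n. ?c i * Top (monomial k i) x)" for x
    using Top_sum[of "{..<Suc n}" "monomial k" ?c x] monomial_cont by simp
  hence "(\<lambda>x. Top (Leg.m n) x + (-1) * monomial k (Suc n) x) = (\<lambda>x. (\<Sum>i<n. c i * Top (monomial k i) x) + b n * monomial k 0 x)"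
    by (simp add: b fun_eq_iff)
  moreover have "Leg.spn (Suc n) (Top (monomial k i))" if "i < n" for i
    unfolding b by (intro Leg.spn_add Leg.spn_v) (use that in simp_all)
  hence "Leg.spn (Suc n) (\<lambda>x. (\<Sum>i<n. c i * Top (monomial k i) x) + b n * monomial k 0 x)"
    by (intro Leg.spn_add Leg.spn_sum Leg.spn_v) auto
  ultimately show ?thesis by simp
qed

definition N2 :: "nat \<Rightarrow> real" where "N2 n = ip2 (Leg.m n) (Leg.m n)"
definition R2 :: "nat \<Rightarrow> real" where "R2 n = ip2 (Top (Leg.m n)) (Top (Leg.m n)) / N2 n"

lemma N2_pos: "N2 n > 0" unfolding N2_def by (rule Leg.B_m_pos)

lemma m_cont: "contSG (Leg.m n)" by (rule poly_cont[OF Leg.S_m])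

lemma Top_cont: "contSG f \<Longrightarrow> contSG (Top f)" using sol_cont(1)[OF sol_Top] .

lemma R2_nonneg: "R2 n \<ge> 0"
  unfolding R2_def using ip2_nonneg[OF Top_cont[OF m_cont]] N2_pos[of n] by simp

text \<open>Integrating the pointwise Bessel bound over a probability measure. In other words,
  \<open>Top\<close> is a Hilbert-Schmidt operator on the span of the polynomials.\<close>

lemma R2_sum: "(\<Sum>i<N. R2 i) \<le> 31\<^sup>2"
proof -
  have "(\<Sum>i<N. R2 i) = intg (\<lambda>x. \<Sum>i<N. (Top (Leg.m i) x)\<^sup>2 / N2 i)"
    using Top_cont[OF m_cont] N2_pos
    by (subst intg_sum) (auto intro!: continuous_intros sum.cong simp: R2_def ip2_eq intg_divide power2_eq_square less_imp_neq[symmetric])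
  also have "\<dots> \<le> intg (\<lambda>_. 31\<^sup>2)"
  proof (rule intg_mono)
    show "contSG (\<lambda>x. \<Sum>i<N. (Top (Leg.m i) x)\<^sup>2 / N2 i)"
      using Top_cont[OF m_cont] N2_pos by (intro continuous_intros) (auto simp: less_imp_neq[symmetric])
    fix x assume x: "x \<in> SG"
    show "(\<Sum>i<N. (Top (Leg.m i) x)\<^sup>2 / N2 i) \<le> 31\<^sup>2" unfolding N2_def
    proof (rule Leg.bessel)
      show "Top (\<lambda>x. \<Sum>i<M. c i * Leg.m i x) x = (\<Sum>i<M. c i * Top (Leg.m i) x)" for M c
        by (rule Top_sum) (auto intro: m_cont)
      show "\<bar>Top u x\<bar> \<le> 31 * sqrt (ip2 u u)" if "poly_on_SG k u" for u
        by (rule Top_bound[OF poly_cont(1)[OF that] x])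
    qed simp
  qed auto
  finally show ?thesis by (simp add: intg_const)
qed

lemma R2_tendsto_0: "R2 \<longlonglongrightarrow> 0"
  by (intro summable_LIMSEQ_zero summableI_nonneg_bounded[of R2 "31\<^sup>2"] R2_nonneg R2_sum)

lemma R2_le: "R2 n \<le> 31\<^sup>2"
proof -
  have "R2 n \<le> (\<Sum>i<Suc n. R2 i)" using R2_nonneg by (intro member_le_sum) auto
  thus ?thesis using R2_sum[of "Suc n"] by linarith
qed

lemma N2_Suc: "N2 (Suc n) \<le> R2 n * N2 n"
  using Leg.m_minimal[OF Top_monic[of n]] N2_pos[of n] unfolding R2_def N2_def by simp

lemma N2_decay:
  assumes r: "r > 0"
  shows "\<exists>C>0. \<forall>n. N2 n * (r\<^sup>2) ^ n \<le> C"
proof -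
  have "\<forall>\<^sub>F n in sequentially. R2 n < 1 / r\<^sup>2"
    using r by (intro order_tendstoD(2)[OF R2_tendsto_0]) simp
  then obtain M where M: "\<And>n. n \<ge> M \<Longrightarrow> R2 n < 1 / r\<^sup>2" unfolding eventually_sequentially by blast
  \<comment> \<open>Weighted by \<open>(r\<^sup>2) ^ n\<close>, the squared norms decrease from
    \<open>M\<close> on, so the sum of the terms up to \<open>M\<close> bounds all of them.\<close>
  define a where "a n = N2 n * (r\<^sup>2) ^ n" for n
  have a0: "a n > 0" for n unfolding a_def using N2_pos r by simp
  have dec: "a (Suc n) \<le> a n" if "n \<ge> M" for n
  proof -
    have "N2 (Suc n) * r\<^sup>2 \<le> (R2 n * N2 n) * r\<^sup>2" using N2_Suc by (intro mult_right_mono) auto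
    also have "\<dots> = N2 n * (R2 n * r\<^sup>2)" by simp
    also have "\<dots> \<le> N2 n * 1"
      using M[OF that] r N2_pos[of n] by (intro mult_left_mono) (auto simp: field_simps)
    finally have "N2 (Suc n) * r\<^sup>2 * (r\<^sup>2) ^ n \<le> N2 n * 1 * (r\<^sup>2) ^ n" by (intro mult_right_mono) auto
    thus ?thesis unfolding a_def by (simp add: mult_ac)
  qed
  have ge: "a n \<le> a M" if "n \<ge> M" for n
    using that by (induction n rule: dec_induct) (auto intro: order.trans[OF dec])
  have "a n \<le> (\<Sum>i\<le>M. a i)" for n
  proof (cases "n \<le> M")
    case True
    thus ?thesis using a0 less_imp_le by (intro member_le_sum) auto
  next
    case False
    hence "a n \<le> a M" using ge by simp
    also have "a M \<le> (\<Sum>i\<le>M. a i)" using a0 less_imp_le by (intro member_le_sum) auto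
    finally show ?thesis .
  qed
  moreover have "(\<Sum>i\<le>M. a i) > 0" using a0 by (intro sum_pos) auto
  ultimately show ?thesis unfolding a_def by blast
qed

text \<open>Minimality against the competitor \<open>Top (Leg.m n)\<close>, which is monic of degree
  \<open>Suc n\<close>. Its own squared norm is at most \<open>31\<^sup>2 * N2 n\<close>, and its
  Laplacian is \<open>Leg.m n\<close>.\<close>

lemma normS_Suc_le: "normS chi (Sob.m (Suc n)) \<le> sqrt ((31\<^sup>2 + chi) * N2 n)"
proof -
  have m: "Sob.spn (Suc n) (\<lambda>x. Top (Leg.m n) x + (-1) * monomial k (Suc n) x)"
    using Top_monic unfolding Leg.spn_def Sob.spn_def .
  have "laplacian (Top (Leg.m n)) = Leg.m n"
    unfolding laplacian_eq[OF sol_Top[OF m_cont]] using poly_outside[OF Leg.S_m] by auto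
  hence "ipS chi (Top (Leg.m n)) (Top (Leg.m n)) = R2 n * N2 n + chi * N2 n"
    unfolding ipS_eq R2_def using N2_pos[of n] by (simp add: N2_def)
  also have "\<dots> \<le> (31\<^sup>2 + chi) * N2 n"
    using R2_le[of n] N2_pos[of n] by (simp add: distrib_right mult_right_mono)
  finally show ?thesis using Sob.m_minimal[OF m] unfolding normS_def by simp
qed

lemma normS_decay:
  assumes r: "r > 0"
  shows "\<exists>C>0. \<forall>n\<ge>1. normS chi (Sob.m n) < C * r powi (- int n)"
proof -
  obtain C where C: "C > 0" "\<And>n. N2 n * (r\<^sup>2) ^ n \<le> C" using N2_decay[OF r] by blast
  define K where "K = sqrt ((31\<^sup>2 + chi) * C)"
  have K: "K > 0" unfolding K_def using C chi by (simp add: add_pos_pos)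
  \<comment> \<open>\<open>K + 1\<close> instead of \<open>K\<close> makes the inequality strict,
    and the extra factor \<open>r\<close> accounts for the shift from \<open>j\<close> to
    \<open>n = Suc j\<close>.\<close>
  have "normS chi (Sob.m n) < (K + 1) * r * r powi (- int n)" if n: "n \<ge> 1" for n
  proof -
    obtain j where j: "n = Suc j" using n by (cases n) auto
    have rj: "(r ^ j)\<^sup>2 = (r\<^sup>2) ^ j" by (simp add: power_mult[symmetric] mult.commute)
    have "(31\<^sup>2 + chi) * N2 j \<le> (31\<^sup>2 + chi) * (C / (r ^ j)\<^sup>2)"
      using C(2)[of j] r chi unfolding rj by (intro mult_left_mono) (simp_all add: pos_le_divide_eq)
    hence "sqrt ((31\<^sup>2 + chi) * N2 j) \<le> sqrt ((31\<^sup>2 + chi) * C / (r ^ j)\<^sup>2)" by simp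
    also have "\<dots> = K / r ^ j" unfolding K_def real_sqrt_divide using r by simp
    also have "\<dots> < (K + 1) / r ^ j" using r by (simp add: divide_strict_right_mono)
    also have "\<dots> = (K + 1) * r * r powi (- int n)"
      unfolding j using r by (simp add: power_int_minus power_int_add field_simps flip: of_nat_Suc)
    finally show ?thesis using normS_Suc_le[of j] unfolding j by linarith
  qed
  moreover have "(K + 1) * r > 0" using K r by simp
  ultimately show ?thesis by blast
qed

lemma norm2_le_normS: "norm2 (Sob.m n) \<le> normS chi (Sob.m n)"
  unfolding norm2_def normS_def using ipS_ge_ip2[OF Sob.S_m] by simp

lemma normS_tendsto_0: "(\<lambda>n. normS chi (Sob.m n)) \<longlonglongrightarrow> 0" "(\<lambda>n. norm2 (Sob.m n)) \<longlonglongrightarrow> 0"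
proof -
  obtain C where C: "C > 0" "\<And>n. n \<ge> 1 \<Longrightarrow> normS chi (Sob.m n) < C * 2 powi (- int n)"
    using normS_decay[of 2] by auto
  have nn: "0 \<le> norm2 (Sob.m n)" for n unfolding norm2_def using ip2_nonneg[OF poly_cont(1)[OF Sob.S_m]] by simp
  have "(\<lambda>n. C * (1/2) ^ n) \<longlonglongrightarrow> C * 0" by (intro tendsto_intros LIMSEQ_power_zero) simp
  hence lim: "(\<lambda>n. C * (1/2) ^ n) \<longlonglongrightarrow> 0" by simp
  have le: "normS chi (Sob.m n) \<le> C * (1/2) ^ n" if "n \<ge> 1" for n
  proof -
    have "2 powi (- int n) = (1 / 2 :: real) ^ n" by (simp add: power_int_minus power_one_over inverse_eq_divide)
    thus ?thesis using C(2)[OF that] by simp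
  qed
  show S: "(\<lambda>n. normS chi (Sob.m n)) \<longlonglongrightarrow> 0"
    by (rule tendsto_sandwich[OF _ _ tendsto_const lim])
      (use le order.trans[OF nn norm2_le_normS] in \<open>auto simp: eventually_sequentially intro: exI[of _ 1]\<close>)
  show "(\<lambda>n. norm2 (Sob.m n)) \<longlonglongrightarrow> 0"
    by (rule tendsto_sandwich[OF _ _ tendsto_const S]) (use nn norm2_le_normS in auto)
qed

section \<open>Comparison of the norms\<close>

lemma legendre_le_sobolev:
  "(norm2 (Leg.m n))\<^sup>2 \<le> (norm2 (Sob.m n))\<^sup>2"
  "n \<ge> 2 \<Longrightarrow> (norm2 (Leg.m n))\<^sup>2 < (norm2 (Sob.m n))\<^sup>2"
proof -
  have m: "Leg.spn n (\<lambda>x. Sob.m n x + (-1) * monomial k n x)"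
    using Sob.m_monic unfolding Leg.spn_def Sob.spn_def .
  note p = Leg.monic_pythagoras[OF m]
  have 0: "ip2 (\<lambda>x. Sob.m n x - Leg.m n x) (\<lambda>x. Sob.m n x - Leg.m n x) \<ge> 0"
    by (rule Leg.B_nonneg[OF spn_poly[OF p(1)]])
  thus "(norm2 (Leg.m n))\<^sup>2 \<le> (norm2 (Sob.m n))\<^sup>2"
    unfolding norm2_sq[OF Leg.S_m] norm2_sq[OF Sob.S_m] using p(2) by linarith
  assume "n \<ge> 2"
  hence "ip2 (\<lambda>x. Sob.m n x - Leg.m n x) (\<lambda>x. Sob.m n x - Leg.m n x) \<noteq> 0"
    using m_eq_if_small[OF p(1)] legendre_neq_sobolev by metis
  thus "(norm2 (Leg.m n))\<^sup>2 < (norm2 (Sob.m n))\<^sup>2"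
    unfolding norm2_sq[OF Leg.S_m] norm2_sq[OF Sob.S_m] using p(2) 0 by linarith
qed

lemma m_0: "Leg.m 0 = monomial k 0" "Sob.m 0 = monomial k 0"
  by (subst monic_orth.simps, simp)+

text \<open>The first Gram-Schmidt step involves only inner products with \<open>P\<^sub>0\<close>,
  where the Sobolev term vanishes because \<open>\<Delta> P\<^sub>0 = 0\<close>.\<close>

lemma m_1: "Leg.m 1 = Sob.m 1"
proof -
  have "ipS chi u (monomial k 0) = ip2 u (monomial k 0)" for u
    unfolding ipS_eq laplacian_mono(2) by (simp add: ip2_eq)
  moreover have "Leg.m 1 = (\<lambda>x. monomial k 1 x - ip2 (monomial k 1) (monomial k 0) / ip2 (monomial k 0) (monomial k 0) * monomial k 0 x)"
    by (subst monic_orth.simps) (simp add: m_0)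
  moreover have "Sob.m 1 = (\<lambda>x. monomial k 1 x - ipS chi (monomial k 1) (monomial k 0) / ipS chi (monomial k 0) (monomial k 0) * monomial k 0 x)"
    by (subst monic_orth.simps) (simp add: m_0)
  ultimately show ?thesis by simp
qed

text \<open>The Laplacian of \<open>Sob.m n\<close> is monic of degree \<open>n - 1\<close> and so
  has positive norm.\<close>

lemma sobolev_norm2_normS: "n \<ge> 1 \<Longrightarrow> (norm2 (Sob.m n))\<^sup>2 < (normS chi (Sob.m n))\<^sup>2"
proof -
  assume "n \<ge> 1"
  then obtain j where j: "n = Suc j" by (cases n) auto
  have m: "Leg.spn (Suc j) (\<lambda>x. Sob.m n x + (-1) * monomial k (Suc j) x)"
    using Sob.m_monic[of n] unfolding Leg.spn_def Sob.spn_def j .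
  have "ip2 (laplacian (Sob.m n)) (laplacian (Sob.m n)) > 0" by (rule monic_pos[OF laplacian_monic[OF m]])
  thus ?thesis unfolding norm2_sq[OF Sob.S_m] normS_sq[OF Sob.S_m] ipS_eq using chi by simp
qed

text \<open>Equality would make \<open>monomial k n\<close> Sobolev-orthogonal to the harmonic
  function \<open>monomial k 0\<close>, hence also orthogonal in \<open>L^2\<close>, contrary to
  \<open>ip2_mono_nonzero\<close>.\<close>

lemma sobolev_lt_monomial: "n \<ge> 1 \<Longrightarrow> (normS chi (Sob.m n))\<^sup>2 < (normS chi (monomial k n))\<^sup>2"
proof -
  assume n: "n \<ge> 1"
  have m: "Sob.spn n (\<lambda>x. monomial k n x + (-1) * monomial k n x)" using Sob.spn_0 by simp
  note p = Sob.monic_pythagoras[OF m]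
  have s: "Leg.spn n (\<lambda>x. monomial k n x - Sob.m n x)" using p(1) unfolding Leg.spn_def Sob.spn_def .
  note pp = spn_poly[OF s]
  have "ipS chi (\<lambda>x. monomial k n x - Sob.m n x) (\<lambda>x. monomial k n x - Sob.m n x) \<noteq> 0"
  proof
    assume "ipS chi (\<lambda>x. monomial k n x - Sob.m n x) (\<lambda>x. monomial k n x - Sob.m n x) = 0"
    hence "ip2 (\<lambda>x. monomial k n x - Sob.m n x) (\<lambda>x. monomial k n x - Sob.m n x) = 0"
      using ipS_ge_ip2[OF pp] ip2_nonneg[OF poly_cont(1)[OF pp]] by linarith
    hence "monomial k n = Sob.m n" by (rule m_eq_if_small[OF s])
    hence "ipS chi (monomial k n) (monomial k 0) = 0" using Sob.m_orth_v[of 0 n] n by simp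
    hence "ip2 (monomial k n) (monomial k 0) = 0"
      unfolding ipS_eq laplacian_mono(2) by (simp add: ip2_eq)
    thus False using ip2_mono_nonzero by blast
  qed
  thus ?thesis using p(2) Sob.B_nonneg[OF pp] unfolding normS_sq[OF Sob.S_m] normS_sq[OF poly_mono] by linarith
qed

lemma monomial_normS:
  "(normS chi (monomial k n))\<^sup>2 = (norm2 (monomial k n))\<^sup>2
     + chi * (norm2 (case n of 0 \<Rightarrow> (\<lambda>_. 0) | Suc m \<Rightarrow> monomial k m))\<^sup>2"
proof (cases n)
  case 0
  thus ?thesis unfolding 0 normS_sq[OF poly_mono] norm2_sq[OF poly_mono] ipS_eq laplacian_mono
    by (simp add: ip2_eq norm2_def)
next
  case (Suc m)
  thus ?thesis unfolding Suc normS_sq[OF poly_mono] norm2_sq[OF poly_mono] ipS_eq laplacian_mono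
    by (simp add: norm2_sq[OF poly_mono])
qed

end

theorem theorem3p1:
  fixes chi :: real
  assumes "chi > 0"
  shows "(\<forall>k\<in>{1,2,3}. \<forall>n.
      (2 \<le> n \<longrightarrow>
         (norm2 (legendre n k))\<^sup>2 < (norm2 (sobolev_legendre chi n k))\<^sup>2 \<and>
         (norm2 (sobolev_legendre chi n k))\<^sup>2 < (normS chi (sobolev_legendre chi n k))\<^sup>2 \<and>
         (normS chi (sobolev_legendre chi n k))\<^sup>2 < (normS chi (Pmon n k))\<^sup>2) \<and>
      (n = 1 \<longrightarrow>
         (norm2 (legendre n k))\<^sup>2 = (norm2 (sobolev_legendre chi n k))\<^sup>2 \<and>
         (norm2 (sobolev_legendre chi n k))\<^sup>2 < (normS chi (sobolev_legendre chi n k))\<^sup>2 \<and>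
         (normS chi (sobolev_legendre chi n k))\<^sup>2 < (normS chi (Pmon n k))\<^sup>2) \<and>
      (n = 0 \<longrightarrow>
         (norm2 (legendre n k))\<^sup>2 = (norm2 (sobolev_legendre chi n k))\<^sup>2 \<and>
         (norm2 (sobolev_legendre chi n k))\<^sup>2 = (normS chi (sobolev_legendre chi n k))\<^sup>2 \<and>
         (normS chi (sobolev_legendre chi n k))\<^sup>2 = (normS chi (Pmon n k))\<^sup>2) \<and>
      (normS chi (Pmon n k))\<^sup>2 =
         (norm2 (Pmon n k))\<^sup>2 + chi * (norm2 (case n of 0 \<Rightarrow> (\<lambda>_. 0) | Suc m \<Rightarrow> Pmon m k))\<^sup>2)
    \<and> (\<exists>c1>0. \<forall>r>0. \<exists>cr>0. \<forall>k\<in>{1,2,3}. \<forall>n\<ge>1.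
         normS chi (sobolev_legendre chi n k)
           < (1 + chi) * (c1 * fact (n - 1) powr (- (ln 5 / ln 2)) + cr * r powi (- int n)))
    \<and> (\<forall>k\<in>{1,2,3}. (\<lambda>n. normS chi (sobolev_legendre chi n k)) \<longlonglongrightarrow> 0 \<and>
         (\<lambda>n. norm2 (sobolev_legendre chi n k)) \<longlonglongrightarrow> 0)"
proof (intro conjI, goal_cases)
  case 1
  show ?case
  proof (intro ballI allI, goal_cases)
    case (1 k n)
    from this assms interpret monomial_family k chi by (rule monomial_family.intro)
    \<comment> \<open>In degree 0 the polynomial is harmonic, so that the Laplacian contributes
      nothing to the Sobolev norm.\<close>
    have "(norm2 (monomial k 0))\<^sup>2 = (normS chi (monomial k 0))\<^sup>2"
      using monomial_normS[of 0] by (simp add: norm2_def ip2_eq)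
    thus ?case
      unfolding legendre_eq sobolev_eq Pmon_mono
      using legendre_le_sobolev(2)[of n] sobolev_norm2_normS[of n] sobolev_lt_monomial[of n]
        monomial_normS[of n] m_1 m_0 by (auto)
  qed
next
  case 2
  show ?case
  \<comment> \<open>\<open>c1\<close> is chosen before \<open>r\<close>. The geometric summand alone
    dominates the norm, so any positive number will do for \<open>c1\<close>.\<close>
  proof (rule exI[of _ 1], intro conjI allI impI)
    fix r :: real assume r: "r > 0"
    have "\<exists>C>0. \<forall>n\<ge>1. normS chi (sobolev_legendre chi n k) < C * r powi (- int n)" if "k \<in> {1, 2, 3}" for k
    proof -
      interpret monomial_family k chi using that assms by (rule monomial_family.intro)
      show ?thesis unfolding sobolev_eq by (rule normS_decay[OF r])
    qed
    then obtain C where C: "\<And>k. k \<in> {1, 2, 3} \<Longrightarrow> C k > 0"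
      "\<And>k n. k \<in> {1, 2, 3} \<Longrightarrow> n \<ge> 1 \<Longrightarrow> normS chi (sobolev_legendre chi n k) < C k * r powi (- int n)" by metis
    \<comment> \<open>One constant has to serve all three families.\<close>
    define cr where "cr = C 1 + C 2 + C 3"
    have "C 1 > 0" "C 2 > 0" "C 3 > 0" using C(1) by auto
    hence cr: "cr > 0" "\<And>k. k \<in> {1, 2, 3} \<Longrightarrow> C k \<le> cr" unfolding cr_def by auto
    show "\<exists>cr>0. \<forall>k\<in>{1,2,3}. \<forall>n\<ge>1. normS chi (sobolev_legendre chi n k)
           < (1 + chi) * (1 * fact (n - 1) powr (- (ln 5 / ln 2)) + cr * r powi (- int n))"
    proof (intro exI[of _ cr] conjI ballI allI impI)
      fix k n assume k: "k \<in> {1, 2, 3::nat}" and n: "n \<ge> (1::nat)"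
      let ?s = "1 * fact (n - 1) powr (- (ln 5 / ln 2)) + cr * r powi (- int n)"
      have p: "r powi (- int n) > 0" using r by simp
      have f: "fact (n - 1) powr (- (ln 5 / ln 2)) > (0::real)" by simp
      have "normS chi (sobolev_legendre chi n k) < C k * r powi (- int n)" by (rule C(2)[OF k n])
      also have "\<dots> \<le> cr * r powi (- int n)" using cr(2)[OF k] p by (intro mult_right_mono) auto
      also have "\<dots> \<le> 1 * ?s" using f by simp
      also have "\<dots> \<le> (1 + chi) * ?s"
        using assms f p cr(1) by (intro mult_right_mono add_nonneg_nonneg mult_nonneg_nonneg) auto
      finally show "normS chi (sobolev_legendre chi n k) < (1 + chi) * ?s" .
    qed (rule cr(1))
  qed simp
next
  case 3
  show ?case
  proof
    fix k assume "k \<in> {1, 2, 3::nat}"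
    from this assms interpret monomial_family k chi by (rule monomial_family.intro)
    show "(\<lambda>n. normS chi (sobolev_legendre chi n k)) \<longlonglongrightarrow> 0 \<and> (\<lambda>n. norm2 (sobolev_legendre chi n k)) \<longlonglongrightarrow> 0"
      unfolding sobolev_eq using normS_tendsto_0 by blast
  qed
qed

end
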